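(* Let $\mathcal A$ be an essential arrangement of $d$ lines in $\mathbb P^2_k$, $L\in\mathcal A$ and $\mathcal A''=\mathcal A|_L$. If $d$ is odd, then $L\in j_{\mathcal D}$ if and only if either $|\mathcal A''|\ge\frac{d+3}{2}$ or $\det\alpha_L=0$, where $$\alpha_L:\ H^0\!\left(\mathcal O_L\!\left(\tfrac{d-1}{2}-|\mathcal A''|\right)\right)\longrightarrow H^1\!\left(\mathcal O_L\!\left(|\mathcal A''|-\tfrac{d+3}{2}\right)\right).$$ If $d$ is even, then $L\in j_{\mathcal D}$ if and only if either $|\mathcal A''|\ge\frac{d+4}{2}$ or $\mathrm{rank}\,\alpha_L<\frac d2-|\mathcal A''|$, where $$\alpha_L:\ H^0\!\left(\mathcal O_L\!\left(\tfrac{d-2}{2}-|\mathcal A''|\right)\right)\longrightarrow H^1\!\left(\mathcal O_L\!\left(|\mathcal A''|-\tfrac{d+4}{2}\right)\right).$$ Here $\alpha_L$ is the connecting homomorphism described in the context.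
   Context: $k$ is a field of characteristic $0$, $R=k[x_0,x_1,x_2]$. An arrangement $\mathcal A$ of $d$ lines in $\mathbb P^2_k$ is a set of $d$ distinct lines, with defining polynomial $Q\in R_d$ the product of the $d$ linear forms; it is essential if the lines do not all pass through one point. $D(\mathcal A)=\{\theta\in\mathrm{Der}_k(R):\theta(Q)\in\langle Q\rangle\}$, graded by $\deg(\sum f_i\,\partial/\partial x_i)=\deg f_i$, and $\theta_E=\sum x_i\,\partial/\partial x_i$. $D(\mathcal A)=D_0\oplus R\theta_E$ with $D_0=\{\theta:\theta(Q)=0\}$, and $\mathcal D$ is the sheaf on $\mathbb P^2$ associated to $D_0\cong D(\mathcal A)/R\theta_E$; it is a rank two bundle with $c_1(\mathcal D)=-(d-1)$. For $L\in\mathcal A$, $\mathcal A''=\mathcal A|_L$ is the set of distinct points in which the other lines of $\mathcal A$ meet $L$. Normalization: for a rank two bundle $\mathcal F$ on $\mathbb P^2$, $\mathcal F_{norm}=\mathcal F(k_{\mathcal F})$ with $k_{\mathcal F}=-c_1(\mathcal F)/2$ if $c_1(\mathcal F)$ is even and $k_{\mathcal F}=-(c_1(\mathcal F)+1)/2$ if $c_1(\mathcal F)$ is odd. Thus $k_{\mathcal D}=\frac{d-1}{2}$ for $d$ odd and $k_{\mathcal D}=\frac{d-2}{2}$ for $d$ even. Jump lines: $j_{\mathcal D}$ is the set of lines $L\subset\mathbb P^2$ with $H^0(\mathcal D_{norm}(-1)|_L)\neq0$. The map $\alpha_L$: let $i:L\hookrightarrow\mathbb P^2$ be the inclusion and $S=R/\alpha$,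 where $\alpha$ is the linear form of $L$. Restricting derivations modulo $\alpha$ gives a map $D(\mathcal A)\to D(\mathcal A'')$, where $D(\mathcal A'')\subseteq\mathrm{Der}_k(S)$ is the module of derivations $\theta$ with $\theta(Q'')\in\langle Q''\rangle$, $Q''\in S$ being the product of the linear forms of the points of $\mathcal A''$. After dividing by the Euler derivations this induces a surjection $\mathcal D\to i_*\mathcal D''$, where $\mathcal D''$ is the sheaf on $L$ associated to $D(\mathcal A'')/S\theta_E$ and $\mathcal D''\simeq\mathcal O_L(1-|\mathcal A''|)$. Restricting this surjection to $L$ and twisting by $k_{\mathcal D}-1$ yields an exact sequence on $L\simeq\mathbb P^1$ $$0\to\mathcal O_L\!\left(|\mathcal A''|-\tfrac{d+3}{2}\right)\to\mathcal D_{norm}(-1)|_L\to\mathcal O_L\!\left(\tfrac{d-1}{2}-|\mathcal A''|\right)\to0\quad(d\text{ odd}),$$ $$0\to\mathcal O_L\!\left(|\mathcal A''|-\tfrac{d+4}{2}\right)\to\mathcal D_{norm}(-1)|_L\to\mathcal O_L\!\left(\tfrac{d-2}{2}-|\mathcal A''|\right)\to0\quad(d\text{ even}),$$ and $\alpha_L$ is the connecting homomorphism of its long exact cohomology sequence. For $d$ odd and $|\mathcal A''|\le\frac{d+1}{2}$ its source and target have equal dimension, so the vanishing of $\det\alpha_L$ makes sense (the determinant of the map between zero spaces being $1$). *)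

theory Defs
  imports
    "HOL-Library.Poly_Mapping"
    "HOL-Library.Numeral_Type"
    "HOL-Algebra.AbelCoset"
    "Jordan_Normal_Form.VS_Connect"
begin

section \<open>Polynomial rings and derivations\<close>

text \<open>Polynomials over \<open>'k\<close> in variables indexed by \<open>'n\<close>. The ring \<open>R = k[x0,x1,x2]\<close> is
  \<open>(3, 'k) mpol\<close> and the coordinate ring \<open>S = k[s,t]\<close> of a line is \<open>(2, 'k) mpol\<close>.\<close>

type_synonym ('n, 'k) mpol = "('n \<Rightarrow>\<^sub>0 nat) \<Rightarrow>\<^sub>0 'k"

definition Const :: "'k::comm_ring_1 \<Rightarrow> ('n, 'k) mpol" where
  "Const c = Poly_Mapping.single 0 c"

definition Var :: "'n \<Rightarrow> ('n, 'k::comm_ring_1) mpol" where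
  "Var i = Poly_Mapping.single (Poly_Mapping.single i 1) 1"

definition mon_deg :: "('n::finite \<Rightarrow>\<^sub>0 nat) \<Rightarrow> nat" where
  "mon_deg m = (\<Sum>i\<in>UNIV. Poly_Mapping.lookup m i)"

definition homog :: "int \<Rightarrow> ('n::finite, 'k::comm_ring_1) mpol \<Rightarrow> bool" where
  "homog n f \<longleftrightarrow> (\<forall>m \<in> Poly_Mapping.keys f. int (mon_deg m) = n)"

definition lin_form :: "('n::finite \<Rightarrow> 'k::comm_ring_1) \<Rightarrow> ('n, 'k) mpol" where
  "lin_form a = (\<Sum>i\<in>UNIV. Const (a i) * Var i)"

definition subst :: "('n::finite \<Rightarrow> ('m, 'k::comm_ring_1) mpol) \<Rightarrow> ('n, 'k) mpol \<Rightarrow> ('m, 'k) mpol" where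
  "subst g f = (\<Sum>m\<in>Poly_Mapping.keys f. Const (Poly_Mapping.lookup f m) * (\<Prod>i\<in>UNIV. g i ^ Poly_Mapping.lookup m i))"

definition partial :: "'n \<Rightarrow> ('n, 'k::comm_ring_1) mpol \<Rightarrow> ('n, 'k) mpol" where
  "partial i f = (\<Sum>m\<in>Poly_Mapping.keys f.
     Poly_Mapping.single (m - Poly_Mapping.single i 1) (of_nat (Poly_Mapping.lookup m i) * Poly_Mapping.lookup f m))"

definition Der :: "(('n, 'k::comm_ring_1) mpol \<Rightarrow> ('n, 'k) mpol) set" where
  "Der = {\<theta>. (\<forall>f g. \<theta> (f + g) = \<theta> f + \<theta> g) \<and> (\<forall>c f. \<theta> (Const c * f) = Const c * \<theta> f) \<and>
             (\<forall>f g. \<theta> (f * g) = f * \<theta> g + \<theta> f * g)}"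

definition euler :: "('n::finite, 'k::comm_ring_1) mpol \<Rightarrow> ('n, 'k) mpol" where
  "euler f = (\<Sum>i\<in>UNIV. Var i * partial i f)"

definition log_der :: "('n, 'k::comm_ring_1) mpol \<Rightarrow> (('n, 'k) mpol \<Rightarrow> ('n, 'k) mpol) set" where
  "log_der Q = {\<theta> \<in> Der. Q dvd \<theta> Q}"

definition log_der0 :: "('n, 'k::comm_ring_1) mpol \<Rightarrow> (('n, 'k) mpol \<Rightarrow> ('n, 'k) mpol) set" where
  "log_der0 Q = {\<theta> \<in> Der. \<theta> Q = 0}"


section \<open>Graded modules\<close>

record ('r, 'm) graded_module = "('r, 'm) module" +
  component :: "int \<Rightarrow> 'm set"

text \<open>A module of derivations, graded by the degree of the coefficients \<open>\<theta> (x_i)\<close>.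
  The multiplicative fields of a module record carry no meaning.\<close>

definition der_module :: "(('n::finite, 'k::comm_ring_1) mpol \<Rightarrow> ('n, 'k) mpol) set
    \<Rightarrow> (('n, 'k) mpol, ('n, 'k) mpol \<Rightarrow> ('n, 'k) mpol) graded_module" where
  "der_module N = \<lparr> carrier = N, mult = undefined, one = undefined,
     zero = (\<lambda>f. 0), add = (\<lambda>\<theta> \<eta> f. \<theta> f + \<eta> f), smult = (\<lambda>r \<theta> f. r * \<theta> f),
     component = (\<lambda>n. {\<theta> \<in> N. \<forall>i. homog n (\<theta> (Var i))}) \<rparr>"

text \<open>The quotient \<open>M / N\<close>, as a module over the target of a surjective ring homomorphism \<open>\<rho>\<close>
  whose kernel annihilates \<open>M / N\<close>; an ordinary quotient is the case \<open>\<rho> = id\<close>.\<close>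

definition quotient_via :: "('r \<Rightarrow> 's) \<Rightarrow> ('r, 'm, 'z) module_scheme \<Rightarrow> 'm set \<Rightarrow> ('s, 'm set) module" where
  "quotient_via \<rho> M N = \<lparr> carrier = a_rcosets\<^bsub>M\<^esub> N, mult = undefined, one = undefined,
     zero = N, add = (\<lambda>X Y. X <+>\<^bsub>M\<^esub> Y),
     smult = (\<lambda>s X. \<Union>{N +>\<^bsub>M\<^esub> (r \<odot>\<^bsub>M\<^esub> x) | r x. \<rho> r = s \<and> x \<in> X}) \<rparr>"

definition graded_quotient_via ::
  "('r \<Rightarrow> 's) \<Rightarrow> ('r, 'm) graded_module \<Rightarrow> 'm set \<Rightarrow> ('s, 'm set) graded_module" where
  "graded_quotient_via \<rho> M N = module.extend (quotient_via \<rho> M N)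
     (graded_module.fields (\<lambda>n. (\<lambda>x. N +>\<^bsub>M\<^esub> x) ` component M n))"

definition kernel_module ::
  "('r, 'm) graded_module \<Rightarrow> ('r, 'm2) graded_module \<Rightarrow> ('m \<Rightarrow> 'm2) \<Rightarrow> ('r, 'm) graded_module" where
  "kernel_module M M2 \<phi> = M \<lparr> carrier := {x \<in> carrier M. \<phi> x = \<zero>\<^bsub>M2\<^esub>},
     component := (\<lambda>n. {x \<in> component M n. \<phi> x = \<zero>\<^bsub>M2\<^esub>}) \<rparr>"


section \<open>Cohomology of the sheaf of a graded module on the projective line\<close>

text \<open>For a graded module \<open>M\<close> over \<open>S = k[s,t]\<close>, the sections of the twisted sheaf \<open>M~(n)\<close> over
  the open set \<open>f \<noteq> 0\<close> (\<open>f\<close> homogeneous of degree \<open>e\<close>) form the degree \<open>n\<close> part of the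
  localization \<open>M_f\<close>. The element \<open>m / f^j\<close> is the equivalence class of the pair \<open>(m, j)\<close>.\<close>

definition frac :: "('r::comm_ring_1, 'm) graded_module \<Rightarrow> 'r \<Rightarrow> 'm \<Rightarrow> nat \<Rightarrow> ('m \<times> nat) set" where
  "frac M f m j = {(m', j'). m' \<in> carrier M \<and>
     (\<exists>i. f ^ (i + j') \<odot>\<^bsub>M\<^esub> m = f ^ (i + j) \<odot>\<^bsub>M\<^esub> m')}"

definition sections :: "(('n, 'k::comm_ring_1) mpol, 'm) graded_module \<Rightarrow> ('n, 'k) mpol \<Rightarrow> nat \<Rightarrow> int
    \<Rightarrow> ('k, ('m \<times> nat) set) module" where
  "sections M f e n = \<lparr> carrier = {frac M f m j | m j. m \<in> component M (n + int (e * j))},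
     mult = undefined, one = undefined, zero = frac M f \<zero>\<^bsub>M\<^esub> 0,
     add = (\<lambda>X Y. \<Union>{frac M f (f ^ j' \<odot>\<^bsub>M\<^esub> m \<oplus>\<^bsub>M\<^esub> f ^ j \<odot>\<^bsub>M\<^esub> m') (j + j') | m j m' j'.
               (m, j) \<in> X \<and> (m', j') \<in> Y}),
     smult = (\<lambda>c X. \<Union>{frac M f (Const c \<odot>\<^bsub>M\<^esub> m) j | m j. (m, j) \<in> X}) \<rparr>"

text \<open>The restriction of sections from \<open>f \<noteq> 0\<close> to \<open>f g \<noteq> 0\<close> sends \<open>m / f^j\<close> to \<open>g^j m / (f g)^j\<close>.\<close>

definition sec_res :: "('r::comm_ring_1, 'm) graded_module \<Rightarrow> 'r \<Rightarrow> 'r \<Rightarrow> ('m \<times> nat) set \<Rightarrow> ('m \<times> nat) set" where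
  "sec_res M f g X = \<Union>{frac M (f * g) (g ^ j \<odot>\<^bsub>M\<^esub> m) j | m j. (m, j) \<in> X}"

text \<open>The action on sections of a homomorphism \<open>\<phi>\<close> into \<open>M2\<close>.\<close>

definition sec_map :: "('r::comm_ring_1, 'm2) graded_module \<Rightarrow> ('m \<Rightarrow> 'm2) \<Rightarrow> 'r
    \<Rightarrow> ('m \<times> nat) set \<Rightarrow> ('m2 \<times> nat) set" where
  "sec_map M2 \<phi> f X = \<Union>{frac M2 f (\<phi> m) j | m j. (m, j) \<in> X}"

abbreviation s_var :: "(2, 'k::comm_ring_1) mpol" where "s_var \<equiv> Var 0"
abbreviation t_var :: "(2, 'k::comm_ring_1) mpol" where "t_var \<equiv> Var 1"

text \<open>The Cech complex of \<open>M~(n)\<close> for the covering of the line by \<open>s \<noteq> 0\<close> and \<open>t \<noteq> 0\<close>.\<close>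

definition cech0 :: "((2, 'k::comm_ring_1) mpol, 'm) graded_module \<Rightarrow> int
    \<Rightarrow> ('k, ('m \<times> nat) set \<times> ('m \<times> nat) set) module" where
  "cech0 M n = direct_sum (sections M s_var 1 n) (sections M t_var 1 n)"

definition cech1 :: "((2, 'k::comm_ring_1) mpol, 'm) graded_module \<Rightarrow> int
    \<Rightarrow> ('k, ('m \<times> nat) set) module" where
  "cech1 M n = sections M (s_var * t_var) 2 n"

definition cech_d :: "((2, 'k::comm_ring_1) mpol, 'm) graded_module \<Rightarrow> int
    \<Rightarrow> ('m \<times> nat) set \<times> ('m \<times> nat) set \<Rightarrow> ('m \<times> nat) set" where
  "cech_d M n z = sec_res M t_var s_var (snd z) \<ominus>\<^bsub>cech1 M n\<^esub> sec_res M s_var t_var (fst z)"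

definition H0 :: "((2, 'k::comm_ring_1) mpol, 'm) graded_module \<Rightarrow> int
    \<Rightarrow> ('k, ('m \<times> nat) set \<times> ('m \<times> nat) set) module" where
  "H0 M n = (cech0 M n) \<lparr> carrier := {z \<in> carrier (cech0 M n). cech_d M n z = \<zero>\<^bsub>cech1 M n\<^esub>} \<rparr>"

definition H1 :: "((2, 'k::comm_ring_1) mpol, 'm) graded_module \<Rightarrow> int
    \<Rightarrow> ('k, ('m \<times> nat) set set) module" where
  "H1 M n = quotient_via id (cech1 M n) (cech_d M n ` carrier (cech0 M n))"

text \<open>For a homomorphism \<open>\<phi>\<close> from \<open>M\<close> to \<open>M2\<close> inducing a surjection of sheaves, with kernel \<open>K\<close>,
  the connecting homomorphism \<open>H0 (M2~(n)) \<rightarrow> H1 (K~(n))\<close> of the exact sequence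
  \<open>0 \<rightarrow> K~(n) \<rightarrow> M~(n) \<rightarrow> M2~(n) \<rightarrow> 0\<close>: lift \<open>c\<close> to a cochain \<open>b\<close> of \<open>M~(n)\<close>; its coboundary comes
  from a cochain \<open>a\<close> of \<open>K~(n)\<close>, and the value at \<open>c\<close> is the class of \<open>a\<close>.\<close>

definition connecting :: "((2, 'k::comm_ring_1) mpol, 'm) graded_module
    \<Rightarrow> ((2, 'k) mpol, 'm2) graded_module \<Rightarrow> ('m \<Rightarrow> 'm2) \<Rightarrow> int
    \<Rightarrow> ('m2 \<times> nat) set \<times> ('m2 \<times> nat) set \<Rightarrow> ('m \<times> nat) set set" where
  "connecting M M2 \<phi> n c = (let K = kernel_module M M2 \<phi> in
     THE h. \<exists>b \<in> carrier (cech0 M n). \<exists>a \<in> carrier (cech1 K n).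
       map_prod (sec_map M2 \<phi> s_var) (sec_map M2 \<phi> t_var) b = c \<and>
       sec_map M id (s_var * t_var) a = cech_d M n b \<and>
       h = cech_d K n ` carrier (cech0 K n) +>\<^bsub>cech1 K n\<^esub> a)"


section \<open>Rank and determinant of a linear map\<close>

definition lin_rank :: "('k::field, 'w, 'z) module_scheme \<Rightarrow> ('v \<Rightarrow> 'w) \<Rightarrow> ('k, 'v, 'y) module_scheme \<Rightarrow> nat" where
  "lin_rank W T V = vectorspace.dim class_ring (W \<lparr> carrier := T ` carrier V \<rparr>)"

definition ordered_basis :: "('k::field, 'v, 'z) module_scheme \<Rightarrow> nat \<Rightarrow> (nat \<Rightarrow> 'v) \<Rightarrow> bool" where
  "ordered_basis V n v \<longleftrightarrow> inj_on v {..<n} \<and> vectorspace.basis class_ring V (v ` {..<n})"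

text \<open>\<open>det T = 0\<close> for a linear map between spaces of the same finite dimension, which need not be
  equal: the matrix of \<open>T\<close> with respect to some (equivalently, any) pair of bases has determinant 0.\<close>

definition det_vanishes :: "('k::field, 'v, 'y) module_scheme \<Rightarrow> ('k, 'w, 'z) module_scheme \<Rightarrow> ('v \<Rightarrow> 'w) \<Rightarrow> bool" where
  "det_vanishes V W T \<longleftrightarrow> (\<exists>n v w. \<exists>A \<in> carrier_mat n n.
     ordered_basis V n v \<and> ordered_basis W n w \<and>
     (\<forall>j<n. T (v j) = finsum W (\<lambda>i. A $$ (i, j) \<odot>\<^bsub>W\<^esub> w i) {..<n}) \<and>
     det A = 0)"


section \<open>Line arrangements\<close>

text \<open>A line of the projective plane is represented by the plane \<open>ker \<alpha>\<close> in \<open>k^3\<close>, and a point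
  of the projective plane by a one-dimensional subspace of \<open>k^3\<close>.\<close>

definition ker_form :: "(3 \<Rightarrow> 'k::field) \<Rightarrow> (3 \<Rightarrow> 'k) set" where
  "ker_form a = {x. (\<Sum>i\<in>UNIV. a i * x i) = 0}"

definition is_line :: "(3 \<Rightarrow> 'k::field) set \<Rightarrow> bool" where
  "is_line L \<longleftrightarrow> (\<exists>a. a \<noteq> (\<lambda>i. 0) \<and> L = ker_form a)"

definition line_arrangement :: "(3 \<Rightarrow> 'k::field) set set \<Rightarrow> bool" where
  "line_arrangement A \<longleftrightarrow> finite A \<and> (\<forall>L\<in>A. is_line L)"

definition essential :: "(3 \<Rightarrow> 'k::field) set set \<Rightarrow> bool" where
  "essential A \<longleftrightarrow> \<not> (\<exists>x. x \<noteq> (\<lambda>i. 0) \<and> (\<forall>L\<in>A. x \<in> L))"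

text \<open>The linear form of a line is determined up to a nonzero scalar, and the choice of an
  isomorphism of \<open>L\<close> with the projective line up to a linear change of \<open>s, t\<close>; we fix one choice
  of each.\<close>

definition line_form :: "(3 \<Rightarrow> 'k::field) set \<Rightarrow> (3, 'k) mpol" where
  "line_form L = lin_form (SOME a. a \<noteq> (\<lambda>i. 0) \<and> L = ker_form a)"

definition line_basis :: "(3 \<Rightarrow> 'k::field) set \<Rightarrow> (3 \<Rightarrow> 'k) \<times> (3 \<Rightarrow> 'k)" where
  "line_basis L = (SOME (p, q). L = {\<lambda>i. u * p i + v * q i | u v. True})"

text \<open>The restriction \<open>R \<rightarrow> S\<close> of functions to \<open>L\<close>, surjective with kernel generated by
  \<open>line_form L\<close>; it identifies \<open>S = k[s,t]\<close> with \<open>R / \<alpha>\<close>.\<close>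

definition res_fun :: "(3 \<Rightarrow> 'k::field) set \<Rightarrow> (3, 'k) mpol \<Rightarrow> (2, 'k) mpol" where
  "res_fun L = (case line_basis L of (p, q) \<Rightarrow>
     subst (\<lambda>i. Const (p i) * s_var + Const (q i) * t_var))"

definition def_poly :: "(3 \<Rightarrow> 'k::field) set set \<Rightarrow> (3, 'k) mpol" where
  "def_poly A = (\<Prod>L\<in>A. line_form L)"

definition restricted_arr :: "(3 \<Rightarrow> 'k::field) set set \<Rightarrow> (3 \<Rightarrow> 'k) set \<Rightarrow> (3 \<Rightarrow> 'k) set set" where
  "restricted_arr A L = {L \<inter> H | H. H \<in> A - {L}}"

text \<open>The linear form in \<open>S\<close> of a point \<open>P\<close> of \<open>L\<close>: the restriction to \<open>L\<close> of the form of any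
  other line through \<open>P\<close>.\<close>

definition point_form :: "(3 \<Rightarrow> 'k::field) set \<Rightarrow> (3 \<Rightarrow> 'k) set \<Rightarrow> (2, 'k) mpol" where
  "point_form L P = res_fun L (line_form (SOME H. is_line H \<and> L \<inter> H = P))"

definition res_poly :: "(3 \<Rightarrow> 'k::field) set set \<Rightarrow> (3 \<Rightarrow> 'k) set \<Rightarrow> (2, 'k) mpol" where
  "res_poly A L = (\<Prod>P\<in>restricted_arr A L. point_form L P)"


section \<open>Jump lines and the connecting map of a line of the arrangement\<close>

definition D0 :: "(3 \<Rightarrow> 'k::field) set set
    \<Rightarrow> ((3, 'k) mpol, (3, 'k) mpol \<Rightarrow> (3, 'k) mpol) graded_module" where
  "D0 A = der_module (log_der0 (def_poly A))"

text \<open>The restriction of the sheaf of a graded \<open>R\<close>-module \<open>M\<close> to \<open>L\<close> is the sheaf of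
  \<open>M / \<alpha> M\<close> (the tensor product of \<open>M\<close> with \<open>R / \<alpha>\<close>), viewed as a graded \<open>S\<close>-module.\<close>

definition restrict_to_line :: "(3 \<Rightarrow> 'k::field) set \<Rightarrow> ((3, 'k) mpol, 'm) graded_module
    \<Rightarrow> ((2, 'k) mpol, 'm set) graded_module" where
  "restrict_to_line L M =
     graded_quotient_via (res_fun L) M ((\<lambda>x. line_form L \<odot>\<^bsub>M\<^esub> x) ` carrier M)"

definition norm_twist :: "int \<Rightarrow> int" where
  "norm_twist c1 = (if even c1 then - c1 div 2 else - (c1 + 1) div 2)"

text \<open>The first Chern class of the sheaf of \<open>D0 A\<close> is \<open>-(d - 1)\<close> for \<open>d\<close> lines.\<close>

definition twist_D :: "(3 \<Rightarrow> 'k::field) set set \<Rightarrow> int" where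
  "twist_D A = norm_twist (- (int (card A) - 1))"

definition jump_lines :: "(3 \<Rightarrow> 'k::field) set set \<Rightarrow> (3 \<Rightarrow> 'k) set set" where
  "jump_lines A = {L. is_line L \<and>
     (let H = H0 (restrict_to_line L (D0 A)) (twist_D A - 1) in carrier H \<noteq> {\<zero>\<^bsub>H\<^esub>})}"

definition euler_multiples :: "((2, 'k::comm_ring_1) mpol \<Rightarrow> (2, 'k) mpol) set" where
  "euler_multiples = {\<lambda>f. r * euler f | r. True}"

text \<open>The graded \<open>S\<close>-module \<open>D(A'') / S \<theta>_E\<close>, whose sheaf on \<open>L\<close> is isomorphic to
  the line bundle of degree \<open>1 - |A''|\<close>.\<close>

definition D_restricted :: "(3 \<Rightarrow> 'k::field) set set \<Rightarrow> (3 \<Rightarrow> 'k) set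
    \<Rightarrow> ((2, 'k) mpol, ((2, 'k) mpol \<Rightarrow> (2, 'k) mpol) set) graded_module" where
  "D_restricted A L = graded_quotient_via id (der_module (log_der (res_poly A L))) euler_multiples"

text \<open>The derivation of \<open>S\<close> induced by a derivation of \<open>R\<close> that preserves the ideal of \<open>L\<close>.\<close>

definition res_der :: "(3 \<Rightarrow> 'k::field) set \<Rightarrow> ((3, 'k) mpol \<Rightarrow> (3, 'k) mpol)
    \<Rightarrow> (2, 'k) mpol \<Rightarrow> (2, 'k) mpol" where
  "res_der L \<theta> = (THE \<eta>. \<forall>f. \<eta> (res_fun L f) = res_fun L (\<theta> f))"

definition res_map :: "(3 \<Rightarrow> 'k::field) set set \<Rightarrow> (3 \<Rightarrow> 'k) set
    \<Rightarrow> ((3, 'k) mpol \<Rightarrow> (3, 'k) mpol) set \<Rightarrow> ((2, 'k) mpol \<Rightarrow> (2, 'k) mpol) set" where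
  "res_map A L X =
     (\<Union>\<theta>\<in>X. euler_multiples +>\<^bsub>der_module (log_der (res_poly A L))\<^esub> res_der L \<theta>)"

definition res_kernel :: "(3 \<Rightarrow> 'k::field) set set \<Rightarrow> (3 \<Rightarrow> 'k) set
    \<Rightarrow> ((2, 'k) mpol, ((3, 'k) mpol \<Rightarrow> (3, 'k) mpol) set) graded_module" where
  "res_kernel A L = kernel_module (restrict_to_line L (D0 A)) (D_restricted A L) (res_map A L)"

text \<open>Source and target of \<open>\<alpha>_L\<close>. With \<open>h\<close> points in \<open>A''\<close> and \<open>d\<close> lines in \<open>A\<close>, the sheaves of
  \<open>D_restricted A L\<close> and \<open>res_kernel A L\<close> are isomorphic to the line bundles of degrees \<open>1 - h\<close> and
  \<open>h - d\<close>. After the twist by \<open>twist_D A - 1\<close> these are the outer terms of the exact sequence for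
  the restriction of \<open>D_norm(-1)\<close> to \<open>L\<close>, of degrees \<open>(d-1)/2 - h\<close> and \<open>h - (d+3)/2\<close> for \<open>d\<close> odd,
  \<open>(d-2)/2 - h\<close> and \<open>h - (d+4)/2\<close> for \<open>d\<close> even.\<close>

definition alpha_source where
  "alpha_source A L = H0 (D_restricted A L) (twist_D A - 1)"

definition alpha_target where
  "alpha_target A L = H1 (res_kernel A L) (twist_D A - 1)"

definition alpha_map where
  "alpha_map A L =
     connecting (restrict_to_line L (D0 A)) (D_restricted A L) (res_map A L) (twist_D A - 1)"

end

theory Submission
  imports Defs "HOL-Library.Product_Plus"
begin

text \<open>
  Write \<open>M\<close> for \<open>D0 / \<alpha> D0\<close>, \<open>M''\<close> for \<open>D(A'') / S \<theta>_E\<close>, \<open>K\<close> for the kernel of \<open>M \<rightarrow> M''\<close>, and \<open>n\<close> for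
  the twist. Two facts about the sequence \<open>0 \<rightarrow> K~ \<rightarrow> M~ \<rightarrow> M''~ \<rightarrow> 0\<close> suffice. It is exact on the charts
  \<open>s \<noteq> 0\<close> and \<open>t \<noteq> 0\<close>, so \<open>H0 (M~(n))\<close> is nonzero exactly if \<open>H0 (K~(n))\<close> is nonzero or \<open>\<alpha>_L\<close> is not
  injective. Its outer terms are line bundles: the determinant of a derivation with \<open>\<theta>_E\<close> identifies
  \<open>M''\<close> locally with \<open>Q'' S\<close>, where \<open>deg Q'' = h\<close>; and the elements of \<open>K\<close> restrict to multiples
  \<open>r \<theta>_E\<close>, where locally \<open>r\<close> ranges over \<open>B S\<close>, with \<open>B\<close> the product over the points of \<open>A''\<close> of their
  forms raised to the number of other lines through the point minus one, of degree \<open>d - 1 - h\<close>.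

  Hence \<open>H0 (K~(n))\<close> is nonzero exactly if \<open>n \<ge> d - h\<close>, which is the bound on \<open>h = |A''|\<close> in the theorem.
  For \<open>d\<close> odd the source and the target of \<open>\<alpha>_L\<close> have the same dimension, so failure of injectivity is
  the vanishing of the determinant; for \<open>d\<close> even it is a rank below the dimension \<open>d/2 - h\<close> of the source
  (and impossible if that number is negative, the source being zero).
\<close>

section \<open>Polynomials, derivations and binary forms\<close>

section \<open>Polynomials as finitely supported functions\<close>

text \<open>Each line bundle description is a pair of inclusions, valid after inverting
  \<open>s\<close> or \<open>t\<close>. One inclusion is divisibility: the determinant of a
  logarithmic derivation by Q'', and r by B when the derivation restricts to r \<theta>_E. For the
  other, the forms g for which Q'' g (or B g) is attained by a derivation of matching degree form a
  homogeneous ideal. At each point P of A'' an explicit derivation, a constant vector field times a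
  product of lines, puts a product of powers of the forms of the other points into this ideal. These
  products have no common zero, so the ideal contains powers of s and of t, and that is surjectivity
  on the two charts.

  The explicit derivations lie in D(A) rather than in D0. Subtracting a multiple of \<theta>_E
  repairs this and divides by the number of lines, whence characteristic 0. For the kernel this
  correction is the whole content: \<alpha> times a derivation vanishes on L, so only the Euler term
  survives restriction.\<close>

lemma mpol_additive_induct [case_names single add]:
  fixes f :: "('n, 'k::comm_ring_1) mpol"
  assumes S: "\<And>m c. P (Poly_Mapping.single m c)" and A: "\<And>f g. P f \<Longrightarrow> P g \<Longrightarrow> P (f + g)"
  shows "P f"
proof -
  have "P (\<Sum>m\<in>K. Poly_Mapping.single m (Poly_Mapping.lookup f m))" for K
    using S[of 0 0] by (induct K rule: infinite_finite_induct) (auto intro: S A)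
  moreover have "f = (\<Sum>m\<in>Poly_Mapping.keys f. Poly_Mapping.single m (Poly_Mapping.lookup f m))"
    by (rule poly_mapping_eqI) (auto simp: lookup_sum lookup_single when_def sum.delta in_keys_iff)
  ultimately show ?thesis by metis
qed

lemma Const_0 [simp]: "Const 0 = 0"
  and Const_1 [simp]: "Const 1 = 1"
  and Const_add: "Const (a + b) = Const a + Const b"
  and Const_mult: "Const (a * b) = Const a * Const b"
  and Const_uminus: "Const (- a) = - Const a"
  and Const_diff: "Const (a - b) = Const a - Const b"
  by (simp_all add: Const_def single_add mult_single single_uminus single_diff)

lemma Const_sum: "Const (\<Sum>i\<in>I. f i) = (\<Sum>i\<in>I. Const (f i))"
  by (induct I rule: infinite_finite_induct) (simp_all add: Const_add)

lemma Const_eq_iff [simp]: "Const a = (Const b :: ('n, 'k::comm_ring_1) mpol) \<longleftrightarrow> a = b"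
  by (auto simp: Const_def dest: injD[OF inj_single])

lemma Const_eq_0_iff [simp]: "Const a = (0 :: ('n, 'k::comm_ring_1) mpol) \<longleftrightarrow> a = 0"
  using Const_eq_iff[of a 0] by (simp del: Const_eq_iff)

lemma of_nat_Const: "of_nat n = Const (of_nat n)"
  by (induct n) (simp_all add: Const_add)

lemma lookup_single_times:
  fixes f :: "('n, 'k::comm_ring_1) mpol"
  shows "Poly_Mapping.lookup (Poly_Mapping.single a c * f) (a + m) = c * Poly_Mapping.lookup f m"
proof (induct f rule: mpol_additive_induct)
  case (single k v)
  then show ?case by (simp add: mult_single lookup_single when_def)
next
  case (add f g)
  then show ?case by (simp add: distrib_left lookup_add)
qed

lemma lookup_single_times_notin:
  fixes f :: "('n, 'k::comm_ring_1) mpol"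
  assumes "\<And>m'. m \<noteq> a + m'"
  shows "Poly_Mapping.lookup (Poly_Mapping.single a c * f) m = 0"
proof (induct f rule: mpol_additive_induct)
  case (single k v)
  then show ?case using assms[of k] by (simp add: mult_single lookup_single when_def)
next
  case (add f g)
  then show ?case by (simp add: distrib_left lookup_add)
qed

lemma lookup_Const_times [simp]:
  "Poly_Mapping.lookup (Const c * f) m = c * Poly_Mapping.lookup (f :: ('n, 'k::comm_ring_1) mpol) m"
  using lookup_single_times[of 0 c f m] by (simp add: Const_def)

lemma Var_power: "(Var i :: ('n, 'k::comm_ring_1) mpol) ^ a = Poly_Mapping.single (Poly_Mapping.single i a) 1"
  by (induct a) (simp_all add: Var_def mult_single single_add[symmetric] flip: single_one)

lemma prod_single:
  "(\<Prod>i\<in>I. Poly_Mapping.single (f i) (1::'k::comm_ring_1)) = Poly_Mapping.single (\<Sum>i\<in>I. f i) 1"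
  by (induct I rule: infinite_finite_induct) (simp_all add: mult_single)

lemma exponent_eq_sum: "(m :: 'n::finite \<Rightarrow>\<^sub>0 nat) = (\<Sum>i\<in>UNIV. Poly_Mapping.single i (Poly_Mapping.lookup m i))"
  by (rule poly_mapping_eqI) (simp add: lookup_sum lookup_single when_def)

lemma single_eq_monomial:
  "Poly_Mapping.single m c = Const (c::'k::comm_ring_1) * (\<Prod>i\<in>UNIV. Var i ^ Poly_Mapping.lookup (m :: 'n::finite \<Rightarrow>\<^sub>0 nat) i)"
  by (simp add: Var_power prod_single exponent_eq_sum[symmetric] Const_def mult_single)

lemma mpol_induct [case_names Const Var add mult]:
  fixes f :: "('n::finite, 'k::comm_ring_1) mpol"
  assumes C: "\<And>c. P (Const c)" and V: "\<And>i. P (Var i)"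
    and A: "\<And>f g. P f \<Longrightarrow> P g \<Longrightarrow> P (f + g)" and M: "\<And>f g. P f \<Longrightarrow> P g \<Longrightarrow> P (f * g)"
  shows "P f"
proof (induct f rule: mpol_additive_induct)
  case (single m c)
  have pow: "P (Var i ^ a)" for i a
    using C[of 1] by (induct a) (auto intro: V M)
  have "P (\<Prod>i\<in>I. Var i ^ Poly_Mapping.lookup m i)" for I
    using C[of 1] by (induct I rule: infinite_finite_induct) (auto intro: pow M)
  then show ?case by (auto simp: single_eq_monomial intro: C M)
next
  case (add f g)
  then show ?case by (auto intro: A)
qed

section \<open>Substitution\<close>

text \<open>\<open>subst\<close> sums over the monomials of its own argument; a common finite index
  set lets the sums for two polynomials be added termwise.\<close>

lemma subst_eq_sum:
  assumes "finite K" "Poly_Mapping.keys f \<subseteq> K"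
  shows "subst g f = (\<Sum>m\<in>K. Const (Poly_Mapping.lookup f m) * (\<Prod>i\<in>UNIV. g i ^ Poly_Mapping.lookup m i))"
  unfolding subst_def by (rule sum.mono_neutral_left) (use assms in \<open>auto simp: in_keys_iff\<close>)

lemma subst_add: "subst g (f + f') = subst g f + subst g f'"
proof -
  let ?K = "Poly_Mapping.keys f \<union> Poly_Mapping.keys f'"
  have "Poly_Mapping.keys (f + f') \<subseteq> ?K" by (rule keys_add)
  then show ?thesis
    by (simp add: subst_eq_sum[of ?K] lookup_add Const_add distrib_right sum.distrib)
qed

lemma subst_single: "subst g (Poly_Mapping.single m c) = Const c * (\<Prod>i\<in>UNIV. g i ^ Poly_Mapping.lookup m i)"
  by (cases "c = 0") (simp_all add: subst_def)

lemma subst_0 [simp]: "subst g 0 = 0"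
  by (simp add: subst_def)

lemma subst_mult: "subst g (f * f') = subst g f * subst g f'"
proof (induct f rule: mpol_additive_induct)
  case (single m c)
  show ?case
  proof (induct f' rule: mpol_additive_induct)
    case (single m' c')
    then show ?case
      by (simp add: mult_single subst_single Const_mult lookup_add power_add prod.distrib mult_ac)
  next
    case (add f g)
    then show ?case by (simp add: distrib_left subst_add)
  qed
next
  case (add f g)
  then show ?case by (simp add: distrib_right subst_add)
qed

lemma subst_Const [simp]: "subst g (Const c) = Const c"
  by (simp add: Const_def subst_single)

lemma subst_Var [simp]: "subst g (Var i) = g i"
proof -
  have "(\<Prod>j\<in>UNIV. g j ^ Poly_Mapping.lookup (Poly_Mapping.single i (1::nat)) j) = (\<Prod>j\<in>UNIV. if j = i then g i else 1)"
    by (rule prod.cong) (auto simp: lookup_single when_def)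
  then show ?thesis by (simp add: Var_def subst_single)
qed

lemma subst_1 [simp]: "subst g 1 = 1"
  using subst_Const[of g 1] by (simp del: subst_Const)

lemma subst_uminus: "subst g (- f) = - subst g f"
  using subst_add[of g f "- f"] by (simp add: eq_neg_iff_add_eq_0 add.commute)

lemma subst_diff: "subst g (f - f') = subst g f - subst g f'"
  using subst_add[of g f "- f'"] by (simp add: subst_uminus)

lemma subst_sum: "subst g (\<Sum>i\<in>I. f i) = (\<Sum>i\<in>I. subst g (f i))"
  by (induct I rule: infinite_finite_induct) (simp_all add: subst_add)

lemma subst_prod: "subst g (\<Prod>i\<in>I. f i) = (\<Prod>i\<in>I. subst g (f i))"
  by (induct I rule: infinite_finite_induct) (simp_all add: subst_mult)

lemma subst_power: "subst g (f ^ a) = subst g f ^ a"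
  by (induct a) (simp_all add: subst_mult)

lemmas subst_simps = subst_add subst_mult subst_diff subst_uminus subst_sum subst_prod subst_power

text \<open>This is how kernels of restriction maps are found: restriction followed by a section of
  it is the identity modulo the equation \<open>p\<close>, and it suffices to see this on the
  variables.\<close>

lemma subst_cong_dvd:
  assumes "\<And>i. p dvd g i - g' i"
  shows "p dvd subst g f - subst g' f"
proof (induct f rule: mpol_induct)
  case (Const c)
  then show ?case by simp
next
  case (Var i)
  then show ?case using assms by simp
next
  case (add f f')
  have "subst g (f + f') - subst g' (f + f') = (subst g f - subst g' f) + (subst g f' - subst g' f')"
    by (simp add: subst_add)
  then show ?case using add by (metis dvd_add)
next
  case (mult f f')
  have "subst g (f * f') - subst g' (f * f')
      = subst g f * (subst g f' - subst g' f') + (subst g f - subst g' f) * subst g' f'"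
    by (simp add: subst_mult algebra_simps)
  then show ?case using mult by (metis dvd_add dvd_mult dvd_mult2)
qed

lemma subst_subst: "subst h (subst g f) = subst (\<lambda>i. subst h (g i)) f"
  by (induct f rule: mpol_induct) (simp_all add: subst_simps)

lemma subst_Var_id [simp]: "subst Var f = f"
  by (induct f rule: mpol_induct) (simp_all add: subst_simps)

section \<open>Derivations\<close>

lemma partial_eq_sum:
  assumes "finite K" "Poly_Mapping.keys f \<subseteq> K"
  shows "partial i f = (\<Sum>m\<in>K. Poly_Mapping.single (m - Poly_Mapping.single i 1)
     (of_nat (Poly_Mapping.lookup m i) * Poly_Mapping.lookup f m))"
  unfolding partial_def by (rule sum.mono_neutral_left) (use assms in \<open>auto simp: in_keys_iff\<close>)

lemma partial_add: "partial i (f + f') = partial i f + partial i f'"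
proof -
  let ?K = "Poly_Mapping.keys f \<union> Poly_Mapping.keys f'"
  have "Poly_Mapping.keys (f + f') \<subseteq> ?K" by (rule keys_add)
  then show ?thesis
    by (simp add: partial_eq_sum[of ?K] lookup_add distrib_left single_add sum.distrib)
qed

lemma partial_single:
  "partial i (Poly_Mapping.single m c) = Poly_Mapping.single (m - Poly_Mapping.single i 1) (of_nat (Poly_Mapping.lookup m i) * c)"
  by (cases "c = 0") (simp_all add: partial_def)

text \<open>Subtraction of exponents is truncated at 0, so it commutes with addition only where the
  variable occurs. Monomials without the variable drop out of \<open>partial\<close> through their
  zero coefficient.\<close>

lemma single_diff_add:
  assumes "Poly_Mapping.lookup m i \<noteq> (0::nat)"
  shows "(m - Poly_Mapping.single i 1) + m' = (m + m') - Poly_Mapping.single i 1"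
  by (rule poly_mapping_eqI) (use assms in \<open>auto simp: lookup_add lookup_minus lookup_single when_def\<close>)

lemma partial_mult: "partial i (f * f') = f * partial i f' + partial i f * f'"
proof (induct f rule: mpol_additive_induct)
  case (single m c)
  show ?case
  proof (induct f' rule: mpol_additive_induct)
    case (single m' c')
    let ?e = "Poly_Mapping.single i (1::nat)"
    have 1: "Poly_Mapping.single m c * partial i (Poly_Mapping.single m' c')
        = Poly_Mapping.single (m + m' - ?e) (c * (of_nat (Poly_Mapping.lookup m' i) * c'))"
    proof (cases "Poly_Mapping.lookup m' i = 0")
      case False
      then show ?thesis using single_diff_add[of m' i m] by (simp add: partial_single mult_single add.commute)
    qed (simp add: partial_single)
    have 2: "partial i (Poly_Mapping.single m c) * Poly_Mapping.single m' c'
        = Poly_Mapping.single (m + m' - ?e) (of_nat (Poly_Mapping.lookup m i) * c * c')"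
    proof (cases "Poly_Mapping.lookup m i = 0")
      case False
      then show ?thesis using single_diff_add[of m i m'] by (simp add: partial_single mult_single add.commute)
    qed (simp add: partial_single)
    show ?case
      by (simp only: 1 2) (simp add: mult_single partial_single lookup_add single_add[symmetric] algebra_simps)
  next
    case (add f g)
    then show ?case by (simp add: distrib_left partial_add algebra_simps)
  qed
next
  case (add f g)
  then show ?case by (simp add: distrib_right partial_add algebra_simps)
qed

lemma partial_Const [simp]: "partial i (Const c) = 0"
  by (simp add: Const_def partial_single)

lemma partial_Var: "partial i (Var j) = (if i = j then 1 else 0)"
  by (simp add: Var_def partial_single lookup_single when_def)

lemma
  assumes "\<theta> \<in> Der"
  shows Der_add: "\<theta> (f + g) = \<theta> f + \<theta> g"
    and Der_mult: "\<theta> (f * g) = f * \<theta> g + \<theta> f * g"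
    and Der_smult: "\<theta> (Const c * f) = Const c * \<theta> f"
    and Der_Const [simp]: "\<theta> (Const c) = 0"
proof -
  show 1: "\<theta> (f + g) = \<theta> f + \<theta> g" "\<theta> (f * g) = f * \<theta> g + \<theta> f * g"
    "\<theta> (Const c * f) = Const c * \<theta> f" for f g c
    using assms by (auto simp: Der_def)
  have "\<theta> 1 = 0" using 1(2)[of 1 1] by simp
  then show "\<theta> (Const c) = 0" using 1(3)[of c 1] by simp
qed

lemma
  assumes "\<theta> \<in> Der"
  shows Der_0: "\<theta> 0 = 0" and Der_1: "\<theta> 1 = 0"
    and Der_uminus: "\<theta> (- f) = - \<theta> f" and Der_diff: "\<theta> (f - g) = \<theta> f - \<theta> g"
    and Der_sum: "\<theta> (\<Sum>i\<in>I. h i) = (\<Sum>i\<in>I. \<theta> (h i))"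
proof -
  show z: "\<theta> 0 = 0" "\<theta> 1 = 0" using Der_Const[OF assms, of 0] Der_Const[OF assms, of 1] by simp_all
  show u: "\<theta> (- f) = - \<theta> f" for f
    using Der_add[OF assms, of f "- f"] by (simp add: z eq_neg_iff_add_eq_0 add.commute)
  show "\<theta> (f - g) = \<theta> f - \<theta> g" using Der_add[OF assms, of f "- g"] by (simp add: u)
  show "\<theta> (\<Sum>i\<in>I. h i) = (\<Sum>i\<in>I. \<theta> (h i))"
    by (induct I rule: infinite_finite_induct) (simp_all add: z Der_add[OF assms])
qed

lemmas Der_simps = Der_add Der_mult Der_Const Der_0 Der_1 Der_uminus Der_diff Der_sum

lemma der_of_coeffs: "(\<lambda>f. \<Sum>i\<in>UNIV. a i * partial i f) \<in> (Der :: (('n::finite,'k::comm_ring_1) mpol \<Rightarrow> _) set)"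
proof -
  have 1: "partial i (Const c * f) = Const c * partial i f" for i :: 'n and c f
    by (simp add: partial_mult)
  show ?thesis
    unfolding Der_def mem_Collect_eq
    by (intro conjI allI; simp only: partial_add 1 partial_mult sum.distrib[symmetric] sum_distrib_left sum_distrib_right)
       (rule sum.cong[OF refl]; simp add: algebra_simps)+
qed

lemma der_of_coeffs_Var: "(\<Sum>i\<in>UNIV. a i * partial i (Var j)) = a (j::'n::finite)"
  by (simp add: partial_Var if_distrib cong: if_cong)

lemma euler_Der: "euler \<in> (Der :: (('n::finite,'k::comm_ring_1) mpol \<Rightarrow> _) set)"
  using der_of_coeffs[of Var] by (simp add: euler_def[abs_def])

lemma euler_Var [simp]: "euler (Var i) = Var i"
  by (simp add: euler_def der_of_coeffs_Var)

lemma DerI: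
  assumes "\<And>f g. \<theta> (f + g) = \<theta> f + \<theta> g" "\<And>c f. \<theta> (Const c * f) = Const c * \<theta> f"
    "\<And>f g. \<theta> (f * g) = f * \<theta> g + \<theta> f * g"
  shows "\<theta> \<in> Der"
  unfolding Der_def using assms by blast

lemma Der_zero: "(\<lambda>f. 0) \<in> Der"
  by (rule DerI) simp_all

lemma Der_plus: "\<theta> \<in> Der \<Longrightarrow> \<eta> \<in> Der \<Longrightarrow> (\<lambda>f. \<theta> f + \<eta> f) \<in> Der"
  by (rule DerI) (simp_all add: Der_add Der_mult Der_smult algebra_simps)

lemma Der_minus: "\<theta> \<in> Der \<Longrightarrow> \<eta> \<in> Der \<Longrightarrow> (\<lambda>f. \<theta> f - \<eta> f) \<in> Der"
  by (rule DerI) (simp_all add: Der_add Der_mult Der_smult algebra_simps)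

lemma Der_times: "\<theta> \<in> Der \<Longrightarrow> (\<lambda>f. r * \<theta> f) \<in> Der"
  by (rule DerI) (simp_all add: Der_add Der_mult Der_smult algebra_simps)

lemma Der_eqI:
  assumes "\<theta> \<in> Der" "\<eta> \<in> Der" "\<And>i. \<theta> (Var i) = \<eta> (Var i)"
  shows "\<theta> = (\<eta> :: ('n::finite, 'k::comm_ring_1) mpol \<Rightarrow> _)"
proof
  fix f show "\<theta> f = \<eta> f"
    by (induct f rule: mpol_induct) (use assms in \<open>simp_all add: Der_simps\<close>)
qed

lemma Der_prod:
  assumes "\<theta> \<in> Der" "finite I" "\<And>i. i \<in> I \<Longrightarrow> \<theta> (f i) = c i * f i"
  shows "\<theta> (\<Prod>i\<in>I. f i) = (\<Sum>i\<in>I. c i) * (\<Prod>i\<in>I. f i)"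
  using assms(2,3) by (induct I rule: finite_induct) (simp_all add: Der_simps[OF assms(1)] algebra_simps)

lemma Der_lin_form: "\<theta> \<in> Der \<Longrightarrow> \<theta> (lin_form a) = (\<Sum>i\<in>UNIV. Const (a i) * \<theta> (Var i))"
  by (simp add: lin_form_def Der_sum Der_smult)

section \<open>Homogeneous polynomials\<close>

lemma mon_deg_add: "mon_deg (m + m') = mon_deg m + mon_deg m'"
  by (simp add: mon_deg_def lookup_add sum.distrib)

lemma mon_deg_single [simp]: "mon_deg (Poly_Mapping.single i a) = a"
  by (simp add: mon_deg_def lookup_single when_def)

lemma homog_iff: "homog n f \<longleftrightarrow> (\<forall>m. Poly_Mapping.lookup f m \<noteq> 0 \<longrightarrow> int (mon_deg m) = n)"
  by (auto simp: homog_def in_keys_iff)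

lemma homog_0 [simp]: "homog n 0"
  by (simp add: homog_def)

lemma homog_single: "homog (int (mon_deg m)) (Poly_Mapping.single m c)"
  by (auto simp: homog_iff lookup_single when_def)

lemma homog_add: "homog n f \<Longrightarrow> homog n g \<Longrightarrow> homog n (f + g)"
  by (auto simp: homog_iff lookup_add) (metis add.right_neutral)

lemma homog_uminus: "homog n f \<Longrightarrow> homog n (- f)"
  by (auto simp: homog_iff)

lemma homog_diff: "homog n f \<Longrightarrow> homog n g \<Longrightarrow> homog n (f - g)"
  using homog_add[of n f "- g"] homog_uminus[of n g] by simp

lemma homog_sum: "(\<And>i. i \<in> I \<Longrightarrow> homog n (f i)) \<Longrightarrow> homog n (\<Sum>i\<in>I. f i)"
  by (induct I rule: infinite_finite_induct) (auto intro: homog_add)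

lemma homog_mult: "homog n f \<Longrightarrow> homog k g \<Longrightarrow> homog (n + k) (f * g)"
  unfolding homog_def
proof safe
  fix m assume f: "\<forall>m\<in>Poly_Mapping.keys f. int (mon_deg m) = n" and g: "\<forall>m\<in>Poly_Mapping.keys g. int (mon_deg m) = k"
    and m: "m \<in> Poly_Mapping.keys (f * g)"
  obtain a b where "a \<in> Poly_Mapping.keys f" "b \<in> Poly_Mapping.keys g" "m = a + b"
    using m keys_mult[of f g] by auto
  then show "int (mon_deg m) = n + k" using f g by (simp add: mon_deg_add)
qed

lemma homog_Const: "homog 0 (Const c)"
  using homog_single[of 0 c] by (simp add: Const_def mon_deg_def)

lemma homog_1: "homog 0 1"
  using homog_Const[of 1] by simp

lemma homog_Const_mult: "homog n f \<Longrightarrow> homog n (Const c * f)"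
  using homog_mult[OF homog_Const] by fastforce

lemma homog_Var: "homog 1 (Var i)"
  using homog_single[of "Poly_Mapping.single i 1" 1] by (simp add: Var_def)

lemma homog_lin_form: "homog 1 (lin_form a)"
  unfolding lin_form_def by (intro homog_sum homog_Const_mult homog_Var)

lemma homog_power: "homog n f \<Longrightarrow> homog (n * int a) (f ^ a)"
proof (induct a)
  case (Suc a)
  then show ?case using homog_mult[of n f "n * int a" "f ^ a"] by (simp add: algebra_simps)
qed (simp add: homog_1)

lemma homog_prod: "(\<And>i. i \<in> I \<Longrightarrow> homog (n i) (f i)) \<Longrightarrow> homog (\<Sum>i\<in>I. n i) (\<Prod>i\<in>I. f i)"
  by (induct I rule: infinite_finite_induct) (auto simp: homog_1 intro: homog_mult)

lemma homog_subst:
  assumes "\<And>i. homog 1 (g i)" "homog n f"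
  shows "homog n (subst g f)"
  unfolding subst_def
proof (rule homog_sum)
  fix m assume "m \<in> Poly_Mapping.keys f"
  then have n: "n = (\<Sum>i\<in>UNIV. int (Poly_Mapping.lookup m i))" using assms(2) by (auto simp: homog_def mon_deg_def)
  show "homog n (Const (Poly_Mapping.lookup f m) * (\<Prod>i\<in>UNIV. g i ^ Poly_Mapping.lookup m i))"
    unfolding n by (intro homog_Const_mult homog_prod) (use homog_power[OF assms(1)] in auto)
qed

lemma homog_neg: "homog n f \<Longrightarrow> n < 0 \<Longrightarrow> f = 0"
  by (rule poly_mapping_eqI) (force simp: homog_iff)

lemma homog_unique: "homog n f \<Longrightarrow> homog k f \<Longrightarrow> f \<noteq> 0 \<Longrightarrow> n = k"
  by (metis homog_def keys_eq_empty all_not_in_conv)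

definition homog_part :: "int \<Rightarrow> ('n::finite, 'k::comm_ring_1) mpol \<Rightarrow> ('n, 'k) mpol" where
  "homog_part n f = (\<Sum>m\<in>Poly_Mapping.keys f. if int (mon_deg m) = n then Poly_Mapping.single m (Poly_Mapping.lookup f m) else 0)"

lemma lookup_homog_part: "Poly_Mapping.lookup (homog_part n f) m = (if int (mon_deg m) = n then Poly_Mapping.lookup f m else 0)"
proof -
  have "Poly_Mapping.lookup (homog_part n f) m = (\<Sum>m'\<in>Poly_Mapping.keys f. if m' = m then (if int (mon_deg m) = n then Poly_Mapping.lookup f m else 0) else 0)"
    unfolding homog_part_def lookup_sum by (rule sum.cong) (auto simp: lookup_single when_def)
  also have "\<dots> = (if int (mon_deg m) = n then Poly_Mapping.lookup f m else 0)"
    by (auto simp: sum.delta in_keys_iff)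
  finally show ?thesis .
qed

lemma homog_part_add: "homog_part n (f + g) = homog_part n f + homog_part n g"
  by (rule poly_mapping_eqI) (simp add: lookup_homog_part lookup_add)

lemma homog_homog_part: "homog n (homog_part n f)"
  by (auto simp: homog_iff lookup_homog_part)

lemma homog_part_homog: "homog k f \<Longrightarrow> homog_part n f = (if n = k then f else 0)"
  by (rule poly_mapping_eqI) (auto simp: homog_iff lookup_homog_part)

lemma homog_part_mult:
  assumes "homog k b"
  shows "homog_part (n + k) (b * f) = b * homog_part n f"
proof (induct f rule: mpol_additive_induct)
  case (single m c)
  have 1: "homog (int (mon_deg m) + k) (b * Poly_Mapping.single m c)"
    using homog_mult[OF assms homog_single[of m c]] by (simp add: add.commute)
  show ?case
    by (auto simp: homog_part_homog[OF 1] homog_part_homog[OF homog_single])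
next
  case (add f g)
  then show ?case by (simp add: distrib_left homog_part_add)
qed

text \<open>Multiplication by the form \<open>b\<close> only shifts degrees, so \<open>b * f\<close>
  is \<open>b\<close> times a single homogeneous part of \<open>f\<close>, and \<open>b\<close>
  cancels. The order on the variables makes the polynomial ring an integral domain.\<close>

lemma homog_mult_cancel:
  fixes b :: "('n::{finite,linorder}, 'k::idom) mpol"
  assumes "homog k b" "b \<noteq> 0" "homog (n + k) (b * f)"
  shows "homog n f"
proof -
  have "b * homog_part n f = b * f"
  proof -
    have "homog_part (n + k) (b * f) = b * f" by (simp only: homog_part_homog[OF assms(3)] if_True refl)
    then show ?thesis by (simp only: homog_part_mult[OF assms(1)])
  qed
  then have "homog_part n f = f" using assms(2) by (metis mult_left_cancel)
  then show ?thesis by (metis homog_homog_part)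
qed

section \<open>Linear forms and primes\<close>

lemma exhaust_2: "(x::2) = 0 \<or> x = 1"
proof (induct x)
  case (of_int z)
  then have "0 \<le> z" "z < 2" by simp_all
  then have "z = 0 \<or> z = 1" by arith
  then show ?case by auto
qed

lemma exhaust_3: "(x::3) = 0 \<or> x = 1 \<or> x = 2"
proof (induct x)
  case (of_int z)
  then have "0 \<le> z" "z < 3" by simp_all
  then have "z = 0 \<or> z = 1 \<or> z = 2" by arith
  then show ?case by auto
qed

lemma UNIV_2: "(UNIV :: 2 set) = {0, 1}"
  using exhaust_2 by auto

lemma UNIV_3: "(UNIV :: 3 set) = {0, 1, 2}"
  using exhaust_3 by auto

lemma sum_2: "(\<Sum>i\<in>(UNIV::2 set). f i) = f 0 + f 1"
  by (simp add: UNIV_2)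

lemma lin_form_2: "lin_form a = Const (a 0) * s_var + Const (a 1) * t_var"
  by (simp add: lin_form_def sum_2)

lemma lookup_lin_form:
  "Poly_Mapping.lookup (lin_form a) (Poly_Mapping.single i 1) = a i"
proof -
  have "Poly_Mapping.single j (1::nat) = Poly_Mapping.single i 1 \<longleftrightarrow> j = i" for j
    by (metis inj_single injD lookup_single_eq lookup_single_not_eq one_neq_zero)
  then show ?thesis
    by (simp add: lin_form_def lookup_sum Var_def Const_def mult_single lookup_single when_def)
qed

lemma lin_form_inj: "lin_form a = lin_form b \<Longrightarrow> a = b"
  by (rule ext) (metis lookup_lin_form)

lemma lin_form_0 [simp]: "lin_form (\<lambda>i. 0) = 0"
  by (simp add: lin_form_def)

lemma lin_form_eq_0_iff: "lin_form a = 0 \<longleftrightarrow> a = (\<lambda>i. 0)"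
  using lin_form_inj[of a "\<lambda>i. 0"] by auto

lemma lin_form_smult: "lin_form (\<lambda>i. c * a i) = Const c * lin_form a"
  by (simp add: lin_form_def Const_mult sum_distrib_left mult.assoc)

lemma lin_form_add: "lin_form (\<lambda>i. a i + b i) = lin_form a + lin_form b"
  by (simp add: lin_form_def Const_add distrib_right sum.distrib)

lemma lin_form_diff: "lin_form (\<lambda>i. a i - b i) = lin_form a - lin_form b"
  by (simp add: lin_form_def Const_diff left_diff_distrib sum_subtractf)

lemma lin_form_single: "lin_form (\<lambda>j. if j = i then 1 else 0) = Var i"
proof -
  have "(\<Sum>j\<in>UNIV. Const (if j = i then 1 else 0) * Var j) = (\<Sum>j\<in>UNIV. if j = i then Var j else 0)"
    by (rule sum.cong) auto
  then show ?thesis by (simp add: lin_form_def)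
qed

lemma subst_lin_form: "subst g (lin_form a) = (\<Sum>i\<in>UNIV. Const (a i) * g i)"
  by (simp add: lin_form_def subst_simps)

lemma prime_elem_power_dvd_cancel:
  fixes p :: "'a::idom"
  assumes "prime_elem p" "\<not> p dvd a" "p ^ n dvd a * x"
  shows "p ^ n dvd x"
  using assms(3)
proof (induct n arbitrary: x)
  case (Suc n)
  have "p dvd a * x" using Suc.prems by (metis dvd_mult_left power_Suc)
  then obtain y where y: "x = p * y" using assms(1,2) by (auto simp: prime_elem_dvd_mult_iff)
  have "p * p ^ n dvd p * (a * y)" using Suc.prems by (simp add: y mult_ac)
  then have "p ^ n dvd a * y" using assms(1) by (simp add: prime_elem_def)
  then have "p ^ n dvd y" by (rule Suc.hyps)
  then show ?case by (simp add: y mult_dvd_mono)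
qed simp

lemma prime_elem_dvd_prod:
  assumes "prime_elem p" "finite I" "p dvd (\<Prod>i\<in>I. f i)"
  shows "\<exists>i\<in>I. p dvd f i"
  using assms(2,3)
proof (induct I rule: finite_induct)
  case empty
  then show ?case using assms(1) by (simp add: prime_elem_not_unit)
next
  case (insert i I)
  then show ?case using assms(1) by (auto simp: prime_elem_dvd_mult_iff)
qed

text \<open>\<open>p i\<close> divides no other prime of the family, hence not their product, so its
  power divides the cofactor that remains after the other prime powers have been split off.\<close>

lemma prod_prime_powers_dvd:
  fixes x :: "'a::idom"
  assumes "finite I" "\<And>i. i \<in> I \<Longrightarrow> prime_elem (p i)"
    and "\<And>i j. i \<in> I \<Longrightarrow> j \<in> I \<Longrightarrow> i \<noteq> j \<Longrightarrow> \<not> p i dvd p j"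
    and "\<And>i. i \<in> I \<Longrightarrow> p i ^ e i dvd x"
  shows "(\<Prod>i\<in>I. p i ^ e i) dvd x"
  using assms
proof (induct I rule: finite_induct)
  case (insert i I)
  have "(\<Prod>i\<in>I. p i ^ e i) dvd x"
    by (rule insert.hyps(3)) (use insert.prems in blast)+
  then obtain y where y: "x = (\<Prod>i\<in>I. p i ^ e i) * y" by (rule dvdE)
  have "\<not> p i dvd (\<Prod>j\<in>I. p j ^ e j)"
  proof
    assume "p i dvd (\<Prod>j\<in>I. p j ^ e j)"
    then obtain j where "j \<in> I" "p i dvd p j ^ e j" using prime_elem_dvd_prod[OF insert.prems(1)[of i] insert.hyps(1)] by blast
    then have "p i dvd p j" using prime_elem_dvd_power[OF insert.prems(1)[of i]] by blast
    then show False using insert.prems(2)[of i j] insert.hyps(2) \<open>j \<in> I\<close> by auto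
  qed
  moreover have "p i ^ e i dvd (\<Prod>j\<in>I. p j ^ e j) * y"
    using insert.prems(3)[of i] by (simp add: y[symmetric])
  ultimately have "p i ^ e i dvd y"
    using prime_elem_power_dvd_cancel[OF insert.prems(1)[of i]] by blast
  then have "p i ^ e i * (\<Prod>j\<in>I. p j ^ e j) dvd (\<Prod>j\<in>I. p j ^ e j) * y"
    by (subst mult.commute) (rule mult_dvd_mono[OF dvd_refl])
  then show ?case using insert.hyps by (simp add: y)
qed simp

lemma prod_primes_dvd:
  fixes x :: "'a::idom"
  assumes "finite I" "\<And>i. i \<in> I \<Longrightarrow> prime_elem (p i)"
    and "\<And>i j. i \<in> I \<Longrightarrow> j \<in> I \<Longrightarrow> i \<noteq> j \<Longrightarrow> \<not> p i dvd p j"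
    and "\<And>i. i \<in> I \<Longrightarrow> p i dvd x"
  shows "(\<Prod>i\<in>I. p i) dvd x"
  using prod_prime_powers_dvd[of I p "\<lambda>_. 1" x] assms by simp

text \<open>The kernel of the restriction to the point \<open>(a 1, - a 0)\<close> of the line is generated by the
  linear form that vanishes there.\<close>

lemma prime_elem_lin_form_2:
  fixes a :: "2 \<Rightarrow> 'k::field"
  assumes "a \<noteq> (\<lambda>i. 0)"
  shows "prime_elem (lin_form a)"
proof -
  define \<rho> :: "(2, 'k) mpol \<Rightarrow> (2, 'k) mpol" where
    "\<rho> = subst (\<lambda>i. if i = 0 then Const (a 1) * s_var else - Const (a 0) * s_var)"
  have nz: "a 0 \<noteq> 0 \<or> a 1 \<noteq> 0" using assms exhaust_2 by (metis ext)
  \<comment> \<open>\<open>g\<close> is a coordinate at the zero of the form: modulo the form, s and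
    t are \<open>a 1\<close> and \<open>- a 0\<close> times \<open>g\<close>. Hence \<rho> followed
    by sending s to \<open>g\<close> is the identity modulo the form. The formula for
    \<open>g\<close> depends on which coefficient is invertible.\<close>
  obtain g :: "(2, 'k) mpol" where g: "lin_form a dvd Const (a 1) * g - s_var" "lin_form a dvd - Const (a 0) * g - t_var"
  proof (cases "a 1 = 0")
    case True
    have e: "Const (a 0) * Const (inverse (a 0)) = (1 :: (2, 'k) mpol)" using nz True by (simp flip: Const_mult)
    have "lin_form a * (- Const (inverse (a 0))) = - ((Const (a 0) * Const (inverse (a 0))) * s_var)"
      by (simp add: lin_form_2 True mult_ac)
    then have "lin_form a dvd - s_var" by (metis e dvd_triv_left mult_1)
    then have "lin_form a dvd Const (a 1) * (- Const (inverse (a 0)) * t_var) - s_var" by (simp add: True)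
    moreover have "- Const (a 0) * (- Const (inverse (a 0)) * t_var) = t_var"
      by (simp add: mult.assoc[symmetric] e)
    then have "lin_form a dvd - Const (a 0) * (- Const (inverse (a 0)) * t_var) - t_var" by (simp only:) simp
    ultimately show ?thesis by (rule that)
  next
    case False
    have e: "Const (a 1) * Const (inverse (a 1)) = (1 :: (2, 'k) mpol)" using False by (simp flip: Const_mult)
    have "lin_form a * (- Const (inverse (a 1))) = - Const (a 0) * (Const (inverse (a 1)) * s_var) - (Const (a 1) * Const (inverse (a 1))) * t_var"
      by (simp add: lin_form_2 algebra_simps)
    then have "lin_form a dvd - Const (a 0) * (Const (inverse (a 1)) * s_var) - t_var" by (metis e dvd_triv_left mult_1)
    moreover have "Const (a 1) * (Const (inverse (a 1)) * s_var) = s_var"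
      by (simp add: mult.assoc[symmetric] e)
    then have "lin_form a dvd Const (a 1) * (Const (inverse (a 1)) * s_var) - s_var" by (simp only:) simp
    ultimately show ?thesis by (intro that)
  qed
  have iff: "lin_form a dvd f \<longleftrightarrow> \<rho> f = 0" for f
  proof
    assume "lin_form a dvd f"
    moreover have "\<rho> (lin_form a) = 0"
      by (simp add: \<rho>_def subst_lin_form sum_2 algebra_simps)
    ultimately show "\<rho> f = 0" by (auto simp: \<rho>_def subst_mult)
  next
    assume f: "\<rho> f = 0"
    define h :: "2 \<Rightarrow> (2, 'k) mpol" where "h = (\<lambda>i. if i = 0 then Const (a 1) * g else - Const (a 0) * g)"
    have "subst h f = subst (\<lambda>_. g) (\<rho> f)"
      unfolding \<rho>_def subst_subst by (rule arg_cong[of _ _ "\<lambda>h. subst h f"]) (auto simp: subst_simps h_def)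
    then have "subst h f = 0" by (simp add: f)
    moreover have "lin_form a dvd h i - Var i" for i
      using g exhaust_2[of i] by (auto simp: h_def)
    then have "lin_form a dvd subst h f - subst Var f"
      by (rule subst_cong_dvd)
    ultimately show "lin_form a dvd f" by simp
  qed
  have "\<rho> 1 \<noteq> 0" by (simp add: \<rho>_def)
  then show ?thesis
    using assms by (intro prime_elemI) (auto simp: iff lin_form_eq_0_iff, auto simp: \<rho>_def subst_mult)
qed

lemma prime_elem_Var_2: "prime_elem (Var i :: (2, 'k::field) mpol)"
proof -
  have "(\<lambda>j. if j = i then 1 else 0 :: 'k) \<noteq> (\<lambda>j. 0)" by (metis zero_neq_one)
  from prime_elem_lin_form_2[OF this] show ?thesis by (simp add: lin_form_single)
qed

section \<open>Binary forms\<close>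

lemma lookup_Var_power_mult:
  "Poly_Mapping.lookup (Var i ^ a * f) m = (if a \<le> Poly_Mapping.lookup m i then Poly_Mapping.lookup f (m - Poly_Mapping.single i a) else 0)"
proof (cases "a \<le> Poly_Mapping.lookup m i")
  case True
  have "m = Poly_Mapping.single i a + (m - Poly_Mapping.single i a)"
    by (rule poly_mapping_eqI) (use True in \<open>auto simp: lookup_add lookup_minus lookup_single when_def\<close>)
  then show ?thesis using True lookup_single_times[of "Poly_Mapping.single i a" 1 f "m - Poly_Mapping.single i a"]
    by (metis Var_power mult_1)
next
  case False
  have "m \<noteq> Poly_Mapping.single i a + m'" for m'
    using False by (auto simp: lookup_add)
  then show ?thesis using False lookup_single_times_notin[of m "Poly_Mapping.single i a"] by (simp add: Var_power)
qed

definition bi :: "nat \<Rightarrow> nat \<Rightarrow> 2 \<Rightarrow>\<^sub>0 nat" where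
  "bi a b = Poly_Mapping.single 0 a + Poly_Mapping.single 1 b"

lemma lookup_bi [simp]: "Poly_Mapping.lookup (bi a b) 0 = a" "Poly_Mapping.lookup (bi a b) 1 = b"
  by (simp_all add: bi_def lookup_add lookup_single)

lemma bi_lookup: "bi (Poly_Mapping.lookup m 0) (Poly_Mapping.lookup m 1) = m"
  by (rule poly_mapping_eqI) (metis exhaust_2 lookup_bi)

lemma bi_eq_iff: "bi a b = bi c d \<longleftrightarrow> a = c \<and> b = d"
  by (metis lookup_bi)

lemma mon_deg_bi: "mon_deg (bi a b) = a + b"
  by (simp add: mon_deg_def sum_2)

lemma bi_monomial: "s_var ^ a * t_var ^ b = Poly_Mapping.single (bi a b) (1::'k::comm_ring_1)"
  by (simp add: Var_power mult_single bi_def)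

lemma lookup_bi_monomial:
  "Poly_Mapping.lookup (s_var ^ a * t_var ^ b :: (2, 'k::comm_ring_1) mpol) (bi c d) = (if a = c \<and> b = d then 1 else 0)"
  by (simp add: bi_monomial lookup_single when_def bi_eq_iff)

lemma binary_form_expand:
  assumes "homog (int n) (f :: (2, 'k::comm_ring_1) mpol)"
  shows "f = (\<Sum>a\<le>n. Const (Poly_Mapping.lookup f (bi a (n - a))) * (s_var ^ a * t_var ^ (n - a)))" (is "f = ?R")
proof (rule poly_mapping_eqI)
  fix m :: "2 \<Rightarrow>\<^sub>0 nat"
  define c d where "c = Poly_Mapping.lookup m 0" and "d = Poly_Mapping.lookup m 1"
  have m: "m = bi c d" by (simp add: c_def d_def bi_lookup)
  have "Poly_Mapping.lookup ?R (bi c d) = (\<Sum>a\<le>n. if a = c then (if n - a = d then Poly_Mapping.lookup f (bi a (n - a)) else 0) else 0)"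
    unfolding lookup_sum by (rule sum.cong) (auto simp: lookup_bi_monomial)
  also have "\<dots> = (if c \<le> n \<and> n - c = d then Poly_Mapping.lookup f (bi c d) else 0)"
    by (auto simp: sum.delta)
  also have "\<dots> = Poly_Mapping.lookup f (bi c d)"
    using assms by (auto simp: homog_iff mon_deg_bi)
  finally show "Poly_Mapping.lookup f m = Poly_Mapping.lookup ?R m" by (simp add: m)
qed

section \<open>Quotient modules and linear algebra over k\<close>

section \<open>Quotients and images of modules\<close>

text \<open>Just what makes \<open>quotient_via\<close> well defined: each scalar acts additively
  and preserves \<open>N\<close>, and by \<open>smult_cong\<close> scalars with the same image under
  \<rho> act alike modulo \<open>N\<close>.\<close>

locale module_quotient =
  fixes G :: "('r, 'm, 'z) module_scheme" (structure) and N :: "'m set" and \<rho> :: "'r \<Rightarrow> 's"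
  assumes G: "abelian_group G" and N: "additive_subgroup N G"
    and smult_closed: "x \<in> carrier G \<Longrightarrow> r \<odot> x \<in> carrier G"
    and smult_add: "x \<in> carrier G \<Longrightarrow> y \<in> carrier G \<Longrightarrow> r \<odot> (x \<oplus> y) = r \<odot> x \<oplus> r \<odot> y"
    and smult_N: "x \<in> N \<Longrightarrow> r \<odot> x \<in> N"
    and smult_cong: "x \<in> carrier G \<Longrightarrow> \<rho> r = \<rho> r' \<Longrightarrow> r \<odot> x \<ominus> r' \<odot> x \<in> N"
    and surj: "\<exists>r. \<rho> r = s"
begin

sublocale abelian_subgroup N G
  by (rule abelian_subgroupI3[OF N G])

abbreviation Q where "Q \<equiv> quotient_via \<rho> G N"

lemma coset_eq_iff:
  assumes "x \<in> carrier G" "y \<in> carrier G"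
  shows "N +> x = N +> y \<longleftrightarrow> x \<ominus> y \<in> N"
proof
  assume "N +> x = N +> y"
  then have "x \<in> N +> y" using a_rcos_self[OF assms(1)] by simp
  then show "x \<ominus> y \<in> N" using a_rcos_module_imp[OF assms(2)] by (simp add: a_minus_def)
next
  assume "x \<ominus> y \<in> N"
  then have "x \<in> N +> y" using a_rcos_module_rev[OF assms(2,1)] by (simp add: a_minus_def)
  then show "N +> x = N +> y" using a_repr_independence assms(2) a_subgroup by metis
qed

lemma mem_cosetD: "x' \<in> N +> x \<Longrightarrow> x \<in> carrier G \<Longrightarrow> \<exists>n\<in>N. x' = n \<oplus> x"
  by (auto simp: a_r_coset_def')

lemma mem_coset_carrier: "x' \<in> N +> x \<Longrightarrow> x \<in> carrier G \<Longrightarrow> x' \<in> carrier G"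
  using mem_cosetD a_subset by blast

lemma quot_carrier: "carrier Q = (\<lambda>x. N +> x) ` carrier G"
  by (auto simp: quotient_via_def A_RCOSETS_def')

lemma quot_zero: "\<zero>\<^bsub>Q\<^esub> = N +> \<zero>"
  using a_coset_join2[OF _ a_subgroup additive_subgroup.zero_closed[OF N]] by (simp add: quotient_via_def)

lemma quot_add: "x \<in> carrier G \<Longrightarrow> y \<in> carrier G \<Longrightarrow> (N +> x) \<oplus>\<^bsub>Q\<^esub> (N +> y) = N +> (x \<oplus> y)"
  by (simp add: quotient_via_def a_rcos_sum)

text \<open>The defining union runs over all representatives of the coset and all preimages of the
  scalar. Either change moves the product by an element of \<open>N\<close>, so it is a union of
  copies of one coset.\<close>

lemma quot_smult:
  assumes x: "x \<in> carrier G" and s: "\<rho> r = s"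
  shows "s \<odot>\<^bsub>Q\<^esub> (N +> x) = N +> (r \<odot> x)"
proof -
  have "N +> (r' \<odot> x') = N +> (r \<odot> x)" if r': "\<rho> r' = s" and x': "x' \<in> N +> x" for r' x'
  proof -
    obtain n where n: "n \<in> N" "x' = n \<oplus> x" using mem_cosetD[OF x' x] by blast
    have nG: "n \<in> carrier G" using n a_subset by blast
    have x'G: "x' \<in> carrier G" using mem_coset_carrier[OF x' x] .
    have "N +> (r' \<odot> x') = N +> (r \<odot> x')"
      using coset_eq_iff smult_closed[OF x'G] smult_cong[OF x'G, of r' r] r' s by simp
    also have "\<dots> = N +> (r \<odot> x)"
    proof -
      have "r \<odot> x' \<ominus> r \<odot> x = r \<odot> n"
        using smult_closed[OF nG, of r] smult_closed[OF x, of r] by (simp add: n(2) smult_add[OF nG x] a_minus_def a_assoc r_neg)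
      then show ?thesis using coset_eq_iff smult_closed[OF x'G] smult_closed[OF x] smult_N[OF n(1)] by simp
    qed
    finally show ?thesis .
  qed
  then have "{N +> (r' \<odot> x') | r' x'. \<rho> r' = s \<and> x' \<in> N +> x} = {N +> (r \<odot> x)}"
    using s a_rcos_self[OF x] by blast
  then show ?thesis by (simp add: quotient_via_def)
qed

end

text \<open>A k-space given as a record, presented as the image of a subspace \<open>X\<close> of an
  ambient additive group, so that calculations take place in the type of \<open>X\<close>. The map
  \<pi> may have a kernel: it is injective for sections and H0, but for H1 it kills the
  coboundaries.\<close>

locale kmod_image =
  fixes ks :: "'k::field \<Rightarrow> 'v::ab_group_add \<Rightarrow> 'v" and X :: "'v set" and \<pi> :: "'v \<Rightarrow> 'w"
    and Q :: "('k, 'w, 'z) module_scheme" (structure)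
  assumes ks_add: "ks c (x + y) = ks c x + ks c y" and ks_add_left: "ks (c + d) x = ks c x + ks d x"
    and ks_ks: "ks c (ks d x) = ks (c * d) x" and ks_1: "ks 1 x = x"
    and X_0: "0 \<in> X" and X_add: "x \<in> X \<Longrightarrow> y \<in> X \<Longrightarrow> x + y \<in> X" and X_ks: "x \<in> X \<Longrightarrow> ks c x \<in> X"
    and carrier_eq: "carrier Q = \<pi> ` X"
    and \<pi>_add: "x \<in> X \<Longrightarrow> y \<in> X \<Longrightarrow> \<pi> x \<oplus> \<pi> y = \<pi> (x + y)"
    and \<pi>_ks: "x \<in> X \<Longrightarrow> c \<odot> \<pi> x = \<pi> (ks c x)"
    and \<pi>_0: "\<zero> = \<pi> 0"
begin

lemma ks_0_left: "ks 0 x = 0"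
  using ks_add_left[of 0 0 x] by simp

lemma ks_0: "ks c 0 = 0"
  using ks_add[of c 0 0] by simp

lemma ks_minus_1: "ks (- 1) x = - x"
  using ks_add_left[of "- 1" 1 x] by (simp add: ks_0_left ks_1 eq_neg_iff_add_eq_0)

lemma X_uminus: "x \<in> X \<Longrightarrow> - x \<in> X"
  using X_ks[of x "- 1"] by (simp add: ks_minus_1)

lemma X_diff: "x \<in> X \<Longrightarrow> y \<in> X \<Longrightarrow> x - y \<in> X"
  using X_add[of x "- y"] X_uminus by simp

lemma X_sum: "(\<And>i. i \<in> I \<Longrightarrow> w i \<in> X) \<Longrightarrow> (\<Sum>i\<in>I. w i) \<in> X"
  by (induct I rule: infinite_finite_induct) (simp_all add: X_0 X_add)

lemma ks_sum: "ks c (\<Sum>i\<in>I. w i) = (\<Sum>i\<in>I. ks c (w i))"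
  by (induct I rule: infinite_finite_induct) (simp_all add: ks_0 ks_add)

lemma ks_sum_left: "ks (\<Sum>i\<in>I. c i) x = (\<Sum>i\<in>I. ks (c i) x)"
  by (induct I rule: infinite_finite_induct) (simp_all add: ks_0_left ks_add_left)

lemma abelian_group: "abelian_group Q"
proof (rule abelian_groupI)
  fix x assume "x \<in> carrier Q"
  then obtain x' where x': "x = \<pi> x'" "x' \<in> X" by (auto simp: carrier_eq)
  then have "\<pi> (- x') \<oplus> x = \<zero>" by (simp add: \<pi>_add X_uminus \<pi>_0)
  then show "\<exists>y\<in>carrier Q. y \<oplus> x = \<zero>" using X_uminus[OF x'(2)] by (auto simp: carrier_eq)
qed (auto simp: carrier_eq \<pi>_add \<pi>_0 X_add X_0 add_ac)

lemma module: "module class_ring Q"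
  by (rule moduleI) (auto intro: class_cring.cring_axioms abelian_group
      simp: carrier_eq \<pi>_add \<pi>_ks X_add X_ks ks_add ks_add_left ks_ks ks_1 class_ring_simps)

lemma vectorspace: "vectorspace class_ring Q"
  using module by (simp add: vectorspace_def class_field.field_axioms)

lemma \<pi>_uminus: "x \<in> X \<Longrightarrow> \<ominus> \<pi> x = \<pi> (- x)"
proof -
  interpret abelian_group Q by (rule abelian_group)
  assume x: "x \<in> X"
  have "\<pi> (- x) \<oplus> \<pi> x = \<zero>" using x by (simp add: \<pi>_add X_uminus \<pi>_0)
  then show "\<ominus> \<pi> x = \<pi> (- x)"
    using minus_equality[of "\<pi> (- x)" "\<pi> x"] x X_uminus by (simp add: carrier_eq)
qed

lemma \<pi>_diff: "x \<in> X \<Longrightarrow> y \<in> X \<Longrightarrow> \<pi> x \<ominus> \<pi> y = \<pi> (x - y)"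
  by (simp add: a_minus_def \<pi>_uminus \<pi>_add X_uminus)

lemma \<pi>_eq_iff: "x \<in> X \<Longrightarrow> y \<in> X \<Longrightarrow> \<pi> x = \<pi> y \<longleftrightarrow> \<pi> (x - y) = \<zero>"
proof -
  interpret abelian_group Q by (rule abelian_group)
  assume xy: "x \<in> X" "y \<in> X"
  then have "\<pi> x \<in> carrier Q" "\<pi> y \<in> carrier Q" by (auto simp: carrier_eq)
  then show ?thesis using xy \<pi>_diff[OF xy] by (metis minus_equality minus_minus a_minus_def r_neg a_inv_closed)
qed

lemma \<pi>_sum:
  assumes "finite I" "\<And>i. i \<in> I \<Longrightarrow> w i \<in> X"
  shows "finsum Q (\<lambda>i. c i \<odot> \<pi> (w i)) I = \<pi> (\<Sum>i\<in>I. ks (c i) (w i))"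
  using assms
proof (induct I rule: finite_induct)
  interpret abelian_group Q by (rule abelian_group)
  case empty
  then show ?case by (simp add: \<pi>_0)
next
  interpret abelian_group Q by (rule abelian_group)
  case (insert i I)
  have c: "c j \<odot> \<pi> (w j) \<in> carrier Q" if "j \<in> insert i I" for j
    using insert.prems that by (auto simp: \<pi>_ks carrier_eq X_ks)
  have "finsum Q (\<lambda>i. c i \<odot> \<pi> (w i)) (insert i I) = c i \<odot> \<pi> (w i) \<oplus> finsum Q (\<lambda>i. c i \<odot> \<pi> (w i)) I"
    by (rule finsum_insert) (use insert.hyps c in auto)
  also have "finsum Q (\<lambda>i. c i \<odot> \<pi> (w i)) I = \<pi> (\<Sum>i\<in>I. ks (c i) (w i))"
    using insert by simp
  also have "c i \<odot> \<pi> (w i) \<oplus> \<dots> = \<pi> (ks (c i) (w i) + (\<Sum>i\<in>I. ks (c i) (w i)))"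
    using insert.prems by (simp add: \<pi>_ks \<pi>_add X_ks X_sum)
  finally show ?case using insert.hyps by simp
qed

end

section \<open>Bases, determinant and rank\<close>

context kmod_image
begin

lemma ordered_basisI:
  assumes w: "\<And>i. i < n \<Longrightarrow> w i \<in> X"
    and span: "\<And>x. x \<in> X \<Longrightarrow> \<exists>c. \<pi> x = \<pi> (\<Sum>i<n. ks (c i) (w i))"
    and indep: "\<And>c i. \<pi> (\<Sum>i<n. ks (c i) (w i)) = \<zero> \<Longrightarrow> i < n \<Longrightarrow> c i = 0"
  shows "ordered_basis Q n (\<lambda>i. \<pi> (w i))"
proof -
  interpret V: vectorspace class_ring Q by (rule vectorspace)
  let ?A = "(\<lambda>i. \<pi> (w i)) ` {..<n}"
  have inj: "inj_on (\<lambda>i. \<pi> (w i)) {..<n}"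
  proof (rule inj_onI, rule ccontr)
    fix i j assume ij: "i \<in> {..<n}" "j \<in> {..<n}" "\<pi> (w i) = \<pi> (w j)" "i \<noteq> j"
    define c :: "nat \<Rightarrow> 'k" where "c l = (if l = i then 1 else if l = j then - 1 else 0)" for l
    have "(\<Sum>l<n. ks (c l) (w l)) = (\<Sum>l\<in>{i, j}. ks (c l) (w l))"
      by (rule sum.mono_neutral_right) (use ij in \<open>auto simp: c_def ks_0_left\<close>)
    also have "\<dots> = w i - w j" using ij by (simp add: c_def ks_1 ks_minus_1)
    finally have "\<pi> (\<Sum>l<n. ks (c l) (w l)) = \<zero>" using \<pi>_eq_iff[of "w i" "w j"] ij w by simp
    then have "c i = 0" using indep[of c i] ij by simp
    then show False by (simp add: c_def)
  qed
  have A: "finite ?A" "?A \<subseteq> carrier Q" using w by (auto simp: carrier_eq)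
  have lc: "V.lincomb a ?A = \<pi> (\<Sum>i<n. ks (a (\<pi> (w i))) (w i))" for a
  proof -
    have "V.lincomb a ?A = finsum Q (\<lambda>i. a (\<pi> (w i)) \<odot> \<pi> (w i)) {..<n}"
      unfolding V.lincomb_def by (rule V.finsum_reindex[OF _ inj]) (use w in \<open>auto simp: carrier_eq \<pi>_ks X_ks\<close>)
    then show ?thesis using \<pi>_sum[of "{..<n}" w "\<lambda>i. a (\<pi> (w i))"] w by simp
  qed
  have "V.lin_indpt ?A"
    by (rule V.finite_lin_indpt2[OF A]) (use indep in \<open>auto simp: lc\<close>)
  moreover have "V.gen_set ?A"
  proof
    show "V.span ?A \<subseteq> carrier Q" by (rule V.span_is_subset2[OF A(2)])
    show "carrier Q \<subseteq> V.span ?A"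
    proof
      fix z assume "z \<in> carrier Q"
      then obtain x where x: "x \<in> X" "z = \<pi> x" by (auto simp: carrier_eq)
      obtain c where c: "\<pi> x = \<pi> (\<Sum>i<n. ks (c i) (w i))" using span[OF x(1)] by blast
      \<comment> \<open>Linear combinations over a set read their coefficients off the vectors, so
        the indexed coefficients are transported along the inverse of the enumeration.\<close>
      define a where "a v = c (the_inv_into {..<n} (\<lambda>i. \<pi> (w i)) v)" for v
      have "V.lincomb a ?A = z"
        using the_inv_into_f_f[OF inj] by (simp add: lc a_def x(2) c)
      then show "z \<in> V.span ?A"
        unfolding V.finite_span[OF A] by auto
    qed
  qed
  ultimately show ?thesis using inj A by (simp add: ordered_basis_def V.basis_def)
qed

lemma ordered_basisE:
  assumes "ordered_basis Q n v"
  obtains w where "\<forall>i<n. w i \<in> X" "\<forall>i<n. v i = \<pi> (w i)"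
    "\<forall>x\<in>X. \<exists>c. \<pi> x = \<pi> (\<Sum>i<n. ks (c i) (w i))"
    "\<forall>c. \<pi> (\<Sum>i<n. ks (c i) (w i)) = \<zero> \<longrightarrow> (\<forall>i<n. c i = 0)"
proof -
  interpret V: vectorspace class_ring Q by (rule vectorspace)
  let ?A = "v ` {..<n}"
  have inj: "inj_on v {..<n}" and li: "V.lin_indpt ?A" and gen: "V.gen_set ?A" and sub: "?A \<subseteq> carrier Q"
    using assms by (auto simp: ordered_basis_def V.basis_def)
  have A: "finite ?A" by simp
  have "\<exists>x. x \<in> X \<and> v i = \<pi> x" if "i < n" for i
    using sub that by (auto simp: carrier_eq)
  then obtain w where w: "\<And>i. i < n \<Longrightarrow> w i \<in> X" "\<And>i. i < n \<Longrightarrow> v i = \<pi> (w i)" by metis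
  have lc: "V.lincomb a ?A = \<pi> (\<Sum>i<n. ks (a (v i)) (w i))" for a
  proof -
    have "V.lincomb a ?A = finsum Q (\<lambda>i. a (v i) \<odot> v i) {..<n}"
      unfolding V.lincomb_def by (rule V.finsum_reindex[OF _ inj]) (use w in \<open>auto simp: carrier_eq \<pi>_ks X_ks\<close>)
    also have "\<dots> = finsum Q (\<lambda>i. a (v i) \<odot> \<pi> (w i)) {..<n}"
      by (rule V.finsum_cong') (use w in \<open>auto simp: carrier_eq \<pi>_ks X_ks\<close>)
    finally show ?thesis using \<pi>_sum[of "{..<n}" w "\<lambda>i. a (v i)"] w by simp
  qed
  show thesis
  proof (rule that[of w]; intro allI ballI impI)
    fix x assume "x \<in> X"
    then have "\<pi> x \<in> V.span ?A" using gen by (auto simp: carrier_eq)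
    then obtain a where "V.lincomb a ?A = \<pi> x" using V.finite_in_span[OF A sub] by blast
    then show "\<exists>c. \<pi> x = \<pi> (\<Sum>i<n. ks (c i) (w i))" using lc[of a] by metis
  next
    fix c i assume c: "\<pi> (\<Sum>i<n. ks (c i) (w i)) = \<zero>" and i: "i < n"
    define a where "a u = c (the_inv_into {..<n} v u)" for u
    have "V.lincomb a ?A = \<zero>"
      using the_inv_into_f_f[OF inj] by (simp add: lc a_def c)
    show "c i = 0"
    proof (rule ccontr)
      assume "c i \<noteq> 0"
      then have "a (v i) \<noteq> 0" using i by (simp add: a_def the_inv_into_f_f[OF inj])
      then have "V.lin_dep ?A" using V.lin_dep_crit[of ?A ?A a "v i"] \<open>V.lincomb a ?A = \<zero>\<close> i by auto
      then show False using li by simp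
    qed
  qed (use w in auto)
qed

end

locale kmod_image_map = V: kmod_image ks X \<pi> V + W: kmod_image ks' X' \<pi>' W
  for ks :: "'k::field \<Rightarrow> 'v::ab_group_add \<Rightarrow> 'v" and X and \<pi> :: "'v \<Rightarrow> 'a" and V :: "('k, 'a, 'y) module_scheme"
    and ks' :: "'k \<Rightarrow> 'w::ab_group_add \<Rightarrow> 'w" and X' and \<pi>' :: "'w \<Rightarrow> 'b" and W :: "('k, 'b, 'z) module_scheme" +
  fixes T :: "'a \<Rightarrow> 'b"
  assumes T_closed: "z \<in> carrier V \<Longrightarrow> T z \<in> carrier W"
    and T_add: "z \<in> carrier V \<Longrightarrow> z' \<in> carrier V \<Longrightarrow> T (z \<oplus>\<^bsub>V\<^esub> z') = T z \<oplus>\<^bsub>W\<^esub> T z'"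
    and T_smult: "z \<in> carrier V \<Longrightarrow> T (c \<odot>\<^bsub>V\<^esub> z) = c \<odot>\<^bsub>W\<^esub> T z"
begin

lemma linear_map: "linear_map class_ring V W T"
  using V.vectorspace W.vectorspace T_closed T_add T_smult V.module W.module
  by (auto simp: linear_map_def mod_hom_def mod_hom_axioms_def LinearCombinations.module_hom_def class_ring_simps)

text \<open>A chosen representative of the value of \<open>T\<close>. It need not be linear itself,
  but its composition with \<pi>' is, because \<open>T\<close> is.\<close>

definition \<tau> :: "'v \<Rightarrow> 'w" where
  "\<tau> x = (SOME y. y \<in> X' \<and> T (\<pi> x) = \<pi>' y)"

lemma \<tau>: "x \<in> X \<Longrightarrow> \<tau> x \<in> X' \<and> T (\<pi> x) = \<pi>' (\<tau> x)"
  unfolding \<tau>_def by (rule someI_ex) (use T_closed[of "\<pi> x"] in \<open>auto simp: V.carrier_eq W.carrier_eq\<close>)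

lemma T_0: "T (\<pi> 0) = \<pi>' 0"
proof -
  have "T (\<pi> (ks 0 0)) = 0 \<odot>\<^bsub>W\<^esub> T (\<pi> 0)"
    using T_smult[of "\<pi> 0" 0] V.X_0 by (simp add: V.carrier_eq V.\<pi>_ks)
  then show ?thesis using \<tau>[OF V.X_0] by (simp add: V.ks_0 W.\<pi>_ks W.ks_0_left)
qed

lemma T_sum:
  assumes "finite I" "\<And>i. i \<in> I \<Longrightarrow> w i \<in> X"
  shows "T (\<pi> (\<Sum>i\<in>I. ks (c i) (w i))) = \<pi>' (\<Sum>i\<in>I. ks' (c i) (\<tau> (w i)))"
  using assms
proof (induct I rule: finite_induct)
  case empty
  then show ?case by (simp add: T_0)
next
  case (insert i I)
  have s: "(\<Sum>i\<in>I. ks (c i) (w i)) \<in> X" by (rule V.X_sum) (use insert.prems V.X_ks in simp)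
  have s': "(\<Sum>i\<in>I. ks' (c i) (\<tau> (w i))) \<in> X'" by (rule W.X_sum) (use insert.prems W.X_ks \<tau> in simp)
  have i: "w i \<in> X" "\<tau> (w i) \<in> X'" "T (\<pi> (w i)) = \<pi>' (\<tau> (w i))" using insert.prems \<tau> by auto
  have "\<pi> (\<Sum>i\<in>insert i I. ks (c i) (w i)) = (c i \<odot>\<^bsub>V\<^esub> \<pi> (w i)) \<oplus>\<^bsub>V\<^esub> \<pi> (\<Sum>i\<in>I. ks (c i) (w i))"
    using insert.hyps i s by (simp add: V.\<pi>_ks V.\<pi>_add V.X_ks)
  also have "T \<dots> = (c i \<odot>\<^bsub>W\<^esub> T (\<pi> (w i))) \<oplus>\<^bsub>W\<^esub> T (\<pi> (\<Sum>i\<in>I. ks (c i) (w i)))"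
  proof -
    have "c i \<odot>\<^bsub>V\<^esub> \<pi> (w i) \<in> carrier V" using i by (simp add: V.carrier_eq V.\<pi>_ks V.X_ks)
    moreover have "\<pi> (\<Sum>i\<in>I. ks (c i) (w i)) \<in> carrier V" using s by (simp add: V.carrier_eq)
    ultimately show ?thesis using T_smult[of "\<pi> (w i)" "c i"] i by (simp add: T_add V.carrier_eq)
  qed
  also have "\<dots> = \<pi>' (\<Sum>i\<in>insert i I. ks' (c i) (\<tau> (w i)))"
    using insert i s' by (simp add: W.\<pi>_ks W.\<pi>_add W.X_ks)
  finally show ?case .
qed

text \<open>\<open>det_vanishes\<close> brings its own bases and its own size, so the forward
  direction turns a null vector of that matrix into a kernel element. The given bases of common size
  \<open>r\<close> serve the converse, where the coordinates of a kernel element form a null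
  vector.\<close>

lemma det_vanishes_iff:
  assumes "ordered_basis V r v" "ordered_basis W r w"
  shows "det_vanishes V W T \<longleftrightarrow> (\<exists>z\<in>carrier V. z \<noteq> \<zero>\<^bsub>V\<^esub> \<and> T z = \<zero>\<^bsub>W\<^esub>)"
proof
  assume "det_vanishes V W T"
  then obtain n v w A where A: "A \<in> carrier_mat n n" and v: "ordered_basis V n v" and w: "ordered_basis W n w"
    and T: "\<And>j. j < n \<Longrightarrow> T (v j) = finsum W (\<lambda>i. A $$ (i, j) \<odot>\<^bsub>W\<^esub> w i) {..<n}" and det: "det A = 0"
    unfolding det_vanishes_def by blast
  obtain x where x: "x \<in> carrier_vec n" "x \<noteq> 0\<^sub>v n" "A *\<^sub>v x = 0\<^sub>v n"
    using det det_0_iff_vec_prod_zero_field[OF A] by blast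
  obtain v' where "\<forall>i<n. v' i \<in> X" "\<forall>i<n. v i = \<pi> (v' i)"
    "\<forall>x\<in>X. \<exists>c. \<pi> x = \<pi> (\<Sum>i<n. ks (c i) (v' i))"
    "\<forall>c. \<pi> (\<Sum>i<n. ks (c i) (v' i)) = \<zero>\<^bsub>V\<^esub> \<longrightarrow> (\<forall>i<n. c i = 0)"
    by (rule V.ordered_basisE[OF v])
  note v' = this[rule_format]
  obtain w' where "\<forall>i<n. w' i \<in> X'" "\<forall>i<n. w i = \<pi>' (w' i)"
    "\<forall>x\<in>X'. \<exists>c. \<pi>' x = \<pi>' (\<Sum>i<n. ks' (c i) (w' i))"
    "\<forall>c. \<pi>' (\<Sum>i<n. ks' (c i) (w' i)) = \<zero>\<^bsub>W\<^esub> \<longrightarrow> (\<forall>i<n. c i = 0)"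
    by (rule W.ordered_basisE[OF w])
  note w' = this[rule_format]
  define z where "z = \<pi> (\<Sum>j<n. ks (x $ j) (v' j))"
  have X: "(\<Sum>j<n. ks (x $ j) (v' j)) \<in> X" by (rule V.X_sum) (use v'(1) V.X_ks in simp)
  interpret abelian_group W by (rule W.abelian_group)
  have Tv: "\<pi>' (\<tau> (v' j)) = \<pi>' (\<Sum>i<n. ks' (A $$ (i, j)) (w' i))" if "j < n" for j
  proof -
    have "\<pi>' (\<tau> (v' j)) = T (v j)" using \<tau> v'(1,2) that by simp
    also have "\<dots> = finsum W (\<lambda>i. A $$ (i, j) \<odot>\<^bsub>W\<^esub> \<pi>' (w' i)) {..<n}"
      unfolding T[OF that] by (rule finsum_cong') (use w'(1,2) in \<open>auto simp: W.carrier_eq W.\<pi>_ks W.X_ks\<close>)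
    finally show ?thesis using W.\<pi>_sum[of "{..<n}" w' "\<lambda>i. A $$ (i, j)"] w'(1) by simp
  qed
  have S: "(\<Sum>i<n. ks' (A $$ (i, j)) (w' i)) \<in> X'" for j
    by (rule W.X_sum) (use w'(1) W.X_ks in simp)
  have "T z = \<pi>' (\<Sum>j<n. ks' (x $ j) (\<tau> (v' j)))"
    unfolding z_def by (rule T_sum) (use v'(1,2) in auto)
  also have "\<dots> = finsum W (\<lambda>j. x $ j \<odot>\<^bsub>W\<^esub> \<pi>' (\<tau> (v' j))) {..<n}"
    using W.\<pi>_sum[of "{..<n}" "\<lambda>j. \<tau> (v' j)" "\<lambda>j. x $ j"] v'(1) \<tau> by simp
  also have "\<dots> = finsum W (\<lambda>j. x $ j \<odot>\<^bsub>W\<^esub> \<pi>' (\<Sum>i<n. ks' (A $$ (i, j)) (w' i))) {..<n}"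
    by (rule finsum_cong') (use S in \<open>auto simp: Tv W.carrier_eq W.\<pi>_ks W.X_ks\<close>)
  also have "\<dots> = \<pi>' (\<Sum>j<n. ks' (x $ j) (\<Sum>i<n. ks' (A $$ (i, j)) (w' i)))"
    using W.\<pi>_sum[of "{..<n}" "\<lambda>j. \<Sum>i<n. ks' (A $$ (i, j)) (w' i)" "\<lambda>j. x $ j"] S by simp
  also have "(\<Sum>j<n. ks' (x $ j) (\<Sum>i<n. ks' (A $$ (i, j)) (w' i))) = (\<Sum>j<n. \<Sum>i<n. ks' (A $$ (i, j) * x $ j) (w' i))"
    by (simp add: W.ks_sum W.ks_ks mult.commute)
  also have "\<dots> = (\<Sum>i<n. \<Sum>j<n. ks' (A $$ (i, j) * x $ j) (w' i))" by (rule sum.swap)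
  also have "\<dots> = (\<Sum>i<n. ks' ((A *\<^sub>v x) $ i) (w' i))"
    using A x(1) by (intro sum.cong refl) (simp add: W.ks_sum_left scalar_prod_def lessThan_atLeast0)
  also have "\<dots> = 0" by (simp add: x(3) W.ks_0_left)
  finally have "T z = \<zero>\<^bsub>W\<^esub>" by (simp add: W.\<pi>_0)
  moreover have "z \<noteq> \<zero>\<^bsub>V\<^esub>"
  proof
    assume "z = \<zero>\<^bsub>V\<^esub>"
    then have "x $ i = 0" if "i < n" for i using v'(4)[of "\<lambda>i. x $ i" i] that by (simp add: z_def)
    then show False using x(1,2) by (auto simp: vec_eq_iff)
  qed
  ultimately show "\<exists>z\<in>carrier V. z \<noteq> \<zero>\<^bsub>V\<^esub> \<and> T z = \<zero>\<^bsub>W\<^esub>" using X by (auto simp: z_def V.carrier_eq)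
next
  assume "\<exists>z\<in>carrier V. z \<noteq> \<zero>\<^bsub>V\<^esub> \<and> T z = \<zero>\<^bsub>W\<^esub>"
  then obtain y where y: "y \<in> X" "\<pi> y \<noteq> \<zero>\<^bsub>V\<^esub>" "T (\<pi> y) = \<zero>\<^bsub>W\<^esub>" by (auto simp: V.carrier_eq)
  obtain v' where "\<forall>i<r. v' i \<in> X" "\<forall>i<r. v i = \<pi> (v' i)"
    "\<forall>x\<in>X. \<exists>c. \<pi> x = \<pi> (\<Sum>i<r. ks (c i) (v' i))"
    "\<forall>c. \<pi> (\<Sum>i<r. ks (c i) (v' i)) = \<zero>\<^bsub>V\<^esub> \<longrightarrow> (\<forall>i<r. c i = 0)"
    by (rule V.ordered_basisE[OF assms(1)])
  note v' = this[rule_format]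
  obtain w' where "\<forall>i<r. w' i \<in> X'" "\<forall>i<r. w i = \<pi>' (w' i)"
    "\<forall>x\<in>X'. \<exists>c. \<pi>' x = \<pi>' (\<Sum>i<r. ks' (c i) (w' i))"
    "\<forall>c. \<pi>' (\<Sum>i<r. ks' (c i) (w' i)) = \<zero>\<^bsub>W\<^esub> \<longrightarrow> (\<forall>i<r. c i = 0)"
    by (rule W.ordered_basisE[OF assms(2)])
  note w' = this[rule_format]
  interpret abelian_group W by (rule W.abelian_group)
  have "\<exists>c. \<pi>' (\<tau> (v' j)) = \<pi>' (\<Sum>i<r. ks' (c i) (w' i))" if "j < r" for j
    using w'(3) \<tau> v'(1) that by blast
  then obtain a where a: "\<And>j. j < r \<Longrightarrow> \<pi>' (\<tau> (v' j)) = \<pi>' (\<Sum>i<r. ks' (a j i) (w' i))" by metis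
  define A where "A = mat r r (\<lambda>(i, j). a j i)"
  have A: "A \<in> carrier_mat r r" by (simp add: A_def)
  have Tv: "T (v j) = finsum W (\<lambda>i. A $$ (i, j) \<odot>\<^bsub>W\<^esub> w i) {..<r}" if "j < r" for j
  proof -
    have "finsum W (\<lambda>i. A $$ (i, j) \<odot>\<^bsub>W\<^esub> w i) {..<r} = finsum W (\<lambda>i. a j i \<odot>\<^bsub>W\<^esub> \<pi>' (w' i)) {..<r}"
      by (rule finsum_cong') (use w'(1,2) that in \<open>auto simp: A_def W.carrier_eq W.\<pi>_ks W.X_ks\<close>)
    also have "\<dots> = \<pi>' (\<Sum>i<r. ks' (a j i) (w' i))" using W.\<pi>_sum[of "{..<r}" w' "a j"] w'(1) by simp
    finally show ?thesis using a that \<tau> v'(1,2) by simp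
  qed
  obtain c where c: "\<pi> y = \<pi> (\<Sum>i<r. ks (c i) (v' i))" using v'(3)[OF y(1)] by blast
  define x where "x = vec r c"
  have x: "x \<in> carrier_vec r" by (simp add: x_def)
  have "x \<noteq> 0\<^sub>v r"
  proof
    assume x0: "x = 0\<^sub>v r"
    have "c i = 0" if "i < r" for i using arg_cong[OF x0, of "\<lambda>x. x $ i"] that by (simp add: x_def)
    then have "(\<Sum>i<r. ks (c i) (v' i)) = 0" by (simp add: V.ks_0_left)
    then show False using c y(2) by (simp add: V.\<pi>_0)
  qed
  moreover have "A *\<^sub>v x = 0\<^sub>v r"
  proof -
    have S: "(\<Sum>i<r. ks' (a j i) (w' i)) \<in> X'" for j
      by (rule W.X_sum) (use w'(1) W.X_ks in simp)
    have "\<zero>\<^bsub>W\<^esub> = \<pi>' (\<Sum>j<r. ks' (c j) (\<tau> (v' j)))"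
      unfolding y(3)[symmetric] c by (rule T_sum) (use v'(1,2) in auto)
    also have "\<dots> = finsum W (\<lambda>j. c j \<odot>\<^bsub>W\<^esub> \<pi>' (\<tau> (v' j))) {..<r}"
      using W.\<pi>_sum[of "{..<r}" "\<lambda>j. \<tau> (v' j)" c] v'(1) \<tau> by simp
    also have "\<dots> = finsum W (\<lambda>j. c j \<odot>\<^bsub>W\<^esub> \<pi>' (\<Sum>i<r. ks' (a j i) (w' i))) {..<r}"
      by (rule finsum_cong') (use S in \<open>auto simp: a W.carrier_eq W.\<pi>_ks W.X_ks\<close>)
    also have "\<dots> = \<pi>' (\<Sum>j<r. ks' (c j) (\<Sum>i<r. ks' (a j i) (w' i)))"
      using W.\<pi>_sum[of "{..<r}" "\<lambda>j. \<Sum>i<r. ks' (a j i) (w' i)" c] S by simp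
    also have "(\<Sum>j<r. ks' (c j) (\<Sum>i<r. ks' (a j i) (w' i))) = (\<Sum>j<r. \<Sum>i<r. ks' (a j i * c j) (w' i))"
      by (simp add: W.ks_sum W.ks_ks mult.commute)
    also have "\<dots> = (\<Sum>i<r. \<Sum>j<r. ks' (a j i * c j) (w' i))" by (rule sum.swap)
    also have "\<dots> = (\<Sum>i<r. ks' (\<Sum>j<r. a j i * c j) (w' i))" by (simp add: W.ks_sum_left)
    finally have "\<pi>' (\<Sum>i<r. ks' (\<Sum>j<r. a j i * c j) (w' i)) = \<zero>\<^bsub>W\<^esub>" by simp
    then have "(\<Sum>j<r. a j i * c j) = 0" if "i < r" for i
      using w'(4)[of "\<lambda>i. \<Sum>j<r. a j i * c j"] that by blast
    then show ?thesis
      by (intro eq_vecI) (auto simp: A_def x_def scalar_prod_def lessThan_atLeast0)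
  qed
  ultimately have "det A = 0" using det_0_iff_vec_prod_zero_field[OF A] x by blast
  then show "det_vanishes V W T" unfolding det_vanishes_def using assms A Tv by blast
qed

text \<open>Rank-nullity: the rank falls short of \<open>r\<close> by the dimension of the
  kernel.\<close>

lemma lin_rank_less_iff:
  assumes "ordered_basis V r v"
  shows "lin_rank W T V < r \<longleftrightarrow> (\<exists>z\<in>carrier V. z \<noteq> \<zero>\<^bsub>V\<^esub> \<and> T z = \<zero>\<^bsub>W\<^esub>)"
proof -
  interpret V': vectorspace class_ring V by (rule V.vectorspace)
  interpret T: linear_map class_ring V W T by (rule linear_map)
  have basis: "V'.basis (v ` {..<r})" and card: "card (v ` {..<r}) = r"
    using assms by (auto simp: ordered_basis_def card_image)
  have fd: "V'.fin_dim" using basis unfolding V'.fin_dim_def V'.basis_def by blast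
  have dim: "V'.dim = r" using V'.dim_basis[OF _ basis] card by simp
  let ?K = "V'.vs T.kerT"
  interpret K: vectorspace class_ring ?K by (rule V'.subspace_is_vs[OF T.kerT_is_subspace])
  have subm: "submodule class_ring T.kerT V" using T.kerT_is_subspace by (simp add: subspace_def)
  have kerV: "T.kerT \<subseteq> carrier V" by (auto simp: T.ker_def)
  \<comment> \<open>Independent subsets of the kernel stay independent in the whole space, so they
    have at most \<open>r\<close> elements. Hence a maximal one exists, and it is a finite basis of
    the kernel.\<close>
  have "\<exists>A. finite A \<and> maximal A (\<lambda>S. S \<subseteq> carrier ?K \<and> K.lin_indpt S)"
  proof (rule maximal_exists)
    fix S assume S: "S \<subseteq> carrier ?K \<and> K.lin_indpt S"
    then have "V'.lin_indpt S" using V'.span_li_not_depend(2)[OF _ subm, of S] by simp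
    then show "finite S \<and> card S \<le> r"
      using V'.li_le_dim[OF fd, of S] S kerV dim by auto
  next
    show "{} \<subseteq> carrier ?K \<and> K.lin_indpt {}" by (auto simp: K.lin_dep_def)
  qed
  then obtain A where A: "finite A" "maximal A (\<lambda>S. S \<subseteq> carrier ?K \<and> K.lin_indpt S)" by blast
  have Ab: "K.basis A" by (rule K.max_li_is_basis[OF A(2)])
  have kdim: "K.dim = card A" by (rule K.dim_basis[OF A(1) Ab])
  have rn: "lin_rank W T V + card A = r"
    using T.rank_nullity[OF fd] dim kdim by (simp add: lin_rank_def T.im_def)
  have "A = {} \<longleftrightarrow> T.kerT = {\<zero>\<^bsub>V\<^esub>}"
  proof
    assume "A = {}"
    then have "K.span {} = T.kerT" using Ab by (simp add: K.basis_def)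
    then show "T.kerT = {\<zero>\<^bsub>V\<^esub>}" by (auto simp: K.span_def K.lincomb_def)
  next
    assume k: "T.kerT = {\<zero>\<^bsub>V\<^esub>}"
    have "\<zero>\<^bsub>V\<^esub> \<notin> A" using K.vs_zero_lin_dep[of A] Ab by (simp add: K.basis_def)
    moreover have "A \<subseteq> T.kerT" using Ab by (simp add: K.basis_def)
    ultimately show "A = {}" using k by auto
  qed
  moreover have "T.kerT = {\<zero>\<^bsub>V\<^esub>} \<longleftrightarrow> \<not> (\<exists>z\<in>carrier V. z \<noteq> \<zero>\<^bsub>V\<^esub> \<and> T z = \<zero>\<^bsub>W\<^esub>)"
    using T.f0_is_0 V'.zero_closed by (auto simp: T.ker_def)
  moreover have "card A = 0 \<longleftrightarrow> A = {}" using A(1) by simp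
  moreover have "lin_rank W T V < r \<longleftrightarrow> card A \<noteq> 0" using rn by linarith
  ultimately show ?thesis by blast
qed

end

declare One_nat_def [simp del]

section \<open>Cech cohomology and connecting maps on the projective line\<close>

section \<open>Cech cohomology of an embedded module\<close>

text \<open>All modules that occur embed linearly into a vector space over the fraction field \<open>F\<close> of \<open>S\<close>.
  The fraction \<open>m / f^j\<close> is then determined by its value there, and the sections over \<open>f \<noteq> 0\<close> become
  a subspace \<open>\<Gamma>\<close>; \<open>H0\<close> is an intersection and \<open>H1\<close> a quotient of such subspaces.\<close>

lemma Union_const: "(\<And>X. X \<in> \<X> \<Longrightarrow> X = c) \<Longrightarrow> \<X> \<noteq> {} \<Longrightarrow> \<Union>\<X> = c"
  by auto

lemma to_fract_power [simp]: "to_fract (x ^ n) = to_fract x ^ n"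
  by (induct n) simp_all

text \<open>An embedding into a vector space over F makes the module torsion free. The extra factor
  \<open>f ^ i\<close> in the equality of fractions can then be cancelled, and a fraction is known
  by its value \<open>fv\<close>.\<close>

locale emb_module = vs: vector_space sc
  for sc :: "(2, 'k::field) mpol fract \<Rightarrow> 'v::ab_group_add \<Rightarrow> 'v" +
  fixes M :: "((2, 'k) mpol, 'm) graded_module" (structure) and \<iota> :: "'m \<Rightarrow> 'v"
  assumes comp_sub: "x \<in> component M n \<Longrightarrow> x \<in> carrier M"
    and comp_add: "x \<in> component M n \<Longrightarrow> y \<in> component M n \<Longrightarrow> x \<oplus> y \<in> component M n"
    and comp_zero: "\<zero> \<in> component M n"
    and comp_smult: "x \<in> component M n \<Longrightarrow> homog k f \<Longrightarrow> f \<odot> x \<in> component M (n + k)"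
    and carrier_add: "x \<in> carrier M \<Longrightarrow> y \<in> carrier M \<Longrightarrow> x \<oplus> y \<in> carrier M"
    and carrier_smult: "x \<in> carrier M \<Longrightarrow> f \<odot> x \<in> carrier M"
    and \<iota>_add: "x \<in> carrier M \<Longrightarrow> y \<in> carrier M \<Longrightarrow> \<iota> (x \<oplus> y) = \<iota> x + \<iota> y"
    and \<iota>_smult: "x \<in> carrier M \<Longrightarrow> \<iota> (f \<odot> x) = sc (to_fract f) (\<iota> x)"
    and \<iota>_zero: "\<iota> \<zero> = 0"
    and \<iota>_inj: "inj_on \<iota> (carrier M)"
begin

definition fv :: "(2, 'k) mpol \<Rightarrow> 'm \<Rightarrow> nat \<Rightarrow> 'v" where
  "fv f m j = sc (1 / to_fract f ^ j) (\<iota> m)"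

definition sec :: "(2, 'k) mpol \<Rightarrow> 'v \<Rightarrow> ('m \<times> nat) set" where
  "sec f x = {(m, j). m \<in> carrier M \<and> fv f m j = x}"

definition \<Gamma> :: "(2, 'k) mpol \<Rightarrow> nat \<Rightarrow> int \<Rightarrow> 'v set" where
  "\<Gamma> f e n = {fv f m j | m j. m \<in> component M (n + int (e * j))}"

definition ks :: "'k \<Rightarrow> 'v \<Rightarrow> 'v" where
  "ks c x = sc (to_fract (Const c)) x"

lemma \<Gamma>I: "m \<in> component M (n + int (e * j)) \<Longrightarrow> x = fv f m j \<Longrightarrow> x \<in> \<Gamma> f e n"
  unfolding \<Gamma>_def by auto

lemma \<Gamma>E:
  assumes "x \<in> \<Gamma> f e n"
  obtains m j where "m \<in> component M (n + int (e * j))" "x = fv f m j"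
  using assms unfolding \<Gamma>_def by auto

lemma carrier_zero: "\<zero> \<in> carrier M"
  using comp_zero comp_sub by blast

lemma ks_laws: "ks c (x + y) = ks c x + ks c y" "ks (c + d) x = ks c x + ks d x"
  "ks c (ks d x) = ks (c * d) x" "ks 1 x = x"
  by (simp_all add: ks_def vs.scale_right_distrib vs.scale_left_distrib Const_add Const_mult)

lemma fv_eq_iff:
  assumes "f \<noteq> 0" "m \<in> carrier M" "m' \<in> carrier M"
  shows "f ^ (i + j') \<odot> m = f ^ (i + j) \<odot> m' \<longleftrightarrow> fv f m' j' = fv f m j"
proof -
  let ?F = "to_fract f"
  have F: "?F \<noteq> 0" using assms(1) by simp
  have "f ^ (i + j') \<odot> m = f ^ (i + j) \<odot> m' \<longleftrightarrow> \<iota> (f ^ (i + j') \<odot> m) = \<iota> (f ^ (i + j) \<odot> m')"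
    using \<iota>_inj assms(2,3) carrier_smult by (metis inj_on_eq_iff)
  also have "\<dots> \<longleftrightarrow> sc (?F ^ (i + j')) (\<iota> m) = sc (?F ^ (i + j)) (\<iota> m')"
    using assms(2,3) by (simp add: \<iota>_smult)
  also have "sc (?F ^ (i + j')) (\<iota> m) = sc (?F ^ (i + j + j')) (fv f m j)"
    using F by (simp add: fv_def power_add)
  also have "sc (?F ^ (i + j)) (\<iota> m') = sc (?F ^ (i + j + j')) (fv f m' j')"
    using F by (simp add: fv_def power_add)
  also have "sc (?F ^ (i + j + j')) (fv f m j) = sc (?F ^ (i + j + j')) (fv f m' j') \<longleftrightarrow> fv f m j = fv f m' j'"
    using F by (subst vs.scale_cancel_left) simp
  finally show ?thesis by auto
qed

lemma frac_eq: "f \<noteq> 0 \<Longrightarrow> m \<in> carrier M \<Longrightarrow> frac M f m j = sec f (fv f m j)"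
  using fv_eq_iff by (auto simp: frac_def sec_def)

lemma fv_add:
  assumes "f \<noteq> 0" "m \<in> carrier M" "m' \<in> carrier M"
  shows "fv f (f ^ j' \<odot> m \<oplus> f ^ j \<odot> m') (j + j') = fv f m j + fv f m' j'"
  using assms by (simp add: fv_def \<iota>_add \<iota>_smult carrier_smult vs.scale_right_distrib power_add)

lemma fv_smult: "m \<in> carrier M \<Longrightarrow> fv f (Const c \<odot> m) j = ks c (fv f m j)"
  by (simp add: fv_def \<iota>_smult ks_def mult.commute)

lemma fv_res:
  assumes "f \<noteq> 0" "g \<noteq> 0" "m \<in> carrier M"
  shows "fv (f * g) (g ^ j \<odot> m) j = fv f m j"
  using assms by (simp add: fv_def \<iota>_smult power_mult_distrib)

lemma \<Gamma>_0: "0 \<in> \<Gamma> f e n"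
proof -
  have "fv f \<zero> 0 = 0" by (simp add: fv_def \<iota>_zero)
  then show ?thesis unfolding \<Gamma>_def using comp_zero by (metis (mono_tags, lifting) mem_Collect_eq)
qed

lemma \<Gamma>_add:
  assumes f: "f \<noteq> 0" "homog (int e) f" and "x \<in> \<Gamma> f e n" "y \<in> \<Gamma> f e n"
  shows "x + y \<in> \<Gamma> f e n"
proof -
  obtain m j m' j' where m: "m \<in> component M (n + int (e * j))" "x = fv f m j"
    and m': "m' \<in> component M (n + int (e * j'))" "y = fv f m' j'" using assms by (auto simp: \<Gamma>_def)
  have "f ^ j' \<odot> m \<in> component M (n + int (e * j) + int e * int j')"
    by (rule comp_smult[OF m(1) homog_power[OF f(2)]])
  moreover have "f ^ j \<odot> m' \<in> component M (n + int (e * j') + int e * int j)"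
    by (rule comp_smult[OF m'(1) homog_power[OF f(2)]])
  ultimately have "f ^ j' \<odot> m \<oplus> f ^ j \<odot> m' \<in> component M (n + int (e * (j + j')))"
    by (intro comp_add) (simp_all add: algebra_simps)
  moreover have "x + y = fv f (f ^ j' \<odot> m \<oplus> f ^ j \<odot> m') (j + j')"
    using fv_add[OF f(1)] m m' comp_sub by simp
  ultimately show ?thesis unfolding \<Gamma>_def by blast
qed

lemma \<Gamma>_ks: "x \<in> \<Gamma> f e n \<Longrightarrow> ks c x \<in> \<Gamma> f e n"
proof -
  assume "x \<in> \<Gamma> f e n"
  then obtain m j where m: "m \<in> component M (n + int (e * j))" "x = fv f m j" by (auto simp: \<Gamma>_def)
  have "Const c \<odot> m \<in> component M (n + int (e * j))" using comp_smult[OF m(1) homog_Const] by simp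
  moreover have "ks c x = fv f (Const c \<odot> m) j" using m comp_sub by (simp add: fv_smult)
  ultimately show ?thesis by (auto simp: \<Gamma>_def)
qed

lemma \<Gamma>_res:
  assumes "f \<noteq> 0" "g \<noteq> 0" "homog (int e') g" "x \<in> \<Gamma> f e n"
  shows "x \<in> \<Gamma> (f * g) (e + e') n"
proof -
  obtain m j where m: "m \<in> component M (n + int (e * j))" "x = fv f m j" using assms by (auto simp: \<Gamma>_def)
  have "g ^ j \<odot> m \<in> component M (n + int (e * j) + int e' * int j)"
    by (rule comp_smult[OF m(1) homog_power[OF assms(3)]])
  then have "g ^ j \<odot> m \<in> component M (n + int ((e + e') * j))" by (simp add: algebra_simps)
  moreover have "x = fv (f * g) (g ^ j \<odot> m) j" using m comp_sub fv_res[OF assms(1,2)] by simp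
  ultimately show ?thesis by (auto simp: \<Gamma>_def)
qed

lemma sec_ex: "x \<in> \<Gamma> f e n \<Longrightarrow> \<exists>m j. (m, j) \<in> sec f x"
  using comp_sub by (auto simp: \<Gamma>_def sec_def)

text \<open>The set of fractions representing \<open>x\<close> is nonempty, and any one of them
  determines the value. Therefore nothing has to be known about \<open>y\<close>.\<close>

lemma sec_eq_iff: "x \<in> \<Gamma> f e n \<Longrightarrow> sec f x = sec f y \<longleftrightarrow> x = y"
proof
  assume "x \<in> \<Gamma> f e n" "sec f x = sec f y"
  then obtain m j where "(m, j) \<in> sec f x" "(m, j) \<in> sec f y" using sec_ex by metis
  then show "x = y" by (simp add: sec_def)
qed simp

lemma sections_image:
  assumes f: "f \<noteq> 0" "homog (int e) f"
  shows "kmod_image ks (\<Gamma> f e n) (sec f) (sections M f e n)"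
proof
  show "carrier (sections M f e n) = sec f ` \<Gamma> f e n"
    using frac_eq[OF f(1)] comp_sub by (fastforce simp: sections_def \<Gamma>_def)
next
  fix x y assume xy: "x \<in> \<Gamma> f e n" "y \<in> \<Gamma> f e n"
  \<comment> \<open>The operation is a union over all representing pairs; every pair contributes the
    same set of fractions.\<close>
  have "frac M f (f ^ j' \<odot> m \<oplus> f ^ j \<odot> m') (j + j') = sec f (x + y)"
    if "(m, j) \<in> sec f x" "(m', j') \<in> sec f y" for m j m' j'
    using that fv_add[OF f(1)] by (auto simp: sec_def[of f x] sec_def[of f y] frac_eq[OF f(1)] carrier_add carrier_smult)
  then show "sec f x \<oplus>\<^bsub>sections M f e n\<^esub> sec f y = sec f (x + y)"
    unfolding sections_def using sec_ex[OF xy(1)] sec_ex[OF xy(2)] by simp (rule Union_const; fast)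
next
  fix x c assume x: "x \<in> \<Gamma> f e n"
  have "frac M f (Const c \<odot> m) j = sec f (ks c x)" if "(m, j) \<in> sec f x" for m j
    using that by (auto simp: sec_def[of f x] frac_eq[OF f(1)] carrier_smult fv_smult)
  then show "c \<odot>\<^bsub>sections M f e n\<^esub> sec f x = sec f (ks c x)"
    unfolding sections_def using sec_ex[OF x] by simp (rule Union_const; fast)
next
  have "fv f \<zero> 0 = 0" by (simp add: fv_def \<iota>_zero)
  then show "\<zero>\<^bsub>sections M f e n\<^esub> = sec f 0"
    by (simp add: sections_def frac_eq[OF f(1)] carrier_zero)
qed (use \<Gamma>_0 \<Gamma>_add[OF f] \<Gamma>_ks ks_laws in auto)

text \<open>Expanding the fraction by a power of \<open>g\<close> does not change its value: inside
  the ambient space, restriction of sections is an inclusion.\<close>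

lemma sec_res_eq:
  assumes "f \<noteq> 0" "g \<noteq> 0" "x \<in> \<Gamma> f e n"
  shows "sec_res M f g (sec f x) = sec (f * g) x"
proof -
  have "frac M (f * g) (g ^ j \<odot> m) j = sec (f * g) x" if "(m, j) \<in> sec f x" for m j
    using that assms(1,2) by (auto simp: sec_def[of f x] frac_eq carrier_smult fv_res)
  then show ?thesis
    unfolding sec_res_def using sec_ex[OF assms(3)] by (intro Union_const) fast+
qed

abbreviation "\<Gamma>s n \<equiv> \<Gamma> s_var 1 n"
abbreviation "\<Gamma>t n \<equiv> \<Gamma> t_var 1 n"
abbreviation "\<Gamma>st n \<equiv> \<Gamma> (s_var * t_var) 2 n"

lemma s_t_nonzero: "s_var \<noteq> (0 :: (2, 'k) mpol)" "t_var \<noteq> (0 :: (2, 'k) mpol)" "s_var * t_var \<noteq> (0 :: (2, 'k) mpol)"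
proof -
  show "s_var \<noteq> (0 :: (2, 'k) mpol)" "t_var \<noteq> (0 :: (2, 'k) mpol)"
    using prime_elem_Var_2[of 0] prime_elem_Var_2[of 1] by (metis not_prime_elem_zero)+
  then show "s_var * t_var \<noteq> (0 :: (2, 'k) mpol)" by simp
qed

lemma s_t_homog: "homog (int 1) (s_var :: (2, 'k) mpol)" "homog (int 1) (t_var :: (2, 'k) mpol)" "homog (int 2) (s_var * t_var :: (2, 'k) mpol)"
  using homog_Var[of 0] homog_Var[of 1] homog_mult[OF homog_Var homog_Var, of 0 1] by simp_all

lemma \<Gamma>s_sub: "x \<in> \<Gamma>s n \<Longrightarrow> x \<in> \<Gamma>st n"
  using \<Gamma>_res[OF s_t_nonzero(1,2) s_t_homog(2), of x 1 n] by (simp add: numeral_2_eq_2)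

lemma \<Gamma>t_sub: "x \<in> \<Gamma>t n \<Longrightarrow> x \<in> \<Gamma>st n"
  using \<Gamma>_res[OF s_t_nonzero(2,1) s_t_homog(1), of x 1 n] by (simp add: numeral_2_eq_2 mult.commute)

lemma s_image: "kmod_image ks (\<Gamma>s n) (sec s_var) (sections M s_var 1 n)"
  and t_image: "kmod_image ks (\<Gamma>t n) (sec t_var) (sections M t_var 1 n)"
  by (rule sections_image[OF s_t_nonzero(1) s_t_homog(1)], rule sections_image[OF s_t_nonzero(2) s_t_homog(2)])

lemma st_image: "kmod_image ks (\<Gamma>st n) (sec (s_var * t_var)) (cech1 M n)"
  unfolding cech1_def by (rule sections_image[OF s_t_nonzero(3) s_t_homog(3)])

lemma cech0_carrier: "carrier (cech0 M n) = (sec s_var ` \<Gamma>s n) \<times> (sec t_var ` \<Gamma>t n)"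
  by (simp add: cech0_def direct_sum_def kmod_image.carrier_eq[OF s_image] kmod_image.carrier_eq[OF t_image])

lemma cech_d_eq:
  assumes "x \<in> \<Gamma>s n" "y \<in> \<Gamma>t n"
  shows "cech_d M n (sec s_var x, sec t_var y) = sec (s_var * t_var) (y - x)"
  using kmod_image.\<pi>_diff[OF st_image \<Gamma>t_sub[OF assms(2)] \<Gamma>s_sub[OF assms(1)]]
    sec_res_eq[OF s_t_nonzero(1,2) assms(1)] sec_res_eq[OF s_t_nonzero(2,1) assms(2)]
  by (simp add: cech_d_def mult.commute)

definition h0 :: "'v \<Rightarrow> ('m \<times> nat) set \<times> ('m \<times> nat) set" where
  "h0 x = (sec s_var x, sec t_var x)"

lemma h0_eq_iff: "x \<in> \<Gamma>s n \<Longrightarrow> h0 x = h0 y \<longleftrightarrow> x = y"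
  using sec_eq_iff by (auto simp: h0_def)

lemma H0_carrier: "carrier (H0 M n) = h0 ` (\<Gamma>s n \<inter> \<Gamma>t n)"
proof -
  have "cech_d M n (sec s_var x, sec t_var y) = \<zero>\<^bsub>cech1 M n\<^esub> \<longleftrightarrow> x = y" if "x \<in> \<Gamma>s n" "y \<in> \<Gamma>t n" for x y
  proof -
    have "y - x \<in> \<Gamma>st n" using that \<Gamma>s_sub \<Gamma>t_sub kmod_image.X_diff[OF st_image] by blast
    then show ?thesis
      using sec_eq_iff[of "y - x" "s_var * t_var" 2 n 0] that by (auto simp: cech_d_eq kmod_image.\<pi>_0[OF st_image])
  qed
  then show ?thesis by (auto simp: H0_def cech0_carrier h0_def)
qed

lemma H0_image: "kmod_image ks (\<Gamma>s n \<inter> \<Gamma>t n) h0 (H0 M n)"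
proof -
  interpret s: kmod_image ks "\<Gamma>s n" "sec s_var" "sections M s_var 1 n" by (rule s_image)
  interpret t: kmod_image ks "\<Gamma>t n" "sec t_var" "sections M t_var 1 n" by (rule t_image)
  show ?thesis
    by standard (auto simp: H0_carrier ks_laws s.X_0 t.X_0 s.X_add t.X_add s.X_ks t.X_ks,
      auto simp: H0_def cech0_def direct_sum_def h0_def s.\<pi>_add t.\<pi>_add s.\<pi>_ks t.\<pi>_ks s.\<pi>_0 t.\<pi>_0)
qed

lemma H0_nonzero_iff: "carrier (H0 M n) \<noteq> {\<zero>\<^bsub>H0 M n\<^esub>} \<longleftrightarrow> (\<exists>x\<in>\<Gamma>s n \<inter> \<Gamma>t n. x \<noteq> 0)"
proof -
  have z: "\<zero>\<^bsub>H0 M n\<^esub> = h0 0" by (rule kmod_image.\<pi>_0[OF H0_image])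
  have "h0 0 \<in> carrier (H0 M n)" using \<Gamma>_0 by (simp add: H0_carrier)
  then have "carrier (H0 M n) \<noteq> {h0 0} \<longleftrightarrow> (\<exists>z\<in>carrier (H0 M n). z \<noteq> h0 0)"
    by blast
  also have "\<dots> \<longleftrightarrow> (\<exists>x\<in>\<Gamma>s n \<inter> \<Gamma>t n. h0 x \<noteq> h0 0)"
    unfolding H0_carrier by simp
  finally show ?thesis unfolding z using h0_eq_iff[of _ n 0] by blast
qed

definition coboundaries :: "int \<Rightarrow> 'v set" where
  "coboundaries n = {y - x | x y. x \<in> \<Gamma>s n \<and> y \<in> \<Gamma>t n}"

definition h1 :: "int \<Rightarrow> 'v \<Rightarrow> ('m \<times> nat) set set" where
  "h1 n x = cech_d M n ` carrier (cech0 M n) +>\<^bsub>cech1 M n\<^esub> sec (s_var * t_var) x"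

lemma cech_d_image: "cech_d M n ` carrier (cech0 M n) = sec (s_var * t_var) ` coboundaries n"
proof -
  have 1: "carrier (cech0 M n) = (\<lambda>z. (sec s_var (fst z), sec t_var (snd z))) ` (\<Gamma>s n \<times> \<Gamma>t n)"
    by (force simp: cech0_carrier)
  have 2: "coboundaries n = (\<lambda>z. snd z - fst z) ` (\<Gamma>s n \<times> \<Gamma>t n)"
    by (force simp: coboundaries_def)
  show ?thesis
    unfolding 1 2 image_image by (rule image_cong) (auto simp: cech_d_eq)
qed

lemma coboundariesI: "x \<in> \<Gamma>s n \<Longrightarrow> y \<in> \<Gamma>t n \<Longrightarrow> z = y - x \<Longrightarrow> z \<in> coboundaries n"
  unfolding coboundaries_def by auto

lemma coboundariesE:
  assumes "z \<in> coboundaries n"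
  obtains x y where "x \<in> \<Gamma>s n" "y \<in> \<Gamma>t n" "z = y - x"
  using assms unfolding coboundaries_def by auto

lemma coboundaries_sub: "x \<in> coboundaries n \<Longrightarrow> x \<in> \<Gamma>st n"
  using \<Gamma>s_sub \<Gamma>t_sub kmod_image.X_diff[OF st_image] by (auto simp: coboundaries_def)

lemma coboundaries_0: "0 \<in> coboundaries n"
  using \<Gamma>_0[of s_var 1 n] \<Gamma>_0[of t_var 1 n] by (force simp: coboundaries_def)

lemma coboundaries_add:
  assumes "x \<in> coboundaries n" "y \<in> coboundaries n" shows "x + y \<in> coboundaries n"
proof -
  obtain a b c d where *: "a \<in> \<Gamma>s n" "b \<in> \<Gamma>t n" "x = b - a" "c \<in> \<Gamma>s n" "d \<in> \<Gamma>t n" "y = d - c"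
    using assms by (auto simp: coboundaries_def)
  then have "x + y = (b + d) - (a + c)" by simp
  then show ?thesis
    using * kmod_image.X_add[OF s_image] kmod_image.X_add[OF t_image] unfolding coboundaries_def by blast
qed

lemma coboundaries_ks:
  assumes "x \<in> coboundaries n" shows "ks c x \<in> coboundaries n"
proof -
  obtain a b where *: "a \<in> \<Gamma>s n" "b \<in> \<Gamma>t n" "x = b - a"
    using assms by (auto simp: coboundaries_def)
  then have "ks c x = ks c b - ks c a" by (simp add: ks_def vs.scale_right_diff_distrib)
  then show ?thesis
    using * \<Gamma>_ks unfolding coboundaries_def by blast
qed

lemma coboundaries_uminus: "x \<in> coboundaries n \<Longrightarrow> - x \<in> coboundaries n"
  using coboundaries_ks[of x n "- 1"] by (simp add: kmod_image.ks_minus_1[OF st_image])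

lemma sec_mem_coboundaries:
  "x \<in> \<Gamma>st n \<Longrightarrow> sec (s_var * t_var) x \<in> cech_d M n ` carrier (cech0 M n) \<longleftrightarrow> x \<in> coboundaries n"
  unfolding cech_d_image using sec_eq_iff[of x] by (auto simp: image_iff)

lemma H1_quotient: "module_quotient (cech1 M n) (cech_d M n ` carrier (cech0 M n)) id"
proof -
  interpret st: kmod_image ks "\<Gamma>st n" "sec (s_var * t_var)" "cech1 M n" by (rule st_image)
  interpret stm: Module.module class_ring "cech1 M n" by (rule st.module)
  show ?thesis
  proof (rule module_quotient.intro)
    show "abelian_group (cech1 M n)" by (rule st.abelian_group)
    show "additive_subgroup (cech_d M n ` carrier (cech0 M n)) (cech1 M n)"
      unfolding additive_subgroup_def cech_d_image
    proof (rule stm.add.subgroupI)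
      show "sec (s_var * t_var) ` coboundaries n \<subseteq> carrier (cech1 M n)"
        using coboundaries_sub by (auto simp: st.carrier_eq)
      show "sec (s_var * t_var) ` coboundaries n \<noteq> {}" using coboundaries_0 by auto
    next
      fix a assume "a \<in> sec (s_var * t_var) ` coboundaries n"
      then show "\<ominus>\<^bsub>cech1 M n\<^esub> a \<in> sec (s_var * t_var) ` coboundaries n"
        using coboundaries_sub coboundaries_uminus by (auto simp: st.\<pi>_uminus)
    next
      fix a b assume "a \<in> sec (s_var * t_var) ` coboundaries n" "b \<in> sec (s_var * t_var) ` coboundaries n"
      then show "a \<oplus>\<^bsub>cech1 M n\<^esub> b \<in> sec (s_var * t_var) ` coboundaries n"
        using coboundaries_sub coboundaries_add by (auto simp: st.\<pi>_add)
    qed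
    show "r \<odot>\<^bsub>cech1 M n\<^esub> x \<in> carrier (cech1 M n)" if "x \<in> carrier (cech1 M n)" for r x
      using that by (auto simp: st.carrier_eq st.\<pi>_ks st.X_ks)
    show "r \<odot>\<^bsub>cech1 M n\<^esub> (x \<oplus>\<^bsub>cech1 M n\<^esub> y) = r \<odot>\<^bsub>cech1 M n\<^esub> x \<oplus>\<^bsub>cech1 M n\<^esub> r \<odot>\<^bsub>cech1 M n\<^esub> y"
      if "x \<in> carrier (cech1 M n)" "y \<in> carrier (cech1 M n)" for r x y
      using that by (auto simp: st.carrier_eq st.\<pi>_ks st.X_ks st.\<pi>_add st.X_add ks_laws)
    show "r \<odot>\<^bsub>cech1 M n\<^esub> x \<in> cech_d M n ` carrier (cech0 M n)" if "x \<in> cech_d M n ` carrier (cech0 M n)" for r x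
      using that coboundaries_sub coboundaries_ks unfolding cech_d_image by (auto simp: st.\<pi>_ks)
    show "r \<odot>\<^bsub>cech1 M n\<^esub> x \<ominus>\<^bsub>cech1 M n\<^esub> r' \<odot>\<^bsub>cech1 M n\<^esub> x \<in> cech_d M n ` carrier (cech0 M n)"
      if "x \<in> carrier (cech1 M n)" "id r = id r'" for r r' x
      using that coboundaries_0 unfolding cech_d_image by (auto simp: st.carrier_eq st.\<pi>_ks st.X_ks st.\<pi>_diff)
    show "\<exists>r. id r = s" for s :: 'k by simp
  qed
qed

lemma H1_image: "kmod_image ks (\<Gamma>st n) (h1 n) (H1 M n)"
proof -
  interpret st: kmod_image ks "\<Gamma>st n" "sec (s_var * t_var)" "cech1 M n" by (rule st_image)
  interpret q: module_quotient "cech1 M n" "cech_d M n ` carrier (cech0 M n)" id by (rule H1_quotient)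
  have c: "sec (s_var * t_var) x \<in> carrier (cech1 M n)" if "x \<in> \<Gamma>st n" for x
    using that by (simp add: st.carrier_eq)
  show ?thesis
  proof
    show "carrier (H1 M n) = h1 n ` \<Gamma>st n"
      unfolding H1_def q.quot_carrier st.carrier_eq by (auto simp: h1_def)
    show "h1 n x \<oplus>\<^bsub>H1 M n\<^esub> h1 n y = h1 n (x + y)" if "x \<in> \<Gamma>st n" "y \<in> \<Gamma>st n" for x y
      using that unfolding H1_def h1_def by (simp add: q.quot_add c st.\<pi>_add)
    show "a \<odot>\<^bsub>H1 M n\<^esub> h1 n x = h1 n (ks a x)" if "x \<in> \<Gamma>st n" for a x
      using that unfolding H1_def h1_def by (subst q.quot_smult[of _ a]) (simp_all add: c st.\<pi>_ks)
    show "\<zero>\<^bsub>H1 M n\<^esub> = h1 n 0"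
      unfolding H1_def h1_def by (simp add: q.quot_zero st.\<pi>_0)
  qed (simp_all add: ks_laws st.X_0 st.X_add st.X_ks)
qed

lemma h1_eq_iff:
  assumes "x \<in> \<Gamma>st n" "y \<in> \<Gamma>st n"
  shows "h1 n x = h1 n y \<longleftrightarrow> x - y \<in> coboundaries n"
proof -
  interpret st: kmod_image ks "\<Gamma>st n" "sec (s_var * t_var)" "cech1 M n" by (rule st_image)
  interpret q: module_quotient "cech1 M n" "cech_d M n ` carrier (cech0 M n)" id by (rule H1_quotient)
  show ?thesis
    unfolding h1_def using assms st.X_diff
    by (subst q.coset_eq_iff) (simp_all add: st.carrier_eq st.\<pi>_diff sec_mem_coboundaries)
qed

lemma h1_eq_0_iff: "x \<in> \<Gamma>st n \<Longrightarrow> h1 n x = \<zero>\<^bsub>H1 M n\<^esub> \<longleftrightarrow> x \<in> coboundaries n"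
  using h1_eq_iff[of x n 0] \<Gamma>_0 by (simp add: kmod_image.\<pi>_0[OF H1_image])

end

section \<open>The connecting homomorphism\<close>

text \<open>\<open>lift\<close> is surjectivity of the map of sheaves on the two charts: \<phi> need
  not be onto, but a homogeneous element lifts after multiplication by some power of s, and likewise
  for t. \<Phi> extends \<phi> to fractions.\<close>

locale emb_epi = M: emb_module sc M \<iota> + M2: emb_module sc2 M2 \<iota>2
  for sc :: "(2, 'k::field) mpol fract \<Rightarrow> 'v::ab_group_add \<Rightarrow> 'v"
    and M :: "((2, 'k) mpol, 'm) graded_module" and \<iota> :: "'m \<Rightarrow> 'v"
    and sc2 :: "(2, 'k) mpol fract \<Rightarrow> 'w::ab_group_add \<Rightarrow> 'w"
    and M2 :: "((2, 'k) mpol, 'n) graded_module" and \<iota>2 :: "'n \<Rightarrow> 'w" +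
  fixes \<phi> :: "'m \<Rightarrow> 'n" and \<Phi> :: "'v \<Rightarrow> 'w"
  assumes \<phi>_closed: "m \<in> carrier M \<Longrightarrow> \<phi> m \<in> carrier M2"
    and \<phi>_comp: "m \<in> component M n \<Longrightarrow> \<phi> m \<in> component M2 n"
    and \<Phi>_add: "\<Phi> (x + y) = \<Phi> x + \<Phi> y" and \<Phi>_sc: "\<Phi> (sc a x) = sc2 a (\<Phi> x)"
    and \<iota>_\<phi>: "m \<in> carrier M \<Longrightarrow> \<iota>2 (\<phi> m) = \<Phi> (\<iota> m)"
    and lift: "m2 \<in> component M2 n \<Longrightarrow> f = s_var \<or> f = t_var \<Longrightarrow>
      \<exists>N m. m \<in> component M (n + int N) \<and> \<phi> m = f ^ N \<odot>\<^bsub>M2\<^esub> m2"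
begin

abbreviation K where "K \<equiv> kernel_module M M2 \<phi>"

lemma \<Phi>_0: "\<Phi> 0 = 0"
  using \<Phi>_add[of 0 0] by simp

lemma \<Phi>_diff: "\<Phi> (x - y) = \<Phi> x - \<Phi> y"
  using \<Phi>_add[of "x - y" y] by (simp add: algebra_simps)

lemma ker_iff: "m \<in> carrier M \<Longrightarrow> \<phi> m = \<zero>\<^bsub>M2\<^esub> \<longleftrightarrow> \<Phi> (\<iota> m) = 0"
proof -
  assume m: "m \<in> carrier M"
  have "\<phi> m = \<zero>\<^bsub>M2\<^esub> \<longleftrightarrow> \<iota>2 (\<phi> m) = \<iota>2 \<zero>\<^bsub>M2\<^esub>"
    using M2.\<iota>_inj \<phi>_closed[OF m] M2.carrier_zero by (metis inj_on_eq_iff)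
  then show ?thesis by (simp add: M2.\<iota>_zero \<iota>_\<phi>[OF m])
qed

lemma K_simps: "carrier K = {m \<in> carrier M. \<Phi> (\<iota> m) = 0}" "component K n = {m \<in> component M n. \<Phi> (\<iota> m) = 0}"
  "add K = add M" "smult K = smult M" "zero K = zero M"
  using ker_iff M.comp_sub by (auto simp: kernel_module_def)

lemma K_emb: "emb_module sc K \<iota>"
  by standard (auto simp: K_simps \<Phi>_add \<Phi>_sc \<Phi>_0 M.comp_sub M.comp_add M.comp_zero M.comp_smult M.carrier_add
      M.carrier_smult M.\<iota>_add M.\<iota>_smult M.\<iota>_zero M2.vs.scale_zero_right intro: inj_on_subset[OF M.\<iota>_inj])

sublocale K: emb_module sc K \<iota>
  by (rule K_emb)

lemma \<Phi>_fv: "m \<in> carrier M \<Longrightarrow> \<Phi> (M.fv f m j) = M2.fv f (\<phi> m) j"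
  by (simp add: M.fv_def M2.fv_def \<Phi>_sc \<iota>_\<phi>)

text \<open>Left exactness of localization: dividing by a power of \<open>f\<close> does not affect
  whether \<Phi> vanishes.\<close>

lemma K_\<Gamma>:
  assumes "f \<noteq> 0"
  shows "K.\<Gamma> f e n = {x \<in> M.\<Gamma> f e n. \<Phi> x = 0}"
proof -
  have *: "\<Phi> (M.fv f m j) = 0 \<longleftrightarrow> \<Phi> (\<iota> m) = 0" for m j
    using assms by (simp add: M.fv_def \<Phi>_sc M2.vs.scale_eq_0_iff)
  show ?thesis
  proof (rule equalityI; rule subsetI)
    fix x assume "x \<in> K.\<Gamma> f e n"
    then obtain m j where m: "m \<in> component K (n + int (e * j))" "x = K.fv f m j" by (rule K.\<Gamma>E)
    then have "m \<in> component M (n + int (e * j))" "x = M.fv f m j" "\<Phi> x = 0"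
      using * by (simp_all add: K_simps(2))
    then show "x \<in> {x \<in> M.\<Gamma> f e n. \<Phi> x = 0}" using M.\<Gamma>I by blast
  next
    fix x assume x: "x \<in> {x \<in> M.\<Gamma> f e n. \<Phi> x = 0}"
    then obtain m j where m: "m \<in> component M (n + int (e * j))" "x = M.fv f m j" using M.\<Gamma>E by blast
    then have "m \<in> component K (n + int (e * j))" "x = K.fv f m j"
      using * x by (simp_all add: K_simps(2))
    then show "x \<in> K.\<Gamma> f e n" by (rule K.\<Gamma>I)
  qed
qed

lemma \<Phi>_\<Gamma>: "x \<in> M.\<Gamma> f e n \<Longrightarrow> \<Phi> x \<in> M2.\<Gamma> f e n"
  using \<phi>_comp \<Phi>_fv M.comp_sub unfolding M.\<Gamma>_def M2.\<Gamma>_def by fast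

text \<open>The power of \<open>f\<close> needed to lift the numerator is absorbed by the
  denominator.\<close>

lemma \<Phi>_surj:
  assumes z: "z \<in> M2.\<Gamma> f 1 n" and f: "f = s_var \<or> f = t_var"
  shows "\<exists>x\<in>M.\<Gamma> f 1 n. \<Phi> x = z"
proof -
  have f0: "to_fract f \<noteq> 0" using f M.s_t_nonzero by auto
  obtain m2 j where m2: "m2 \<in> component M2 (n + int j)" "z = M2.fv f m2 j" using z by (auto simp: M2.\<Gamma>_def)
  obtain N m where m: "m \<in> component M (n + int j + int N)" "\<phi> m = f ^ N \<odot>\<^bsub>M2\<^esub> m2"
    using lift[OF m2(1) f] by blast
  have "M.fv f m (j + N) \<in> M.\<Gamma> f 1 n" by (rule M.\<Gamma>I[OF _ refl]) (use m(1) in \<open>simp add: add.assoc\<close>)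
  moreover have "\<Phi> (M.fv f m (j + N)) = z"
    using M.comp_sub[OF m(1)] M2.comp_sub[OF m2(1)] f0
    by (simp add: \<Phi>_fv m(2) m2(2) M2.fv_def M2.\<iota>_smult power_add)
  ultimately show ?thesis by blast
qed

lemma sec_map_\<phi>:
  assumes "f \<noteq> 0" "x \<in> M.\<Gamma> f e n"
  shows "sec_map M2 \<phi> f (M.sec f x) = M2.sec f (\<Phi> x)"
proof -
  have "frac M2 f (\<phi> m) j = M2.sec f (\<Phi> x)" if "(m, j) \<in> M.sec f x" for m j
    using that assms(1) \<Phi>_fv by (auto simp: M.sec_def M2.frac_eq \<phi>_closed)
  then show ?thesis
    unfolding sec_map_def using M.sec_ex[OF assms(2)] by (intro Union_const) fast+
qed

lemma sec_map_incl:
  assumes "f \<noteq> 0" "x \<in> K.\<Gamma> f e n"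
  shows "sec_map M id f (K.sec f x) = M.sec f x"
proof -
  have "frac M f (id m) j = M.sec f x" if "(m, j) \<in> K.sec f x" for m j
  proof -
    have "m \<in> carrier M" "M.fv f m j = x" using that by (simp_all add: K.sec_def K_simps(1))
    then show ?thesis using M.frac_eq[OF assms(1)] by simp
  qed
  then show ?thesis
    unfolding sec_map_def using K.sec_ex[OF assms(2)] by (intro Union_const) fast+
qed

text \<open>The definite description is legitimate because two lifts of \<open>z\<close> over a
  chart differ by a section of \<open>K\<close> there. The differences of the two pairs of lifts
  thus differ by a coboundary of \<open>K\<close>.\<close>

lemma connecting_eq:
  assumes x: "x \<in> M.\<Gamma>s n" "\<Phi> x = z" and y: "y \<in> M.\<Gamma>t n" "\<Phi> y = z"
  shows "connecting M M2 \<phi> n (M2.h0 z) = K.h1 n (y - x)"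
  unfolding connecting_def Let_def
proof (rule the_equality)
  note nz = M.s_t_nonzero
  have yx: "y - x \<in> K.\<Gamma>st n"
    using x y M.\<Gamma>s_sub M.\<Gamma>t_sub kmod_image.X_diff[OF M.st_image] by (simp add: K_\<Gamma>[OF nz(3)] \<Phi>_diff)
  show "\<exists>b\<in>carrier (cech0 M n). \<exists>a\<in>carrier (cech1 K n).
       map_prod (sec_map M2 \<phi> s_var) (sec_map M2 \<phi> t_var) b = M2.h0 z \<and>
       sec_map M id (s_var * t_var) a = cech_d M n b \<and>
       K.h1 n (y - x) = cech_d K n ` carrier (cech0 K n) +>\<^bsub>cech1 K n\<^esub> a"
  proof (intro bexI conjI)
    show "map_prod (sec_map M2 \<phi> s_var) (sec_map M2 \<phi> t_var) (M.sec s_var x, M.sec t_var y) = M2.h0 z"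
      using x y by (simp add: sec_map_\<phi>[OF nz(1) x(1)] sec_map_\<phi>[OF nz(2) y(1)] M2.h0_def)
    show "sec_map M id (s_var * t_var) (K.sec (s_var * t_var) (y - x)) = cech_d M n (M.sec s_var x, M.sec t_var y)"
      using sec_map_incl[OF nz(3) yx] M.cech_d_eq[OF x(1) y(1)] by simp
    show "K.h1 n (y - x) = cech_d K n ` carrier (cech0 K n) +>\<^bsub>cech1 K n\<^esub> K.sec (s_var * t_var) (y - x)"
      by (simp add: K.h1_def)
    show "(M.sec s_var x, M.sec t_var y) \<in> carrier (cech0 M n)"
      using x y by (simp add: M.cech0_carrier)
    show "K.sec (s_var * t_var) (y - x) \<in> carrier (cech1 K n)"
      using yx by (simp add: kmod_image.carrier_eq[OF K.st_image])
  qed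
  fix h assume "\<exists>b\<in>carrier (cech0 M n). \<exists>a\<in>carrier (cech1 K n).
       map_prod (sec_map M2 \<phi> s_var) (sec_map M2 \<phi> t_var) b = M2.h0 z \<and>
       sec_map M id (s_var * t_var) a = cech_d M n b \<and>
       h = cech_d K n ` carrier (cech0 K n) +>\<^bsub>cech1 K n\<^esub> a"
  then obtain b a where b: "b \<in> carrier (cech0 M n)" and a: "a \<in> carrier (cech1 K n)"
    and 1: "map_prod (sec_map M2 \<phi> s_var) (sec_map M2 \<phi> t_var) b = M2.h0 z"
    and 2: "sec_map M id (s_var * t_var) a = cech_d M n b"
    and 3: "h = cech_d K n ` carrier (cech0 K n) +>\<^bsub>cech1 K n\<^esub> a" by blast
  obtain x' y' where x': "x' \<in> M.\<Gamma>s n" and y': "y' \<in> M.\<Gamma>t n" and b': "b = (M.sec s_var x', M.sec t_var y')"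
    using b by (auto simp: M.cech0_carrier)
  obtain w where w: "w \<in> K.\<Gamma>st n" "a = K.sec (s_var * t_var) w"
    using a by (auto simp: kmod_image.carrier_eq[OF K.st_image])
  have x'z: "\<Phi> x' = z" and y'z: "\<Phi> y' = z"
    using 1 M2.sec_eq_iff[OF \<Phi>_\<Gamma>[OF x'], of z] M2.sec_eq_iff[OF \<Phi>_\<Gamma>[OF y'], of z]
    by (simp_all add: b' M2.h0_def sec_map_\<phi>[OF nz(1) x'] sec_map_\<phi>[OF nz(2) y'])
  have wM: "w \<in> M.\<Gamma>st n" using w by (simp add: K_\<Gamma>[OF nz(3)])
  have "M.sec (s_var * t_var) w = M.sec (s_var * t_var) (y' - x')"
    using 2 by (simp add: w(2) b' sec_map_incl[OF nz(3) w(1)] M.cech_d_eq[OF x' y'])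
  then have w': "w = y' - x'" using M.sec_eq_iff[OF wM] by simp
  have "w - (y - x) \<in> K.coboundaries n"
  proof -
    have "w - (y - x) = (y' - y) - (x' - x)" by (simp add: w')
    moreover have "x' - x \<in> K.\<Gamma>s n" "y' - y \<in> K.\<Gamma>t n"
      using x y x' y' x'z y'z kmod_image.X_diff[OF M.s_image] kmod_image.X_diff[OF M.t_image]
      by (simp_all add: K_\<Gamma>[OF nz(1)] K_\<Gamma>[OF nz(2)] \<Phi>_diff)
    ultimately show ?thesis using K.coboundariesI by blast
  qed
  then have "K.h1 n w = K.h1 n (y - x)" using K.h1_eq_iff[OF w(1) yx] by simp
  then show "h = K.h1 n (y - x)" by (simp add: 3 w(2) K.h1_def)
qed

lemma H0_M2_lift:
  assumes "c \<in> carrier (H0 M2 n)"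
  obtains z x y where "c = M2.h0 z" "z \<in> M2.\<Gamma>s n \<inter> M2.\<Gamma>t n"
    "x \<in> M.\<Gamma>s n" "\<Phi> x = z" "y \<in> M.\<Gamma>t n" "\<Phi> y = z" "y - x \<in> K.\<Gamma>st n"
proof -
  obtain z where z: "c = M2.h0 z" "z \<in> M2.\<Gamma>s n \<inter> M2.\<Gamma>t n" using assms by (auto simp: M2.H0_carrier)
  obtain x where x: "x \<in> M.\<Gamma>s n" "\<Phi> x = z" using \<Phi>_surj[of z s_var n] z by auto
  obtain y where y: "y \<in> M.\<Gamma>t n" "\<Phi> y = z" using \<Phi>_surj[of z t_var n] z by auto
  have "y - x \<in> K.\<Gamma>st n"
    using x y M.\<Gamma>s_sub M.\<Gamma>t_sub kmod_image.X_diff[OF M.st_image] by (simp add: K_\<Gamma>[OF M.s_t_nonzero(3)] \<Phi>_diff)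
  then show thesis using z x y that by blast
qed

text \<open>Lifts are not chosen linearly, but \<open>connecting_eq\<close> accepts any lifts, in
  particular sums and multiples of lifts.\<close>

lemma connecting_linear:
  "kmod_image_map M2.ks (M2.\<Gamma>s n \<inter> M2.\<Gamma>t n) M2.h0 (H0 M2 n) M.ks (K.\<Gamma>st n) (K.h1 n) (H1 K n) (connecting M M2 \<phi> n)"
proof -
  interpret V: kmod_image M2.ks "M2.\<Gamma>s n \<inter> M2.\<Gamma>t n" M2.h0 "H0 M2 n" by (rule M2.H0_image)
  interpret W: kmod_image M.ks "K.\<Gamma>st n" "K.h1 n" "H1 K n" by (rule K.H1_image)
  have \<Phi>_ks: "\<Phi> (M.ks c x) = M2.ks c (\<Phi> x)" for c x by (simp add: M.ks_def M2.ks_def \<Phi>_sc)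
  show ?thesis
  proof
    fix c assume c: "c \<in> carrier (H0 M2 n)"
    obtain z x y where z: "c = M2.h0 z" "z \<in> M2.\<Gamma>s n \<inter> M2.\<Gamma>t n"
      "x \<in> M.\<Gamma>s n" "\<Phi> x = z" "y \<in> M.\<Gamma>t n" "\<Phi> y = z" "y - x \<in> K.\<Gamma>st n" by (rule H0_M2_lift[OF c])
    show "connecting M M2 \<phi> n c \<in> carrier (H1 K n)"
      unfolding z(1) connecting_eq[OF z(3-6)] W.carrier_eq using z(7) by (rule imageI)
  next
    fix c c' assume c: "c \<in> carrier (H0 M2 n)" and c': "c' \<in> carrier (H0 M2 n)"
    obtain z x y where z: "c = M2.h0 z" "z \<in> M2.\<Gamma>s n \<inter> M2.\<Gamma>t n"
      "x \<in> M.\<Gamma>s n" "\<Phi> x = z" "y \<in> M.\<Gamma>t n" "\<Phi> y = z" "y - x \<in> K.\<Gamma>st n" by (rule H0_M2_lift[OF c])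
    obtain z' x' y' where z': "c' = M2.h0 z'" "z' \<in> M2.\<Gamma>s n \<inter> M2.\<Gamma>t n"
      "x' \<in> M.\<Gamma>s n" "\<Phi> x' = z'" "y' \<in> M.\<Gamma>t n" "\<Phi> y' = z'" "y' - x' \<in> K.\<Gamma>st n" by (rule H0_M2_lift[OF c'])
    have "c \<oplus>\<^bsub>H0 M2 n\<^esub> c' = M2.h0 (z + z')" using z z' by (simp add: V.\<pi>_add)
    moreover have "connecting M M2 \<phi> n (M2.h0 (z + z')) = K.h1 n ((y + y') - (x + x'))"
      by (rule connecting_eq) (use z z' kmod_image.X_add[OF M.s_image] kmod_image.X_add[OF M.t_image] \<Phi>_add in auto)
    moreover have "(y + y') - (x + x') = (y - x) + (y' - x')" by simp
    ultimately show "connecting M M2 \<phi> n (c \<oplus>\<^bsub>H0 M2 n\<^esub> c') = connecting M M2 \<phi> n c \<oplus>\<^bsub>H1 K n\<^esub> connecting M M2 \<phi> n c'"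
      using z z' by (simp add: connecting_eq[of x n z y] connecting_eq[of x' n z' y'] W.\<pi>_add)
  next
    fix c a assume c: "c \<in> carrier (H0 M2 n)"
    obtain z x y where z: "c = M2.h0 z" "z \<in> M2.\<Gamma>s n \<inter> M2.\<Gamma>t n"
      "x \<in> M.\<Gamma>s n" "\<Phi> x = z" "y \<in> M.\<Gamma>t n" "\<Phi> y = z" "y - x \<in> K.\<Gamma>st n" by (rule H0_M2_lift[OF c])
    have "a \<odot>\<^bsub>H0 M2 n\<^esub> c = M2.h0 (M2.ks a z)" using z by (simp add: V.\<pi>_ks)
    moreover have "connecting M M2 \<phi> n (M2.h0 (M2.ks a z)) = K.h1 n (M.ks a y - M.ks a x)"
      by (rule connecting_eq) (use z M.\<Gamma>_ks \<Phi>_ks in auto)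
    moreover have "M.ks a y - M.ks a x = M.ks a (y - x)" by (simp add: M.ks_def M.vs.scale_right_diff_distrib)
    ultimately show "connecting M M2 \<phi> n (a \<odot>\<^bsub>H0 M2 n\<^esub> c) = a \<odot>\<^bsub>H1 K n\<^esub> connecting M M2 \<phi> n c"
      using z by (simp add: connecting_eq[of x n z y] W.\<pi>_ks)
  qed
qed

text \<open>Exactness of the long sequence at H0 of \<open>M\<close>, on elements: a nonzero section
  is either killed by \<Phi>, hence a section of \<open>K\<close>, or its image is nonzero and has
  connecting class 0.\<close>

lemma H0_nonzero_iff:
  "carrier (H0 M n) \<noteq> {\<zero>\<^bsub>H0 M n\<^esub>} \<longleftrightarrow> carrier (H0 K n) \<noteq> {\<zero>\<^bsub>H0 K n\<^esub>} \<or>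
     (\<exists>c\<in>carrier (H0 M2 n). c \<noteq> \<zero>\<^bsub>H0 M2 n\<^esub> \<and> connecting M M2 \<phi> n c = \<zero>\<^bsub>H1 K n\<^esub>)"
proof
  assume "carrier (H0 M n) \<noteq> {\<zero>\<^bsub>H0 M n\<^esub>}"
  then obtain x where x: "x \<in> M.\<Gamma>s n" "x \<in> M.\<Gamma>t n" "x \<noteq> 0" by (auto simp: M.H0_nonzero_iff)
  show "carrier (H0 K n) \<noteq> {\<zero>\<^bsub>H0 K n\<^esub>} \<or>
     (\<exists>c\<in>carrier (H0 M2 n). c \<noteq> \<zero>\<^bsub>H0 M2 n\<^esub> \<and> connecting M M2 \<phi> n c = \<zero>\<^bsub>H1 K n\<^esub>)"
  proof (cases "\<Phi> x = 0")
    case True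
    then have "x \<in> K.\<Gamma>s n \<inter> K.\<Gamma>t n" using x M.s_t_nonzero by (simp add: K_\<Gamma>)
    then show ?thesis using x K.H0_nonzero_iff by blast
  next
    case False
    have "connecting M M2 \<phi> n (M2.h0 (\<Phi> x)) = K.h1 n (x - x)"
      by (rule connecting_eq) (use x in auto)
    also have "\<dots> = \<zero>\<^bsub>H1 K n\<^esub>" by (simp add: kmod_image.\<pi>_0[OF K.H1_image])
    finally have "connecting M M2 \<phi> n (M2.h0 (\<Phi> x)) = \<zero>\<^bsub>H1 K n\<^esub>" .
    moreover have "M2.h0 (\<Phi> x) \<in> carrier (H0 M2 n)" using \<Phi>_\<Gamma> x by (simp add: M2.H0_carrier)
    moreover have "M2.h0 (\<Phi> x) \<noteq> \<zero>\<^bsub>H0 M2 n\<^esub>"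
      using M2.h0_eq_iff[OF \<Phi>_\<Gamma>[OF x(1)], of 0] False by (simp add: kmod_image.\<pi>_0[OF M2.H0_image])
    ultimately show ?thesis by blast
  qed
next
  assume "carrier (H0 K n) \<noteq> {\<zero>\<^bsub>H0 K n\<^esub>} \<or>
     (\<exists>c\<in>carrier (H0 M2 n). c \<noteq> \<zero>\<^bsub>H0 M2 n\<^esub> \<and> connecting M M2 \<phi> n c = \<zero>\<^bsub>H1 K n\<^esub>)"
  then show "carrier (H0 M n) \<noteq> {\<zero>\<^bsub>H0 M n\<^esub>}"
  proof
    assume "carrier (H0 K n) \<noteq> {\<zero>\<^bsub>H0 K n\<^esub>}"
    then obtain x where "x \<in> K.\<Gamma>s n \<inter> K.\<Gamma>t n" "x \<noteq> 0" by (auto simp: K.H0_nonzero_iff)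
    then have "x \<in> M.\<Gamma>s n \<inter> M.\<Gamma>t n" "x \<noteq> 0" using M.s_t_nonzero by (simp_all add: K_\<Gamma>)
    then show ?thesis using M.H0_nonzero_iff by blast
  next
    assume "\<exists>c\<in>carrier (H0 M2 n). c \<noteq> \<zero>\<^bsub>H0 M2 n\<^esub> \<and> connecting M M2 \<phi> n c = \<zero>\<^bsub>H1 K n\<^esub>"
    then obtain c where c: "c \<in> carrier (H0 M2 n)" "c \<noteq> \<zero>\<^bsub>H0 M2 n\<^esub>" "connecting M M2 \<phi> n c = \<zero>\<^bsub>H1 K n\<^esub>" by blast
    obtain z x y where z: "c = M2.h0 z" "z \<in> M2.\<Gamma>s n \<inter> M2.\<Gamma>t n"
      "x \<in> M.\<Gamma>s n" "\<Phi> x = z" "y \<in> M.\<Gamma>t n" "\<Phi> y = z" "y - x \<in> K.\<Gamma>st n" by (rule H0_M2_lift[OF c(1)])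
    have "y - x \<in> K.coboundaries n"
      using c(3) z by (simp add: connecting_eq K.h1_eq_0_iff)
    then obtain a b where ab: "a \<in> K.\<Gamma>s n" "b \<in> K.\<Gamma>t n" "y - x = b - a" by (rule K.coboundariesE)
    have a: "a \<in> M.\<Gamma>s n" "\<Phi> a = 0" and b: "b \<in> M.\<Gamma>t n" "\<Phi> b = 0"
      using ab M.s_t_nonzero by (simp_all add: K_\<Gamma>)
    \<comment> \<open>The lifts, corrected by sections of \<open>K\<close>, agree on the overlap and
      so glue to a global section of \<open>M\<close> above \<open>z\<close>.\<close>
    have eq: "x - a = y - b" using ab(3) by (simp add: algebra_simps)
    have "x - a \<in> M.\<Gamma>s n" using kmod_image.X_diff[OF M.s_image] z(3) a(1) .
    moreover have "x - a \<in> M.\<Gamma>t n" unfolding eq using kmod_image.X_diff[OF M.t_image] z(5) b(1) .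
    moreover have "x - a \<noteq> 0"
    proof
      assume "x - a = 0"
      then have "z = 0" using z(4) a(2) by simp
      then show False using c(2) z(1) by (simp add: kmod_image.\<pi>_0[OF M2.H0_image])
    qed
    ultimately show ?thesis using M.H0_nonzero_iff by blast
  qed
qed

end

section \<open>Line bundles\<close>

text \<open>For a coboundary relation with denominators \<open>S\<close>, a power of s, and
  \<open>T\<close>, a power of t. Choosing \<open>S'\<close> and \<open>T'\<close> to complete these
  to the same exponent exhibits the numerator \<open>h\<close> in the ideal of two equal powers of s
  and t.\<close>

lemma clear_denominators:
  fixes b :: "'a::field"
  assumes "b \<noteq> 0" "S \<noteq> 0" "T \<noteq> 0" "S' \<noteq> 0" "T' \<noteq> 0"
    and eq: "b * h / ((S' * S) * (T' * T)) = b * g' / T - b * g / S"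
  shows "h = (S' * S) * (T' * g') - (T' * T) * (S' * g)"
proof -
  have "b * h = (b * g' / T - b * g / S) * ((S' * S) * (T' * T))"
    using eq assms(1-5) by (simp add: nonzero_divide_eq_eq del: times_divide_eq_right times_divide_eq_left)
  also have "\<dots> = b * ((S' * S) * (T' * g') - (T' * T) * (S' * g))"
    using assms(2,3) by (simp add: field_simps)
  finally show ?thesis using assms(1) by simp
qed

text \<open>The sheaf of \<open>M\<close> sits in F as \<open>b\<close> times O(c): in degree n all
  values are \<open>b\<close> times forms of degree n + c, and each such product is attained after
  multiplication by a power of s, and also by a power of t.\<close>

locale line_bundle = emb_module "(*)" M \<iota>
  for M :: "((2, 'k::field) mpol, 'm) graded_module" and \<iota> :: "'m \<Rightarrow> (2, 'k) mpol fract" +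
  fixes b :: "(2, 'k) mpol" and c :: int
  assumes b_nonzero: "b \<noteq> 0"
    and comp_form: "m \<in> component M n \<Longrightarrow> \<exists>g. homog (n + c) g \<and> \<iota> m = to_fract (b * g)"
    and comp_ex: "homog (n + c) g \<Longrightarrow> f = s_var \<or> f = t_var \<Longrightarrow>
      \<exists>N. \<exists>m\<in>component M (n + int N). \<iota> m = to_fract (b * (f ^ N * g))"
begin

lemma \<Gamma>_form: "x \<in> \<Gamma> f e n \<Longrightarrow> \<exists>g j. homog (n + int (e * j) + c) g \<and> x = to_fract (b * g) / to_fract f ^ j"
proof -
  assume "x \<in> \<Gamma> f e n"
  then obtain m j where m: "m \<in> component M (n + int (e * j))" "x = fv f m j" by (rule \<Gamma>E)
  obtain g where "homog (n + int (e * j) + c) g" "\<iota> m = to_fract (b * g)" using comp_form[OF m(1)] by blast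
  then show ?thesis using m(2) by (auto simp: fv_def)
qed

lemma \<Gamma>_ex:
  assumes "homog (n + int j + c) g" "f = s_var \<or> f = t_var"
  shows "to_fract (b * g) / to_fract f ^ j \<in> \<Gamma> f 1 n"
proof -
  obtain N m where m: "m \<in> component M (n + int j + int N)" "\<iota> m = to_fract (b * (f ^ N * g))"
    using comp_ex[OF assms] by blast
  have "to_fract f \<noteq> 0" using assms(2) s_t_nonzero by auto
  then have "to_fract (b * g) / to_fract f ^ j = fv f m (j + N)" by (simp add: fv_def m(2) power_add)
  then show ?thesis using m(1) by (intro \<Gamma>I[where j = "j + N"]) (simp_all add: add.assoc)
qed

lemma \<Gamma>st_ex:
  assumes "homog (n + 2 * int j + c) g"
  shows "to_fract (b * g) / to_fract (s_var * t_var) ^ j \<in> \<Gamma>st n"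
proof -
  obtain N m where m: "m \<in> component M (n + 2 * int j + int N)" "\<iota> m = to_fract (b * (s_var ^ N * g))"
    using comp_ex[OF assms] by blast
  \<comment> \<open>The numerator is attained up to a power of s; multiplying by the same power of t
    keeps the denominator a power of s t.\<close>
  have "t_var ^ N \<odot>\<^bsub>M\<^esub> m \<in> component M (n + 2 * int j + int N + 1 * int N)"
    by (rule comp_smult[OF m(1) homog_power[OF homog_Var]])
  then have 1: "t_var ^ N \<odot>\<^bsub>M\<^esub> m \<in> component M (n + int (2 * (j + N)))" by (simp add: algebra_simps)
  have nz: "to_fract s_var \<noteq> (0 :: (2, 'k) mpol fract)" "to_fract t_var \<noteq> (0 :: (2, 'k) mpol fract)"
    using s_t_nonzero by auto
  have "to_fract (b * g) / to_fract (s_var * t_var) ^ j = fv (s_var * t_var) (t_var ^ N \<odot>\<^bsub>M\<^esub> m) (j + N)"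
  proof -
    have "t_var ^ N * (b * (s_var ^ N * g)) = (s_var * t_var) ^ N * (b * g)"
      by (simp only: power_mult_distrib mult_ac)
    then have "\<iota> (t_var ^ N \<odot>\<^bsub>M\<^esub> m) = to_fract (s_var * t_var) ^ N * to_fract (b * g)"
      unfolding \<iota>_smult[OF comp_sub[OF m(1)]] m(2) to_fract_mult[symmetric] to_fract_power[symmetric] by (rule arg_cong)
    moreover have "to_fract (s_var * t_var) \<noteq> (0 :: (2, 'k) mpol fract)" using nz by simp
    ultimately show ?thesis unfolding fv_def power_add by (simp del: to_fract_mult)
  qed
  then show ?thesis by (rule \<Gamma>I[OF 1])
qed

text \<open>Equating a fraction over \<open>s ^ j\<close> with one over \<open>t ^ j'\<close> shows
  that \<open>s ^ j\<close> divides the product of \<open>t ^ j'\<close> with the first numerator.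
  As s is prime and does not divide t, the denominator cancels.\<close>

lemma global_sections: "\<Gamma>s n \<inter> \<Gamma>t n = {to_fract (b * g) | g. homog (n + c) g}"
proof (rule equalityI; rule subsetI)
  fix x assume x: "x \<in> \<Gamma>s n \<inter> \<Gamma>t n"
  obtain g j where g: "homog (n + int j + c) g" "x = to_fract (b * g) / to_fract s_var ^ j"
    using \<Gamma>_form[of x s_var 1 n] x by auto
  obtain g' j' where g': "homog (n + int j' + c) g'" "x = to_fract (b * g') / to_fract t_var ^ j'"
    using \<Gamma>_form[of x t_var 1 n] x by auto
  have nz: "to_fract s_var \<noteq> (0 :: (2, 'k) mpol fract)" "to_fract t_var \<noteq> (0 :: (2, 'k) mpol fract)" "to_fract b \<noteq> 0"
    using s_t_nonzero b_nonzero by auto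
  have "to_fract (b * g) / to_fract s_var ^ j = to_fract (b * g') / to_fract t_var ^ j'" using g(2) g'(2) by simp
  then have "to_fract g * to_fract t_var ^ j' = to_fract g' * to_fract s_var ^ j"
    using nz by (simp add: frac_eq_eq)
  then have "to_fract (t_var ^ j' * g) = to_fract (s_var ^ j * g')" by (simp add: mult.commute)
  then have eq: "t_var ^ j' * g = s_var ^ j * g'" by (simp only: to_fract_eq_iff)
  have "\<not> s_var dvd (t_var ^ j' :: (2, 'k) mpol)"
  proof
    assume "s_var dvd (t_var ^ j' :: (2, 'k) mpol)"
    then have "s_var dvd (t_var :: (2, 'k) mpol)" using prime_elem_dvd_power[OF prime_elem_Var_2] by blast
    then obtain q where "t_var = (s_var * q :: (2, 'k) mpol)" by (rule dvdE)
    then have "Poly_Mapping.lookup (t_var :: (2, 'k) mpol) (bi 0 1) = 0"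
      using lookup_Var_power_mult[of 0 1 q "bi 0 1"] by simp
    then show False using lookup_bi_monomial[of 0 1 0 1, where 'k = 'k] by simp
  qed
  then have "s_var ^ j dvd g"
    using prime_elem_power_dvd_cancel[OF prime_elem_Var_2, of 0 "t_var ^ j'" j g] eq by simp
  then obtain q where q: "g = s_var ^ j * q" by (rule dvdE)
  have "homog (n + c) q"
  proof (rule homog_mult_cancel)
    show "homog (int j) (s_var ^ j :: (2, 'k) mpol)" using homog_power[OF homog_Var, of j 0] by simp
    show "homog (n + c + int j) (s_var ^ j * q)" using g(1) by (simp add: q algebra_simps)
  qed (use s_t_nonzero in simp)
  moreover have "x = to_fract (b * q)" using nz by (simp add: g(2) q)
  ultimately show "x \<in> {to_fract (b * g) | g. homog (n + c) g}" by blast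
next
  fix x assume "x \<in> {to_fract (b * g) | g. homog (n + c) g}"
  then obtain g where "homog (n + c) g" "x = to_fract (b * g)" by blast
  then show "x \<in> \<Gamma>s n \<inter> \<Gamma>t n" using \<Gamma>_ex[of n 0 g s_var] \<Gamma>_ex[of n 0 g t_var] by simp
qed

lemma H0_nonzero_iff_degree: "carrier (H0 M n) \<noteq> {\<zero>\<^bsub>H0 M n\<^esub>} \<longleftrightarrow> 0 \<le> n + c"
proof -
  have "(\<exists>x\<in>\<Gamma>s n \<inter> \<Gamma>t n. x \<noteq> 0) \<longleftrightarrow> (\<exists>g :: (2, 'k) mpol. homog (n + c) g \<and> g \<noteq> 0)"
    unfolding global_sections using b_nonzero by auto
  also have "\<dots> \<longleftrightarrow> 0 \<le> n + c"
  proof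
    assume "\<exists>g :: (2, 'k) mpol. homog (n + c) g \<and> g \<noteq> 0"
    then show "0 \<le> n + c" using homog_neg by (metis not_le)
  next
    assume "0 \<le> n + c"
    then have "homog (n + c) (s_var ^ nat (n + c) :: (2, 'k) mpol)" using homog_power[OF homog_Var, of "nat (n + c)" 0] by simp
    then show "\<exists>g :: (2, 'k) mpol. homog (n + c) g \<and> g \<noteq> 0" using s_t_nonzero by fastforce
  qed
  finally show ?thesis by (simp add: H0_nonzero_iff)
qed

lemma ks_eq: "ks a x = to_fract (Const a) * x"
  by (simp add: ks_def)

lemma to_fract_sum: "to_fract (\<Sum>i\<in>I. f i) = (\<Sum>i\<in>I. to_fract (f i))" for f :: "'i \<Rightarrow> (2, 'k) mpol"
  by (induct I rule: infinite_finite_induct) simp_all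

text \<open>The basis is \<open>b\<close> times the monomials of degree n + c. For n + c < 0 the
  size is truncated to 0, in agreement with the absence of nonzero forms.\<close>

lemma H0_basis: "\<exists>v. ordered_basis (H0 M n) (nat (n + c + 1)) v"
proof -
  interpret V: kmod_image ks "\<Gamma>s n \<inter> \<Gamma>t n" h0 "H0 M n" by (rule H0_image)
  define r where "r = nat (n + c + 1)"
  define w :: "nat \<Rightarrow> (2, 'k) mpol" where "w i = s_var ^ i * t_var ^ (r - 1 - i)" for i
  have sum: "(\<Sum>i<r. ks (a i) (to_fract (b * w i))) = to_fract (b * (\<Sum>i<r. Const (a i) * w i))" for a
  proof -
    have "(\<Sum>i<r. ks (a i) (to_fract (b * w i))) = (\<Sum>i<r. to_fract (b * (Const (a i) * w i)))"
      by (rule sum.cong[OF refl]) (simp only: ks_eq to_fract_mult[symmetric] mult.left_commute)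
    then show ?thesis by (simp only: to_fract_sum[symmetric] sum_distrib_left[symmetric])
  qed
  have "ordered_basis (H0 M n) r (\<lambda>i. h0 (to_fract (b * w i)))"
  proof (rule V.ordered_basisI)
    fix i assume i: "i < r"
    have "homog (1 * int i + 1 * int (r - 1 - i)) (w i)"
      unfolding w_def by (intro homog_mult homog_power homog_Var)
    then have "homog (n + c) (w i)" using i by (simp add: r_def of_nat_diff)
    then show "to_fract (b * w i) \<in> \<Gamma>s n \<inter> \<Gamma>t n" unfolding global_sections by blast
  next
    fix x assume "x \<in> \<Gamma>s n \<inter> \<Gamma>t n"
    then obtain g where g: "homog (n + c) g" "x = to_fract (b * g)" unfolding global_sections by blast
    show "\<exists>a. h0 x = h0 (\<Sum>i<r. ks (a i) (to_fract (b * w i)))"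
    proof (cases "0 \<le> n + c")
      case True
      then have r: "{..r - 1} = {..<r}" "int (r - 1) = n + c" by (auto simp: r_def)
      have "homog (int (r - 1)) g" unfolding r(2) by (rule g(1))
      from binary_form_expand[OF this]
      have "g = (\<Sum>i<r. Const (Poly_Mapping.lookup g (bi i (r - 1 - i))) * w i)"
        unfolding r(1) w_def .
      then have "h0 x = h0 (\<Sum>i<r. ks (Poly_Mapping.lookup g (bi i (r - 1 - i))) (to_fract (b * w i)))"
        unfolding sum g(2) by simp
      then show ?thesis by (rule exI[of _ "\<lambda>i. Poly_Mapping.lookup g (bi i (r - 1 - i))"])
    next
      case False
      then have "g = 0" using homog_neg[OF g(1)] by simp
      then have "h0 x = h0 (\<Sum>i<r. ks 0 (to_fract (b * w i)))" unfolding sum g(2) by simp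
      then show ?thesis by (rule exI[of _ "\<lambda>_. 0"])
    qed
  next
    fix a i assume a: "h0 (\<Sum>i<r. ks (a i) (to_fract (b * w i))) = \<zero>\<^bsub>H0 M n\<^esub>" and i: "i < r"
    let ?g = "\<Sum>i<r. Const (a i) * w i"
    have "h0 0 = h0 (to_fract (b * ?g))" using a by (simp only: sum V.\<pi>_0)
    then have "to_fract (b * ?g) = 0" using h0_eq_iff[OF \<Gamma>_0, of "to_fract (b * ?g)"] by simp
    then have "b * ?g = 0" by (simp only: to_fract_eq_0_iff)
    then have "?g = 0" using b_nonzero by (simp only: mult_eq_0_iff) simp
    then have "0 = Poly_Mapping.lookup ?g (bi i (r - 1 - i))" by simp
    also have "\<dots> = (\<Sum>l<r. if l = i then a i else 0)"
      unfolding lookup_sum by (rule sum.cong) (auto simp: w_def lookup_bi_monomial)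
    also have "\<dots> = a i" using i by simp
    finally show "a i = 0" by simp
  qed
  then show ?thesis unfolding r_def by blast
qed

text \<open>The classes are \<open>b\<close> times the Laurent monomials of degree n + c with both
  exponents negative, the ones that are regular on neither chart. There are -(n + c) - 1 of them, or
  none if this number is negative.\<close>

lemma H1_basis: "\<exists>v. ordered_basis (H1 M n) (nat (- (n + c) - 1)) v"
proof -
  interpret W: kmod_image ks "\<Gamma>st n" "h1 n" "H1 M n" by (rule H1_image)
  define r where "r = nat (- (n + c) - 1)"
  let ?s = "to_fract s_var :: (2, 'k) mpol fract" and ?t = "to_fract t_var :: (2, 'k) mpol fract"
  have nz: "?s \<noteq> 0" "?t \<noteq> 0" using s_t_nonzero by auto
  define w where "w i = to_fract b / (?s ^ Suc i * ?t ^ (r - i))" for i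
  text \<open>Clearing denominators with \<open>(s t)^j\<close> turns \<open>w i\<close> into a monomial in which both exponents
    are smaller than \<open>j\<close>, whereas coboundaries become elements of the ideal \<open>(s^j, t^j)\<close>.\<close>
  have w_st: "w i = to_fract (b * (s_var ^ (j - Suc i) * t_var ^ (j - (r - i)))) / to_fract (s_var * t_var) ^ j"
    if "i < r" "r \<le> j" for i j
  proof -
    have "?s ^ j = ?s ^ (j - Suc i) * ?s ^ Suc i" "?t ^ j = ?t ^ (j - (r - i)) * ?t ^ (r - i)"
      using that by (simp_all only: power_add[symmetric]) auto
    then show ?thesis using nz by (simp add: w_def power_mult_distrib)
  qed
  have w_deg: "homog (n + 2 * int j + c) (s_var ^ (j - Suc i) * t_var ^ (j - (r - i)) :: (2, 'k) mpol)"
    if "i < r" "r \<le> j" for i j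
  proof -
    have "homog (1 * int (j - Suc i) + 1 * int (j - (r - i))) (s_var ^ (j - Suc i) * t_var ^ (j - (r - i)) :: (2, 'k) mpol)"
      by (intro homog_mult homog_power homog_Var)
    moreover have "1 * int (j - Suc i) + 1 * int (j - (r - i)) = n + 2 * int j + c" using that by (simp add: r_def of_nat_diff)
    ultimately show ?thesis by simp
  qed
  have w_in: "w i \<in> \<Gamma>st n" if "i < r" for i
    using \<Gamma>st_ex[OF w_deg[OF that order_refl]] w_st[OF that order_refl] by simp
  have sum: "(\<Sum>i<r. ks (a i) (w i)) = to_fract (b * (\<Sum>i<r. Const (a i) * (s_var ^ (j - Suc i) * t_var ^ (j - (r - i))))) / to_fract (s_var * t_var) ^ j"
    if "r \<le> j" for a j
  proof -
    have "(\<Sum>i<r. ks (a i) (w i)) = (\<Sum>i<r. to_fract (b * (Const (a i) * (s_var ^ (j - Suc i) * t_var ^ (j - (r - i))))) / to_fract (s_var * t_var) ^ j)"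
    proof (rule sum.cong[OF refl])
      fix i assume "i \<in> {..<r}"
      then have "i < r" by simp
      show "ks (a i) (w i) = to_fract (b * (Const (a i) * (s_var ^ (j - Suc i) * t_var ^ (j - (r - i))))) / to_fract (s_var * t_var) ^ j"
        unfolding w_st[OF \<open>i < r\<close> that] ks_eq times_divide_eq_right to_fract_mult[symmetric]
        by (simp only: mult.left_commute)
    qed
    then show ?thesis by (simp only: sum_divide_distrib[symmetric] to_fract_sum[symmetric] sum_distrib_left[symmetric])
  qed
  have "ordered_basis (H1 M n) r (\<lambda>i. h1 n (w i))"
  proof (rule W.ordered_basisI[OF w_in])
    fix x assume x: "x \<in> \<Gamma>st n"
    \<comment> \<open>Expanding the fraction by a power of s t makes \<open>j\<close> at least
      \<open>r\<close>, so that all \<open>w i\<close> have numerators over the same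
      denominator.\<close>
    obtain g j where g: "homog (n + 2 * int j + c) g" "x = to_fract (b * g) / to_fract (s_var * t_var) ^ j" "r \<le> j"
    proof -
      obtain g j where g: "homog (n + 2 * int j + c) g" "x = to_fract (b * g) / to_fract (s_var * t_var) ^ j"
        using \<Gamma>_form[OF x] by auto
      have "homog (n + 2 * int j + c + 2 * int r) (g * (s_var * t_var) ^ r)"
        using homog_mult[OF g(1) homog_power[OF s_t_homog(3)], of r] by simp
      then have 1: "homog (n + 2 * int (j + r) + c) (g * (s_var * t_var) ^ r)" by (simp add: algebra_simps)
      have 2: "x = to_fract (b * (g * (s_var * t_var) ^ r)) / to_fract (s_var * t_var) ^ (j + r)"
        using nz by (simp add: g(2) power_add power_mult_distrib)
      show thesis by (rule that[OF 1 2]) simp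
    qed
    define N where "N = nat (n + 2 * int j + c)"
    have N: "n + 2 * int j + c = int N" if "g \<noteq> 0" using homog_neg[OF g(1)] that by (cases "n + 2 * int j + c < 0") (simp_all add: N_def)
    define a where "a i = Poly_Mapping.lookup g (bi (j - Suc i) (j - (r - i)))" for i
    let ?m = "\<lambda>e. Const (Poly_Mapping.lookup g (bi e (N - e))) * (s_var ^ e * t_var ^ (N - e))"
    have "x - (\<Sum>i<r. ks (a i) (w i)) \<in> coboundaries n"
    proof (cases "g = 0")
      case True
      then show ?thesis using coboundaries_0 sum[OF g(3), of a] by (simp add: g(2) a_def)
    next
      case False
      note N = N[OF False]
      \<comment> \<open>If one exponent of a monomial reaches \<open>j\<close>, that variable
        disappears from the denominator, and the fraction is regular on the chart of the other
        variable.\<close>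
      have mon: "to_fract (b * ?m e) / to_fract (s_var * t_var) ^ j \<in> coboundaries n"
        if e: "e \<le> N" "j \<le> e \<or> j \<le> N - e" for e
        using e(2)
      proof
        let ?q = "Const (Poly_Mapping.lookup g (bi e (N - e))) * (s_var ^ (e - j) * t_var ^ (N - e))"
        assume je: "j \<le> e"
        have d: "1 * int (e - j) + 1 * int (N - e) = n + int j + c" using je e N by (simp add: of_nat_diff)
        have "homog (n + int j + c) ?q"
          unfolding d[symmetric] by (intro homog_Const_mult homog_mult homog_power homog_Var)
        then have t: "to_fract (b * ?q) / ?t ^ j \<in> \<Gamma>t n" by (rule \<Gamma>_ex) simp
        have "?s ^ e = ?s ^ (e - j) * ?s ^ j" using je by (subst power_add[symmetric]) simp
        then have "to_fract (b * ?m e) / to_fract (s_var * t_var) ^ j = to_fract (b * ?q) / ?t ^ j - 0"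
          using nz by (simp add: power_mult_distrib)
        then show ?thesis by (rule coboundariesI[OF \<Gamma>_0 t])
      next
        let ?q = "- Const (Poly_Mapping.lookup g (bi e (N - e))) * (s_var ^ e * t_var ^ (N - e - j))"
        assume je: "j \<le> N - e"
        have d: "1 * int e + 1 * int (N - e - j) = n + int j + c" using je e N by (simp add: of_nat_diff)
        have "homog (n + int j + c) ?q"
          unfolding d[symmetric] Const_uminus[symmetric] by (intro homog_Const_mult homog_mult homog_power homog_Var)
        then have t: "to_fract (b * ?q) / ?s ^ j \<in> \<Gamma>s n" by (rule \<Gamma>_ex) simp
        have "N - e = (N - e - j) + j" using je by arith
        then have "?t ^ (N - e) = ?t ^ ((N - e - j) + j)" by (rule arg_cong)
        then have "?t ^ (N - e) = ?t ^ (N - e - j) * ?t ^ j" unfolding power_add .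
        then have "to_fract (b * ?m e) / to_fract (s_var * t_var) ^ j = 0 - to_fract (b * ?q) / ?s ^ j"
          using nz by (simp add: power_mult_distrib)
        then show ?thesis by (rule coboundariesI[OF t \<Gamma>_0])
      qed
      have cob_sum: "(\<Sum>i\<in>I. f i) \<in> coboundaries n" if "\<And>i. i \<in> I \<Longrightarrow> f i \<in> coboundaries n" for f and I :: "nat set"
        using that by (induct I rule: infinite_finite_induct) (simp_all add: coboundaries_0 coboundaries_add)
      let ?J = "{e. e < j \<and> N - e < j \<and> e \<le> N}"
      have "{..N} = ?J \<union> {e. e \<le> N \<and> (j \<le> e \<or> j \<le> N - e)}" by auto
      moreover have "finite ?J" "finite {e. e \<le> N \<and> (j \<le> e \<or> j \<le> N - e)}" "?J \<inter> {e. e \<le> N \<and> (j \<le> e \<or> j \<le> N - e)} = {}" by auto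
      ultimately have "(\<Sum>e\<le>N. ?m e) = (\<Sum>e\<in>?J. ?m e) + (\<Sum>e | e \<le> N \<and> (j \<le> e \<or> j \<le> N - e). ?m e)"
        by (simp add: sum.union_disjoint)
      moreover have "(\<Sum>e\<in>?J. ?m e) = (\<Sum>i<r. Const (a i) * (s_var ^ (j - Suc i) * t_var ^ (j - (r - i))))"
      proof (rule sum.reindex_bij_witness[where i = "\<lambda>i. j - Suc i" and j = "\<lambda>e. j - Suc e"])
        \<comment> \<open>The remaining monomials have both exponents below \<open>j\<close> and
          total degree \<open>N\<close>. For r > 0, n + c = - (r + 1), which leaves exactly the
          numerators of the \<open>w i\<close>; for r = 0 the degree is at least 2 j - 1 and none
          remain.\<close>
        have rN: "int N = 2 * int j - 1 - int r" if "r > 0" using N that by (simp add: r_def)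
        have rN': "int N \<ge> 2 * int j - 1" if "r = 0" using N that by (simp add: r_def)
        fix e assume e: "e \<in> ?J"
        show "j - Suc (j - Suc e) = e" using e by auto
        have "r > 0" using e rN' by force
        note rN = rN[OF this]
        show "j - Suc e \<in> {..<r}" using e rN by auto
        have "j - (r - (j - Suc e)) = N - e" using e rN by auto
        moreover have "j - Suc (j - Suc e) = e" using e by auto
        ultimately show "Const (a (j - Suc e)) * (s_var ^ (j - Suc (j - Suc e)) * t_var ^ (j - (r - (j - Suc e)))) = ?m e"
          by (simp add: a_def)
      next
        fix i assume i: "i \<in> {..<r}"
        then have rN: "int N = 2 * int j - 1 - int r" using N by (simp add: r_def)
        show "j - Suc (j - Suc i) = i" using i g(3) by auto
        show "j - Suc i \<in> ?J" using i g(3) rN by auto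
      qed
      ultimately have "g = (\<Sum>i<r. Const (a i) * (s_var ^ (j - Suc i) * t_var ^ (j - (r - i))))
          + (\<Sum>e | e \<le> N \<and> (j \<le> e \<or> j \<le> N - e). ?m e)"
        using binary_form_expand[of N g] g(1) N by simp
      then have "to_fract (b * g) = to_fract (b * (\<Sum>i<r. Const (a i) * (s_var ^ (j - Suc i) * t_var ^ (j - (r - i))))
          + (\<Sum>e | e \<le> N \<and> (j \<le> e \<or> j \<le> N - e). b * ?m e))"
        unfolding sum_distrib_left[symmetric] distrib_left[symmetric] by simp
      then have "x - (\<Sum>i<r. ks (a i) (w i)) = (\<Sum>e | e \<le> N \<and> (j \<le> e \<or> j \<le> N - e). to_fract (b * ?m e) / to_fract (s_var * t_var) ^ j)"
        unfolding g(2) sum[OF g(3)] sum_divide_distrib[symmetric] to_fract_sum[symmetric] diff_divide_distrib[symmetric] to_fract_diff[symmetric]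
        by simp
      also have "\<dots> \<in> coboundaries n" by (rule cob_sum) (use mon in auto)
      finally show ?thesis .
    qed
    moreover have "(\<Sum>i<r. ks (a i) (w i)) \<in> \<Gamma>st n" by (rule W.X_sum) (use W.X_ks w_in in auto)
    ultimately have "h1 n x = h1 n (\<Sum>i<r. ks (a i) (w i))" using h1_eq_iff[OF x] by simp
    then show "\<exists>a. h1 n x = h1 n (\<Sum>i<r. ks (a i) (w i))" by (rule exI[of _ a])
  next
    fix a i assume a: "h1 n (\<Sum>i<r. ks (a i) (w i)) = \<zero>\<^bsub>H1 M n\<^esub>" and i: "i < r"
    have "(\<Sum>i<r. ks (a i) (w i)) \<in> \<Gamma>st n" by (rule W.X_sum) (use W.X_ks w_in in auto)
    then have "(\<Sum>i<r. ks (a i) (w i)) \<in> coboundaries n" using a by (simp add: h1_eq_0_iff)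
    then obtain x y where xy: "x \<in> \<Gamma>s n" "y \<in> \<Gamma>t n" "(\<Sum>i<r. ks (a i) (w i)) = y - x" by (rule coboundariesE)
    obtain g k where g: "x = to_fract (b * g) / ?s ^ k" using \<Gamma>_form[OF xy(1)] by blast
    obtain g' k' where g': "y = to_fract (b * g') / ?t ^ k'" using \<Gamma>_form[OF xy(2)] by blast
    \<comment> \<open>Large enough for both denominators to divide \<open>(s t) ^ j\<close> and for
      every \<open>w i\<close> to have a numerator over it.\<close>
    define j where "j = r + k + k'"
    let ?h = "\<Sum>i<r. Const (a i) * (s_var ^ (j - Suc i) * t_var ^ (j - (r - i)))"
    have eq: "to_fract b * to_fract ?h / (?s ^ j * ?t ^ j) = to_fract b * to_fract g' / ?t ^ k' - to_fract b * to_fract g / ?s ^ k"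
    proof -
      have "r \<le> j" by (simp add: j_def)
      from sum[OF this, of a] show ?thesis
        unfolding xy(3) g g' to_fract_mult power_mult_distrib by (rule sym)
    qed
    have "?t ^ j = ?t ^ (r + k) * ?t ^ k'" "?s ^ j = ?s ^ (r + k') * ?s ^ k"
      unfolding power_add[symmetric] j_def by (simp_all add: ac_simps)
    with eq have "to_fract ?h = ?s ^ j * (?t ^ (r + k) * to_fract g') - ?t ^ j * (?s ^ (r + k') * to_fract g)"
      using clear_denominators[of "to_fract b" "?s ^ k" "?t ^ k'" "?s ^ (r + k')" "?t ^ (r + k)" "to_fract ?h" "to_fract g'" "to_fract g"]
        b_nonzero nz by (simp only: to_fract_eq_0_iff power_not_zero not_False_eq_True)
    then have "to_fract ?h = to_fract (s_var ^ j * (t_var ^ (r + k) * g') - t_var ^ j * (s_var ^ (r + k') * g))"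
      by (simp only: to_fract_mult to_fract_power to_fract_diff)
    then have h: "?h = s_var ^ j * (t_var ^ (r + k) * g') - t_var ^ j * (s_var ^ (r + k') * g)"
      by (simp only: to_fract_eq_iff)
    have "Poly_Mapping.lookup ?h (bi (j - Suc i) (j - (r - i))) = (\<Sum>l<r. if l = i then a i else 0)"
      unfolding lookup_sum by (rule sum.cong) (use i in \<open>auto simp: lookup_bi_monomial j_def\<close>)
    also have "\<dots> = a i" using i by simp
    finally have "a i = Poly_Mapping.lookup ?h (bi (j - Suc i) (j - (r - i)))" by simp
    also have "\<dots> = 0" unfolding h lookup_minus using i by (simp add: lookup_Var_power_mult j_def)
    finally show "a i = 0" .
  qed
  then show ?thesis unfolding r_def by blast
qed

end

section \<open>From the points of the line to its two charts\<close>

section \<open>Binary forms without common zeros\<close>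

text \<open>Closure is required for homogeneous elements only, and for sums in equal degree:
  membership will mean that a homogeneous derivation of a matching degree exists.\<close>

locale homog_ideal =
  fixes I :: "(2, 'k::field) mpol \<Rightarrow> bool"
  assumes I_add: "I x \<Longrightarrow> I y \<Longrightarrow> homog k x \<Longrightarrow> homog k y \<Longrightarrow> I (x + y)"
    and I_mult: "I x \<Longrightarrow> homog k h \<Longrightarrow> I (h * x)"
begin

text \<open>Membership in the saturation with respect to \<open>f\<close>. The aim is
  \<open>sat f 1\<close> for f = s and f = t: a power of \<open>f\<close> lies in the ideal.\<close>

definition sat :: "(2, 'k) mpol \<Rightarrow> (2, 'k) mpol \<Rightarrow> bool" where
  "sat f x \<longleftrightarrow> (\<exists>N. I (f ^ N * x))"

lemma sat_mult: "sat f x \<Longrightarrow> homog k h \<Longrightarrow> sat f (h * x)"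
proof -
  assume "sat f x" "homog k h"
  then obtain N where "I (h * (f ^ N * x))" using I_mult by (auto simp: sat_def)
  then show ?thesis unfolding sat_def by (auto simp: mult.left_commute)
qed

lemma I_power:
  assumes "I (f ^ N * x)" "homog 1 f" "N \<le> K"
  shows "I (f ^ K * x)"
proof -
  have "I (f ^ (K - N) * (f ^ N * x))" by (rule I_mult[OF assms(1) homog_power[OF assms(2)]])
  moreover have "f ^ (K - N) * f ^ N = f ^ K" using assms(3) by (simp flip: power_add)
  ultimately show ?thesis by (simp add: mult.assoc[symmetric])
qed

text \<open>One more factor \<open>f\<close> is spent and written as a combination of
  \<open>l1\<close> and \<open>l2\<close>, each of which moves \<open>x\<close> into the
  ideal.\<close>

lemma sat_span:
  assumes f: "homog 1 f" "f = Const c1 * l1 + Const c2 * l2" and l: "homog 1 l1" "homog 1 l2"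
    and x: "homog k x" "sat f (l1 * x)" "sat f (l2 * x)"
  shows "sat f x"
proof -
  obtain N1 N2 where "I (f ^ N1 * (l1 * x))" "I (f ^ N2 * (l2 * x))" using x by (auto simp: sat_def)
  then have N: "I (f ^ (N1 + N2) * (l1 * x))" "I (f ^ (N1 + N2) * (l2 * x))"
    using I_power[OF _ f(1)] by simp_all
  have h: "homog (1 * int (N1 + N2) + (1 + k)) (f ^ (N1 + N2) * (l1 * x))"
    "homog (1 * int (N1 + N2) + (1 + k)) (f ^ (N1 + N2) * (l2 * x))"
    by (intro homog_mult homog_power f l x)+
  have "I (Const c1 * (f ^ (N1 + N2) * (l1 * x)) + Const c2 * (f ^ (N1 + N2) * (l2 * x)))"
    by (rule I_add[OF I_mult[OF N(1) homog_Const] I_mult[OF N(2) homog_Const] homog_Const_mult[OF h(1)] homog_Const_mult[OF h(2)]])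
  also have "Const c1 * (f ^ (N1 + N2) * (l1 * x)) + Const c2 * (f ^ (N1 + N2) * (l2 * x))
      = f ^ (N1 + N2) * ((Const c1 * l1 + Const c2 * l2) * x)"
    by (simp only: distrib_left distrib_right mult_ac)
  also have "\<dots> = f ^ Suc (N1 + N2) * x" by (simp only: f(2)[symmetric] power_Suc2 mult.assoc)
  finally show ?thesis unfolding sat_def by blast
qed

text \<open>The factors \<open>l1\<close> and \<open>l2\<close> are removed one at a time by
  \<open>sat_span\<close>; the inner induction is on the exponent of \<open>l2\<close>, the outer
  one on that of \<open>l1\<close>.\<close>

lemma sat_span_powers:
  assumes f: "homog 1 f" "f = Const c1 * l1 + Const c2 * l2" and l: "homog 1 l1" "homog 1 l2"
    and x: "homog k x" "sat f (l1 ^ a * x)" "sat f (l2 ^ b * x)"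
  shows "sat f x"
proof -
  have step: "sat f x" if "homog k x" "sat f (l1 * x)" "sat f (l2 ^ b * x)" for k x b
    using that
  proof (induct b arbitrary: x k)
    case (Suc b)
    have h: "homog (1 * int b + k) (l2 ^ b * x)" by (intro homog_mult homog_power l Suc.prems)
    have "sat f (l1 * (l2 ^ b * x))"
      using sat_mult[OF Suc.prems(2) homog_power[OF l(2)], of b] by (simp only: mult.left_commute)
    moreover have "sat f (l2 * (l2 ^ b * x))" using Suc.prems(3) by (simp only: power_Suc mult.assoc)
    ultimately have "sat f (l2 ^ b * x)" by (rule sat_span[OF f l h])
    then show ?case by (rule Suc.hyps[OF Suc.prems(1,2)])
  qed simp
  show ?thesis using x
  proof (induct a arbitrary: x k)
    case (Suc a)
    have h: "homog (1 * int a + k) (l1 ^ a * x)" by (intro homog_mult homog_power l Suc.prems)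
    have "sat f (l2 ^ b * (l1 ^ a * x))"
      using sat_mult[OF Suc.prems(3) homog_power[OF l(1)], of a] by (simp only: mult.left_commute)
    moreover have "sat f (l1 * (l1 ^ a * x))" using Suc.prems(2) by (simp only: power_Suc mult.assoc)
    ultimately have "sat f (l1 ^ a * x)" by (intro step[OF h])
    then show ?case by (rule Suc.hyps[OF Suc.prems(1) _ Suc.prems(3)])
  qed simp
qed

text \<open>The form at \<open>P0\<close> has no common zero with any other form; the points of
  \<open>F\<close> are split off one by one, always against the power at \<open>P0\<close>.\<close>

lemma sat_prod:
  assumes f: "homog 1 f" and F: "finite F" and P0: "P0 \<notin> F"
    and l: "\<And>P. P \<in> insert P0 F \<Longrightarrow> homog 1 (l P)"
    and span: "\<And>P. P \<in> F \<Longrightarrow> \<exists>c1 c2. f = Const c1 * l P0 + Const c2 * l P"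
    and x: "homog k x" "sat f (l P0 ^ e P0 * x)" "sat f ((\<Prod>P\<in>F. l P ^ e P) * x)"
  shows "sat f x"
  using F P0 l span x
proof (induct F arbitrary: x k rule: finite_induct)
  case empty
  then show ?case by simp
next
  case (insert P F)
  have lP: "homog 1 (l P)" "homog 1 (l P0)" using insert.prems(2) by simp_all
  have h: "homog (1 * int (e P) + k) (l P ^ e P * x)" by (intro homog_mult homog_power lP insert.prems(4))
  have 1: "sat f (l P0 ^ e P0 * (l P ^ e P * x))"
    using sat_mult[OF insert.prems(5) homog_power[OF lP(1)], of "e P"] by (simp only: mult.left_commute)
  have 2: "sat f ((\<Prod>P\<in>F. l P ^ e P) * (l P ^ e P * x))"
    using insert.prems(6) insert.hyps by (simp add: mult_ac)
  have "sat f (l P ^ e P * x)"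
    by (rule insert.hyps(3)[OF _ _ _ h 1 2]) (use insert.prems in auto)
  moreover obtain c1 c2 where "f = Const c1 * l P0 + Const c2 * l P" using insert.prems(3)[of P] by auto
  ultimately show ?case by (intro sat_span_powers[OF f _ lP(2,1) insert.prems(4,5)])
qed

text \<open>The products that omit one point have no common zero. When \<open>P0\<close> is added,
  the induction hypothesis applied to \<open>l P0 ^ e P0 * x\<close> gives membership of that
  product, the product over \<open>F\<close> is the hypothesis at \<open>P0\<close>, and
  \<open>sat_prod\<close> combines the two.\<close>

lemma sat_complementary_products:
  assumes f: "homog 1 f" and F: "finite F" "F \<noteq> {}"
    and l: "\<And>P. P \<in> F \<Longrightarrow> homog 1 (l P)"
    and span: "\<And>P P'. P \<in> F \<Longrightarrow> P' \<in> F \<Longrightarrow> P \<noteq> P' \<Longrightarrow> \<exists>c1 c2. f = Const c1 * l P + Const c2 * l P'"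
    and x: "homog k x" "\<And>P. P \<in> F \<Longrightarrow> sat f ((\<Prod>P'\<in>F - {P}. l P' ^ e P') * x)"
  shows "sat f x"
  using F l span x
proof (induct F arbitrary: x k rule: finite_ne_induct)
  case (singleton P)
  then show ?case using singleton.prems(4)[of P] by simp
next
  case (insert P0 F)
  have l0: "homog 1 (l P0)" using insert.prems(1) by simp
  have h: "homog (1 * int (e P0) + k) (l P0 ^ e P0 * x)" by (intro homog_mult homog_power l0 insert.prems(3))
  have "sat f (l P0 ^ e P0 * x)"
  proof (rule insert.hyps(4)[OF _ _ h])
    fix P assume P: "P \<in> F"
    then have "P \<noteq> P0" using insert.hyps by auto
    then have "insert P0 F - {P} = insert P0 (F - {P})" by auto
    moreover have "P0 \<notin> F - {P}" "finite (F - {P})" using insert.hyps by auto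
    ultimately have "(\<Prod>P'\<in>insert P0 F - {P}. l P' ^ e P') * x = (\<Prod>P'\<in>F - {P}. l P' ^ e P') * (l P0 ^ e P0 * x)"
      by (simp add: mult_ac)
    moreover have "sat f ((\<Prod>P'\<in>insert P0 F - {P}. l P' ^ e P') * x)"
      by (rule insert.prems(4)) (use P in simp)
    ultimately show "sat f ((\<Prod>P'\<in>F - {P}. l P' ^ e P') * (l P0 ^ e P0 * x))"
      by (simp only:)
  qed (use insert.prems in auto)
  moreover have "sat f ((\<Prod>P'\<in>F. l P' ^ e P') * x)"
    using insert.prems(4)[of P0] insert.hyps by simp
  ultimately show ?case
    by (intro sat_prod[OF f insert.hyps(1) insert.hyps(3) _ _ insert.prems(3), of l e]) (use insert.prems insert.hyps in auto)
qed

end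

section \<open>Lines in the plane and restriction to a line\<close>

section \<open>Lines in the plane\<close>

definition dot :: "(3 \<Rightarrow> 'k::comm_ring_1) \<Rightarrow> (3 \<Rightarrow> 'k) \<Rightarrow> 'k" where
  "dot a x = (\<Sum>i\<in>UNIV. a i * x i)"

lemma ker_form_dot: "ker_form a = {x. dot a x = 0}"
  by (simp add: ker_form_def dot_def)

lemma dot_add: "dot a (\<lambda>i. x i + y i) = dot a x + dot a y"
  and dot_smult: "dot a (\<lambda>i. c * x i) = c * dot a x"
  and dot_smult_left: "dot (\<lambda>i. c * a i) x = c * dot a x"
  by (simp_all add: dot_def algebra_simps sum.distrib sum_distrib_left sum_subtractf)

lemma other_two_coordinates: "\<exists>i j. UNIV = {i, j, k :: 3} \<and> i \<noteq> j \<and> i \<noteq> k \<and> j \<noteq> k"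
proof -
  have ne: "(0::3) \<noteq> 1" "(0::3) \<noteq> 2" "(1::3) \<noteq> 2" by simp_all
  consider "k = 0" | "k = 1" | "k = 2" using exhaust_3[of k] by blast
  then show ?thesis
  proof cases
    case 1
    then show ?thesis using ne UNIV_3 by (intro exI[of _ 1] exI[of _ 2]) auto
  next
    case 2
    then show ?thesis using ne UNIV_3 by (intro exI[of _ 0] exI[of _ 2]) auto
  next
    case 3
    then show ?thesis using ne UNIV_3 by (intro exI[of _ 0] exI[of _ 1]) auto
  qed
qed

text \<open>A one-sided inverse of a 2 x 2 matrix is two-sided: the determinant \<open>D\<close> is
  nonzero, and solving by the adjugate gives the products in the other order.\<close>

lemma matrix_2_left_inverse:
  fixes u1 :: "'a::field"
  assumes "u1 * p1 + v1 * q1 = 1" "u1 * p2 + v1 * q2 = 0" "u2 * p1 + v2 * q1 = 0" "u2 * p2 + v2 * q2 = 1"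
  shows "u1 * p1 + u2 * p2 = 1" "u1 * q1 + u2 * q2 = 0" "v1 * p1 + v2 * p2 = 0" "v1 * q1 + v2 * q2 = 1"
proof -
  define D where "D = p1 * q2 - p2 * q1"
  have "(u1 * v2 - v1 * u2) * D = (u1 * p1 + v1 * q1) * (u2 * p2 + v2 * q2) - (u1 * p2 + v1 * q2) * (u2 * p1 + v2 * q1)"
    by (simp add: D_def algebra_simps)
  also have "\<dots> = 1" unfolding assms by simp
  finally have D: "D \<noteq> 0" by auto
  have "u1 * D = (u1 * p1 + v1 * q1) * q2 - (u1 * p2 + v1 * q2) * q1"
    "v1 * D = (u1 * p2 + v1 * q2) * p1 - (u1 * p1 + v1 * q1) * p2"
    "u2 * D = (u2 * p1 + v2 * q1) * q2 - (u2 * p2 + v2 * q2) * q1"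
    "v2 * D = (u2 * p2 + v2 * q2) * p1 - (u2 * p1 + v2 * q1) * p2"
    by (simp_all add: D_def algebra_simps)
  then have uv: "u1 * D = q2" "v1 * D = - p2" "u2 * D = - q1" "v2 * D = p1"
    unfolding assms by simp_all
  have "(u1 * p1 + u2 * p2) * D = (u1 * D) * p1 + (u2 * D) * p2"
    "(u1 * q1 + u2 * q2) * D = (u1 * D) * q1 + (u2 * D) * q2"
    "(v1 * p1 + v2 * p2) * D = (v1 * D) * p1 + (v2 * D) * p2"
    "(v1 * q1 + v2 * q2) * D = (v1 * D) * q1 + (v2 * D) * q2"
    by (simp_all add: algebra_simps)
  then have e: "(u1 * p1 + u2 * p2) * D = 1 * D" "(u1 * q1 + u2 * q2) * D = 0 * D"
    "(v1 * p1 + v2 * p2) * D = 0 * D" "(v1 * q1 + v2 * q2) * D = 1 * D"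
    unfolding uv by (simp_all add: D_def algebra_simps)
  note c = mult_right_cancel[OF D, THEN iffD1]
  show "u1 * p1 + u2 * p2 = 1" by (rule c[OF e(1)])
  show "u1 * q1 + u2 * q2 = 0" by (rule c[OF e(2)])
  show "v1 * p1 + v2 * p2 = 0" by (rule c[OF e(3)])
  show "v1 * q1 + v2 * q2 = 1" by (rule c[OF e(4)])
qed

lemma line_parametrization:
  fixes a :: "3 \<Rightarrow> 'k::field"
  assumes "a \<noteq> (\<lambda>i. 0)"
  obtains i j k where "UNIV = {i, j, k}" "i \<noteq> j" "i \<noteq> k" "j \<noteq> k" "a k \<noteq> 0"
    "\<forall>x. x \<in> ker_form a \<longleftrightarrow> a k * x k = - a i * x i - a j * x j"
proof -
  obtain k where k: "a k \<noteq> 0" using assms by auto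
  obtain i j where ij: "UNIV = {i, j, k}" "i \<noteq> j" "i \<noteq> k" "j \<noteq> k" using other_two_coordinates by metis
  have "x \<in> ker_form a \<longleftrightarrow> a k * x k = - a i * x i - a j * x j" for x
  proof -
    have "(\<Sum>l\<in>UNIV. a l * x l) = a i * x i + (a j * x j + a k * x k)"
      unfolding ij(1) using ij(2-4) by simp
    then show ?thesis by (auto simp: ker_form_def algebra_simps eq_neg_iff_add_eq_0)
  qed
  then show thesis using that k ij by blast
qed

lemma vanishing_form_multiple:
  fixes a b :: "3 \<Rightarrow> 'k::field"
  assumes "a \<noteq> (\<lambda>i. 0)" "\<And>x. x \<in> ker_form a \<Longrightarrow> dot b x = 0"
  shows "\<exists>c. b = (\<lambda>i. c * a i)"
proof -
  obtain i j k where ijk: "UNIV = {i, j, k}" "i \<noteq> j" "i \<noteq> k" "j \<noteq> k" "a k \<noteq> 0"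
    "\<forall>x. x \<in> ker_form a \<longleftrightarrow> a k * x k = - a i * x i - a j * x j"
    by (rule line_parametrization[OF assms(1)])
  have dot: "dot b x = b i * x i + (b j * x j + b k * x k)" for x
    unfolding dot_def ijk(1) using ijk(2-4) by simp
  \<comment> \<open>The points of the line with free coordinates (\<open>a k\<close>, 0) and (0,
    \<open>a k\<close>); the factor \<open>a k\<close> avoids a division.\<close>
  define x where "x = (\<lambda>l. if l = i then a k else if l = k then - a i else 0)"
  define y where "y = (\<lambda>l. if l = j then a k else if l = k then - a j else 0)"
  have "x \<in> ker_form a" "y \<in> ker_form a" using ijk by (simp_all add: x_def y_def)
  then have "dot b x = 0" "dot b y = 0" using assms(2) by auto
  then have "b i * a k = b k * a i" "b j * a k = b k * a j"
    using ijk(2-4) by (simp_all add: dot x_def y_def algebra_simps)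
  then have "b l = b k / a k * a l" for l
    using ijk(1,5) by (cases "l = k"; cases "l = i") (auto simp: field_simps)
  then show ?thesis by blast
qed

text \<open>\<open>line_basis\<close> promises only that p and q span the line. An explicit basis
  with unit coordinates i and j is expressed through them, and the 2 x 2 matrix of coefficients
  supplies the dual forms \<open>u\<close> and \<open>v\<close>, which also prove
  independence.\<close>

lemma line_basis_exists:
  assumes "is_line (L :: (3 \<Rightarrow> 'k::field) set)"
  obtains p q u v where "line_basis L = (p, q)" "L = {\<lambda>i. x * p i + y * q i | x y. True}"
    "dot u p = 1" "dot u q = 0" "dot v p = 0" "dot v q = 1"
proof -
  obtain a where a: "a \<noteq> (\<lambda>i. 0)" "L = ker_form a" using assms by (auto simp: is_line_def)
  obtain i j k where ijk: "UNIV = {i, j, k}" "i \<noteq> j" "i \<noteq> k" "j \<noteq> k" "a k \<noteq> 0"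
    "\<forall>x. x \<in> ker_form a \<longleftrightarrow> a k * x k = - a i * x i - a j * x j"
    by (rule line_parametrization[OF a(1)])
  define p0 where "p0 = (\<lambda>l. if l = i then 1 else if l = k then - a i / a k else 0)"
  define q0 where "q0 = (\<lambda>l. if l = j then 1 else if l = k then - a j / a k else 0)"
  have p0L: "p0 \<in> L" and q0L: "q0 \<in> L" using ijk by (simp_all add: a(2) p0_def q0_def)
  have "L = {\<lambda>l. x * p0 l + y * q0 l | x y. True}"
  proof (rule equalityI; rule subsetI)
    fix x assume "x \<in> L"
    then have xk: "a k * x k = - a i * x i - a j * x j" using ijk(6) a(2) by simp
    have "x l = x i * p0 l + x j * q0 l" for l
    proof -
      have "l = i \<or> l = j \<or> l = k" using ijk(1) by auto
      moreover have "x k = x i * p0 k + x j * q0 k"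
        using xk ijk(2-5) by (simp add: p0_def q0_def field_simps)
      ultimately show ?thesis using ijk(2-4) by (auto simp: p0_def q0_def)
    qed
    then show "x \<in> {\<lambda>l. x * p0 l + y * q0 l | x y. True}" by blast
  next
    fix x assume "x \<in> {\<lambda>l. x * p0 l + y * q0 l | x y. True}"
    then obtain c d where x: "x = (\<lambda>l. c * p0 l + d * q0 l)" by blast
    have "dot a x = c * dot a p0 + d * dot a q0" unfolding x by (simp add: dot_add dot_smult)
    then show "x \<in> L" using p0L q0L by (simp add: a(2) ker_form_dot)
  qed
  then have "\<exists>pq. case pq of (p, q) \<Rightarrow> L = {\<lambda>i. x * p i + y * q i | x y. True}" by (intro exI[of _ "(p0, q0)"]) simp
  then have some: "case line_basis L of (p, q) \<Rightarrow> L = {\<lambda>i. x * p i + y * q i | x y. True}"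
    unfolding line_basis_def by (rule someI_ex)
  obtain p q where pq: "line_basis L = (p, q)" by (cases "line_basis L")
  with some have L: "L = {\<lambda>i. x * p i + y * q i | x y. True}" by simp
  obtain u1 v1 where 1: "p0 = (\<lambda>l. u1 * p l + v1 * q l)" using p0L unfolding L by blast
  obtain u2 v2 where 2: "q0 = (\<lambda>l. u2 * p l + v2 * q l)" using q0L unfolding L by blast
  have "u1 * p i + v1 * q i = 1" "u1 * p j + v1 * q j = 0" "u2 * p i + v2 * q i = 0" "u2 * p j + v2 * q j = 1"
    using fun_cong[OF 1, of i] fun_cong[OF 1, of j] fun_cong[OF 2, of i] fun_cong[OF 2, of j] ijk(2-4)
    by (simp_all add: p0_def q0_def)
  note inv = matrix_2_left_inverse[OF this]
  define u where "u = (\<lambda>l. if l = i then u1 else if l = j then u2 else 0)"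
  define v where "v = (\<lambda>l. if l = i then v1 else if l = j then v2 else 0)"
  have dots: "dot u x = u1 * x i + u2 * x j" "dot v x = v1 * x i + v2 * x j" for x
    unfolding dot_def ijk(1) using ijk(2-4) by (simp_all add: u_def v_def)
  show thesis by (rule that[OF pq L, of u v]) (simp_all add: dots inv)
qed

definition line_coeffs :: "(3 \<Rightarrow> 'k::field) set \<Rightarrow> 3 \<Rightarrow> 'k" where
  "line_coeffs L = (SOME a. a \<noteq> (\<lambda>i. 0) \<and> L = ker_form a)"

lemma line_form_coeffs: "line_form L = lin_form (line_coeffs L)"
  by (simp add: line_form_def line_coeffs_def)

lemma line_coeffs:
  assumes "is_line L"
  shows "line_coeffs L \<noteq> (\<lambda>i. 0)" "L = ker_form (line_coeffs L)"
  using someI_ex[of "\<lambda>a. a \<noteq> (\<lambda>i. 0) \<and> L = ker_form a"] assms by (auto simp: line_coeffs_def is_line_def)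

lemma line_subset_eq:
  assumes "is_line L" "is_line H" "L \<subseteq> H"
  shows "L = H"
proof -
  obtain c where c: "line_coeffs H = (\<lambda>i. c * line_coeffs L i)"
    using vanishing_form_multiple[OF line_coeffs(1)[OF assms(1)], of "line_coeffs H"]
      line_coeffs(2)[OF assms(1)] line_coeffs(2)[OF assms(2)] assms(3) by (auto simp: ker_form_dot)
  have "c \<noteq> 0" using c line_coeffs(1)[OF assms(2)] by auto
  then have "ker_form (line_coeffs H) = ker_form (line_coeffs L)"
    unfolding c ker_form_dot dot_smult_left by simp
  then show ?thesis using line_coeffs(2) assms by metis
qed

lemma line_form_nonzero: "is_line L \<Longrightarrow> line_form L \<noteq> 0"
  using line_coeffs(1) by (simp add: line_form_coeffs lin_form_eq_0_iff)

lemma homog_line_form: "homog 1 (line_form L)"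
  by (simp add: line_form_coeffs homog_lin_form)

lemma euler_lin_form: "euler (lin_form a) = lin_form a"
  by (simp add: Der_lin_form[OF euler_Der]) (simp add: lin_form_def)

section \<open>Restriction to a line\<close>

locale plane_line =
  fixes L :: "(3 \<Rightarrow> 'k::field) set"
  assumes line: "is_line L"
begin

abbreviation "res \<equiv> res_fun L"
abbreviation "\<alpha> \<equiv> line_form L"

definition p where "p = fst (line_basis L)"
definition q where "q = snd (line_basis L)"
definition u where "u = (SOME u. dot u p = 1 \<and> dot u q = 0)"
definition v where "v = (SOME v. dot v p = 0 \<and> dot v q = 1)"

lemma L_eq: "L = {\<lambda>i. x * p i + y * q i | x y. True}"
  and u: "dot u p = 1" "dot u q = 0" and v: "dot v p = 0" "dot v q = 1"
proof -
  obtain p' q' u' v' where *: "line_basis L = (p', q')" "L = {\<lambda>i. x * p' i + y * q' i | x y. True}"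
    "dot u' p' = 1" "dot u' q' = 0" "dot v' p' = 0" "dot v' q' = 1"
    by (rule line_basis_exists[OF line])
  have pq: "p' = p" "q' = q" unfolding p_def q_def *(1) by simp_all
  show "L = {\<lambda>i. x * p i + y * q i | x y. True}" using *(2) unfolding pq .
  have "dot u p = 1 \<and> dot u q = 0" unfolding u_def by (rule someI[of _ u']) (use *(3,4) pq in simp)
  then show "dot u p = 1" "dot u q = 0" by simp_all
  have "dot v p = 0 \<and> dot v q = 1" unfolding v_def by (rule someI[of _ v']) (use *(5,6) pq in simp)
  then show "dot v p = 0" "dot v q = 1" by simp_all
qed

lemma mem_L_iff: "x \<in> L \<longleftrightarrow> (\<exists>c d. x = (\<lambda>i. c * p i + d * q i))"
  using arg_cong[OF L_eq, of "\<lambda>S. x \<in> S"] by (simp only: mem_Collect_eq simp_thms)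

lemma p_in: "p \<in> L" and q_in: "q \<in> L"
proof -
  have "(\<lambda>i. 1 * p i + 0 * q i) \<in> L" "(\<lambda>i. 0 * p i + 1 * q i) \<in> L" unfolding mem_L_iff by blast+
  then show "p \<in> L" "q \<in> L" by simp_all
qed

text \<open>\<open>U\<close> and \<open>V\<close> are linear forms in the plane that restrict to s
  and t. They make \<tau> below a ring homomorphism that is a section of the restriction.\<close>

definition U :: "(3, 'k) mpol" where "U = lin_form u"
definition V :: "(3, 'k) mpol" where "V = lin_form v"

definition \<tau> :: "(2, 'k) mpol \<Rightarrow> (3, 'k) mpol" where
  "\<tau> = subst (\<lambda>i. if i = 0 then U else V)"

lemma res_eq: "res = subst (\<lambda>i. Const (p i) * s_var + Const (q i) * t_var)"
  by (simp add: res_fun_def p_def q_def case_prod_unfold)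

lemma res_simps: "res (f + g) = res f + res g" "res (f * g) = res f * res g" "res (f - g) = res f - res g"
  "res (- f) = - res f" "res (Const c) = Const c" "res 0 = 0" "res 1 = 1" "res (f ^ n) = res f ^ n"
  "res (\<Sum>i\<in>I. h i) = (\<Sum>i\<in>I. res (h i))" "res (\<Prod>i\<in>I. h i) = (\<Prod>i\<in>I. res (h i))"
  by (simp_all add: res_eq subst_simps)

lemma \<tau>_simps: "\<tau> (f + g) = \<tau> f + \<tau> g" "\<tau> (f * g) = \<tau> f * \<tau> g" "\<tau> (Const c) = Const c"
  by (simp_all add: \<tau>_def subst_simps)

lemma res_lin_form: "res (lin_form b) = lin_form (\<lambda>i. if i = 0 then dot b p else dot b q)"
proof -
  have "res (lin_form b) = (\<Sum>i\<in>UNIV. Const (b i) * (Const (p i) * s_var + Const (q i) * t_var))"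
    by (simp add: res_eq subst_lin_form)
  also have "\<dots> = Const (dot b p) * s_var + Const (dot b q) * t_var"
    unfolding dot_def Const_sum sum_distrib_right sum.distrib[symmetric]
    by (rule sum.cong[OF refl]) (simp add: Const_mult algebra_simps)
  finally show ?thesis by (simp add: lin_form_2)
qed

lemma res_U: "res U = s_var" and res_V: "res V = t_var"
  by (simp_all add: U_def V_def res_lin_form u v lin_form_2)

lemma res_\<tau>: "res (\<tau> g) = g"
proof -
  have "res (\<tau> g) = subst (\<lambda>i. res (if i = 0 then U else V)) g" by (simp add: res_eq \<tau>_def subst_subst)
  also have "(\<lambda>i. res (if i = 0 then U else V)) = Var"
  proof
    fix i :: 2 show "res (if i = 0 then U else V) = Var i"
      using exhaust_2[of i] by (auto simp: res_U res_V)
  qed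
  finally show ?thesis by simp
qed

lemma \<alpha>_vanish: "x \<in> L \<Longrightarrow> dot (line_coeffs L) x = 0"
  using line_coeffs(2)[OF line] by (auto simp: ker_form_dot)

lemma res_\<alpha>: "res \<alpha> = 0"
proof -
  have "dot (line_coeffs L) p = 0" "dot (line_coeffs L) q = 0" using \<alpha>_vanish p_in q_in by auto
  then show ?thesis by (simp add: line_form_coeffs res_lin_form lin_form_2)
qed

lemma vanish_on_L_iff: "(\<forall>x\<in>L. dot b x = 0) \<longleftrightarrow> dot b p = 0 \<and> dot b q = 0"
proof
  assume "dot b p = 0 \<and> dot b q = 0"
  then have "dot b (\<lambda>i. x * p i + y * q i) = 0" for x y by (simp add: dot_add dot_smult)
  then show "\<forall>x\<in>L. dot b x = 0" using mem_L_iff by auto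
qed (use p_in q_in in blast)

lemma res_lin_form_eq_0:
  assumes "res (lin_form b) = 0"
  shows "\<exists>c. b = (\<lambda>i. c * line_coeffs L i)"
proof (rule vanishing_form_multiple[OF line_coeffs(1)[OF line]])
  have 0: "(\<lambda>i::2. if i = 0 then dot b p else dot b q) = (\<lambda>i. 0)"
    using assms by (simp only: res_lin_form lin_form_eq_0_iff)
  have "dot b p = 0" "dot b q = 0" using fun_cong[OF 0, of 0] fun_cong[OF 0, of 1] by simp_all
  then show "dot b x = 0" if "x \<in> ker_form (line_coeffs L)" for x
    using vanish_on_L_iff that line_coeffs(2)[OF line] by blast
qed

lemma \<alpha>_dvd_Var: "\<exists>c. Var i - (Const (p i) * U + Const (q i) * V) = Const c * \<alpha>"
proof -
  let ?b = "\<lambda>j. (if j = i then 1 else 0) - (p i * u j + q i * v j)"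
  have eq: "lin_form ?b = Var i - (Const (p i) * U + Const (q i) * V)"
    by (simp only: lin_form_diff lin_form_add lin_form_smult lin_form_single U_def V_def)
  have "res (lin_form ?b) = 0"
    unfolding eq by (simp add: res_simps res_U res_V) (simp add: res_eq)
  then obtain c where "?b = (\<lambda>j. c * line_coeffs L j)" using res_lin_form_eq_0 by blast
  then have "lin_form ?b = Const c * \<alpha>" by (simp only: lin_form_smult line_form_coeffs)
  then show ?thesis using eq by metis
qed

text \<open>Projecting onto the line along \<open>u\<close> and \<open>v\<close> changes each
  variable by a multiple of \<alpha>, and substitution respects this congruence.\<close>

lemma \<alpha>_dvd_diff: "\<alpha> dvd f - \<tau> (res f)"
proof -
  have "\<alpha> dvd subst Var f - subst (\<lambda>i. Const (p i) * U + Const (q i) * V) f"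
  proof (rule subst_cong_dvd)
    fix i show "\<alpha> dvd Var i - (Const (p i) * U + Const (q i) * V)"
      using \<alpha>_dvd_Var[of i] by (auto simp: mult.commute)
  qed
  moreover have "subst (\<lambda>i. Const (p i) * U + Const (q i) * V) f = \<tau> (res f)"
    by (simp add: \<tau>_def res_eq subst_subst subst_simps)
  ultimately show ?thesis by simp
qed

lemma res_eq_0_iff: "res f = 0 \<longleftrightarrow> \<alpha> dvd f"
proof
  assume "res f = 0"
  then show "\<alpha> dvd f" using \<alpha>_dvd_diff[of f] by (simp add: \<tau>_def)
next
  assume "\<alpha> dvd f"
  then obtain g where "f = \<alpha> * g" by (rule dvdE)
  then show "res f = 0" by (simp add: res_simps res_\<alpha>)
qed

text \<open>\<alpha> generates the kernel of a homomorphism into an integral domain.\<close>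

lemma prime_\<alpha>: "prime_elem \<alpha>"
proof (rule prime_elemI)
  show "\<alpha> \<noteq> 0" by (rule line_form_nonzero[OF line])
  show "\<not> \<alpha> dvd 1" by (simp add: res_eq_0_iff[symmetric] res_simps)
  show "\<alpha> dvd a \<or> \<alpha> dvd b" if "\<alpha> dvd a * b" for a b
    using that by (simp add: res_eq_0_iff[symmetric] res_simps)
qed

lemma homog_res: "homog n f \<Longrightarrow> homog n (res f)"
  unfolding res_eq by (intro homog_subst homog_add homog_Const_mult homog_Var)

lemma homog_U: "homog 1 U" and homog_V: "homog 1 V"
  by (simp_all add: U_def V_def homog_lin_form)

lemma homog_\<tau>: "homog n g \<Longrightarrow> homog n (\<tau> g)"
  unfolding \<tau>_def by (rule homog_subst) (simp add: homog_U homog_V)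

text \<open>An explicit formula for the induced derivation. It is a derivation of S for every
  \<theta>, but it commutes with restriction only when \<theta> preserves the ideal of L.\<close>

definition dres :: "((3, 'k) mpol \<Rightarrow> (3, 'k) mpol) \<Rightarrow> (2, 'k) mpol \<Rightarrow> (2, 'k) mpol" where
  "dres \<theta> g = res (\<theta> (\<tau> g))"

lemma dres_res:
  assumes "\<theta> \<in> Der" "\<alpha> dvd \<theta> \<alpha>"
  shows "dres \<theta> (res f) = res (\<theta> f)"
proof -
  obtain h where h: "f - \<tau> (res f) = \<alpha> * h" using \<alpha>_dvd_diff by (rule dvdE)
  have "\<theta> f = \<theta> (\<tau> (res f) + \<alpha> * h)" by (simp add: h[symmetric])
  also have "res \<dots> = dres \<theta> (res f)"
    using assms(2) by (simp add: Der_simps[OF assms(1)] res_simps dres_def res_\<alpha> res_eq_0_iff)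
  finally show ?thesis by simp
qed

lemma dres_Der:
  assumes "\<theta> \<in> Der"
  shows "dres \<theta> \<in> Der"
  by (rule DerI) (simp_all add: dres_def \<tau>_simps Der_simps[OF assms] Der_smult[OF assms] res_simps res_\<tau>)

lemma res_der_eq:
  assumes "\<theta> \<in> Der" "\<alpha> dvd \<theta> \<alpha>"
  shows "res_der L \<theta> = dres \<theta>"
  unfolding res_der_def
proof (rule the_equality)
  show "\<forall>f. dres \<theta> (res f) = res (\<theta> f)" using dres_res[OF assms] by blast
  fix \<eta> assume \<eta>: "\<forall>f. \<eta> (res f) = res (\<theta> f)"
  show "\<eta> = dres \<theta>"
  proof
    fix g show "\<eta> g = dres \<theta> g" using \<eta>[rule_format, of "\<tau> g"] by (simp add: dres_def res_\<tau>)
  qed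
qed

lemma dres_s: "dres \<theta> s_var = res (\<theta> U)" and dres_t: "dres \<theta> t_var = res (\<theta> V)"
  by (simp_all add: dres_def \<tau>_def)

text \<open>The induced derivation is determined by its values at s and t, the restrictions of
  \<theta> U and \<theta> V; if they vanish, everything \<theta> produces vanishes on L.\<close>

lemma res_Der_eq_0:
  assumes "\<theta> \<in> Der" "\<alpha> dvd \<theta> \<alpha>" "res (\<theta> U) = 0" "res (\<theta> V) = 0"
  shows "\<alpha> dvd \<theta> f"
proof -
  have "dres \<theta> = (\<lambda>f. 0)"
  proof (rule Der_eqI[OF dres_Der[OF assms(1)] Der_zero])
    fix i :: 2 show "dres \<theta> (Var i) = 0" using exhaust_2[of i] assms(3,4) by (auto simp: dres_s dres_t)
  qed
  then show ?thesis using dres_res[OF assms(1,2), of f] by (simp add: res_eq_0_iff)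
qed

lemma Der_divide:
  assumes "\<theta> \<in> Der" "\<And>i. \<alpha> dvd \<theta> (Var i)"
  obtains \<psi> where "\<psi> \<in> Der" "\<theta> = (\<lambda>f. \<alpha> * \<psi> f)"
proof -
  have "\<forall>i. \<exists>c. \<theta> (Var i) = \<alpha> * c" using assms(2) by (simp add: dvd_def)
  from choice[OF this] obtain c where c: "\<And>i. \<theta> (Var i) = \<alpha> * c i" by blast
  define \<psi> where "\<psi> = (\<lambda>f. \<Sum>i\<in>UNIV. c i * partial i f)"
  have \<psi>: "\<psi> \<in> Der" unfolding \<psi>_def by (rule der_of_coeffs)
  have "\<theta> = (\<lambda>f. \<alpha> * \<psi> f)"
    by (rule Der_eqI[OF assms(1) Der_times[OF \<psi>]]) (simp add: \<psi>_def der_of_coeffs_Var c)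
  then show thesis using \<psi> that by blast
qed

end

section \<open>Logarithmic derivations\<close>

lemma homog_0_Const: "homog 0 f \<Longrightarrow> f = Const (Poly_Mapping.lookup f 0)"
proof (rule poly_mapping_eqI)
  fix m assume f: "homog 0 f"
  have "Poly_Mapping.lookup f m = 0" if "m \<noteq> 0"
  proof (rule ccontr)
    assume "Poly_Mapping.lookup f m \<noteq> 0"
    then have "mon_deg m = 0" using f by (auto simp: homog_iff)
    then have "m = 0" by (intro poly_mapping_eqI) (simp add: mon_deg_def)
    then show False using that by simp
  qed
  then show "Poly_Mapping.lookup f m = Poly_Mapping.lookup (Const (Poly_Mapping.lookup f 0)) m"
    by (simp add: Const_def lookup_single when_def)
qed

lemma Const_unit_dvd: "c \<noteq> 0 \<Longrightarrow> x dvd Const (c::'k::field) * y \<longleftrightarrow> x dvd (y :: ('n, 'k) mpol)"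
proof
  assume c: "c \<noteq> 0" and x: "x dvd Const c * y"
  have "x dvd Const (inverse c) * (Const c * y)" using x by (rule dvd_mult)
  moreover have "Const (inverse c) * (Const c * y) = y"
    using c by (simp add: mult.assoc[symmetric] flip: Const_mult)
  ultimately show "x dvd y" by simp
qed (rule dvd_mult)

lemma Const_unit_dvd_left: "c \<noteq> 0 \<Longrightarrow> Const (c::'k::field) * x dvd y \<longleftrightarrow> x dvd (y :: ('n, 'k) mpol)"
proof
  assume c: "c \<noteq> 0" and "x dvd y"
  then obtain z where "y = x * z" by (auto elim: dvdE)
  moreover have "x * z = (Const c * x) * (Const (inverse c) * z)"
  proof -
    have "(Const c * x) * (Const (inverse c) * z) = (Const c * Const (inverse c)) * (x * z)" by (simp only: mult_ac)
    then show ?thesis using c by (simp flip: Const_mult)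
  qed
  ultimately show "Const c * x dvd y" by simp
qed (rule dvd_mult_right)

text \<open>Modulo \<open>l i\<close>, the Leibniz rule leaves only the product of
  \<open>\<theta> (l i)\<close> with the other factors, none of which is divisible by the prime
  \<open>l i\<close>.\<close>

lemma logarithmic_factor_dvd:
  fixes l :: "'i \<Rightarrow> ('n::{finite,linorder}, 'k::field) mpol"
  assumes "\<theta> \<in> Der" "finite I" "i \<in> I" "prime_elem (l i)"
    and "\<And>j. j \<in> I \<Longrightarrow> j \<noteq> i \<Longrightarrow> \<not> l i dvd l j"
    and "(\<Prod>j\<in>I. l j) dvd \<theta> (\<Prod>j\<in>I. l j)"
  shows "l i dvd \<theta> (l i)"
proof -
  define R where "R = (\<Prod>j\<in>I - {i}. l j)"
  have Q: "(\<Prod>j\<in>I. l j) = l i * R" unfolding R_def using assms(2,3) by (rule prod.remove)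
  have "\<not> l i dvd R"
  proof
    assume "l i dvd R"
    then obtain j where "j \<in> I - {i}" "l i dvd l j"
      unfolding R_def using prime_elem_dvd_prod[OF assms(4)] assms(2) by blast
    then show False using assms(5) by blast
  qed
  moreover have "l i dvd \<theta> (l i * R)" using assms(6) unfolding Q by (rule dvd_mult_left)
  then have "l i dvd \<theta> (l i) * R"
    unfolding Der_mult[OF assms(1)] by (simp add: dvd_add_right_iff)
  ultimately show ?thesis using prime_elem_dvd_mult_iff[OF assms(4)] by blast
qed

lemma lin_form_2_span:
  fixes \<beta> \<gamma> :: "2 \<Rightarrow> 'k::field"
  assumes "\<beta> \<noteq> (\<lambda>i. 0)" "\<not> lin_form \<beta> dvd lin_form \<gamma>"
  shows "\<exists>c1 c2. Var i = Const c1 * lin_form \<beta> + Const c2 * lin_form \<gamma>"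
proof -
  define D where "D = \<beta> 0 * \<gamma> 1 - \<beta> 1 * \<gamma> 0"
  have "D \<noteq> 0"
  proof
    assume "D = 0"
    then have eq: "\<beta> 0 * \<gamma> 1 = \<beta> 1 * \<gamma> 0" by (simp add: D_def)
    have "\<exists>c. \<forall>j. \<gamma> j = c * \<beta> j"
    proof (cases "\<beta> 0 = 0")
      case True
      then have "\<beta> 1 \<noteq> 0" using assms(1) exhaust_2 by (metis ext)
      then have "\<gamma> j = \<gamma> 1 / \<beta> 1 * \<beta> j" for j
        using exhaust_2[of j] True eq by (auto simp: field_simps)
      then show ?thesis by blast
    next
      case False
      then have "\<gamma> j = \<gamma> 0 / \<beta> 0 * \<beta> j" for j
        using exhaust_2[of j] eq by (auto simp: field_simps)
      then show ?thesis by blast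
    qed
    then obtain c where "\<gamma> = (\<lambda>j. c * \<beta> j)" by auto
    then have "lin_form \<gamma> = Const c * lin_form \<beta>" by (simp only: lin_form_smult)
    then show False using assms(2) by simp
  qed
  \<comment> \<open>Cramer's rule for the coefficients of the i-th variable.\<close>
  define c1 where "c1 = (if i = 0 then \<gamma> 1 / D else - \<gamma> 0 / D)"
  define c2 where "c2 = (if i = 0 then - \<beta> 1 / D else \<beta> 0 / D)"
  have "(\<lambda>j. if j = i then 1 else 0) = (\<lambda>j. c1 * \<beta> j + c2 * \<gamma> j)"
  proof
    fix j
    have "\<beta> 0 * \<gamma> 1 = D + \<beta> 1 * \<gamma> 0" by (simp add: D_def)
    then show "(if j = i then 1 else 0) = c1 * \<beta> j + c2 * \<gamma> j"
      using exhaust_2[of i] exhaust_2[of j] \<open>D \<noteq> 0\<close>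
      by (auto simp: c1_def c2_def field_simps)
  qed
  then have "lin_form (\<lambda>j. if j = i then 1 else 0) = lin_form (\<lambda>j. c1 * \<beta> j + c2 * \<gamma> j)" by (rule arg_cong)
  then have "Var i = Const c1 * lin_form \<beta> + Const c2 * lin_form \<gamma>"
    unfolding lin_form_single lin_form_add lin_form_smult .
  then show ?thesis by blast
qed

definition dir_der :: "(3 \<Rightarrow> 'k::comm_ring_1) \<Rightarrow> (3, 'k) mpol \<Rightarrow> (3, 'k) mpol" where
  "dir_der w f = (\<Sum>i\<in>UNIV. Const (w i) * partial i f)"

lemma dir_der_Der: "dir_der w \<in> Der"
  using der_of_coeffs[of "\<lambda>i. Const (w i)"] by (simp add: dir_der_def[abs_def])

lemma dir_der_lin_form: "dir_der w (lin_form b) = Const (dot b w)"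
  unfolding Der_lin_form[OF dir_der_Der]
  by (simp add: dir_der_def der_of_coeffs_Var dot_def Const_sum Const_mult)

lemma dir_der_Var: "dir_der w (Var i) = Const (w i)"
  by (simp add: dir_der_def der_of_coeffs_Var)

section \<open>Derivations of the arrangement along L\<close>

section \<open>Arrangements and the points of a line\<close>

locale arrangement_line =
  fixes A :: "(3 \<Rightarrow> 'k::field_char_0) set set" and L :: "(3 \<Rightarrow> 'k) set"
  assumes arrangement: "line_arrangement A" and L_in: "L \<in> A" and two: "2 \<le> card A"
begin

sublocale plane_line L
  by standard (use arrangement L_in in \<open>simp add: line_arrangement_def\<close>)

abbreviation "pts \<equiv> restricted_arr A L"
abbreviation "pf \<equiv> point_form L"
abbreviation "Q \<equiv> def_poly A"
abbreviation "Q2 \<equiv> res_poly A L"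

definition A' where "A' = A - {L}"
definition mlt where "mlt P = card {H \<in> A'. L \<inter> H = P}"
definition B where "B = (\<Prod>P\<in>pts. pf P ^ (mlt P - 1))"
definition d where "d = int (card A)"
definition h where "h = int (card pts)"

lemma lines: "H \<in> A \<Longrightarrow> is_line H" and finite_A: "finite A"
  using arrangement by (simp_all add: line_arrangement_def)

lemma A'_D: "H \<in> A' \<Longrightarrow> is_line H" "H \<in> A' \<Longrightarrow> H \<noteq> L" "H \<in> A' \<Longrightarrow> H \<in> A"
  using lines by (auto simp: A'_def)

lemma finite_A': "finite A'" and L_notin: "L \<notin> A'"
  using finite_A L_in by (auto simp: A'_def)

lemma card_A': "int (card A') = d - 1"
  using finite_A L_in two by (simp add: A'_def d_def of_nat_diff)

lemma pts_eq: "pts = (\<lambda>H. L \<inter> H) ` A'"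
  by (auto simp: restricted_arr_def A'_def)

lemma finite_pts: "finite pts"
  by (simp add: pts_eq finite_A')

lemma pts_nonempty: "pts \<noteq> {}"
proof -
  have "A' \<noteq> {}" using card_A' two by (auto simp: d_def)
  then show ?thesis by (simp add: pts_eq)
qed

lemma in_pts: "H \<in> A' \<Longrightarrow> L \<inter> H \<in> pts"
  by (auto simp: pts_eq)

definition \<beta> :: "(3 \<Rightarrow> 'k) set \<Rightarrow> 2 \<Rightarrow> 'k" where
  "\<beta> H = (\<lambda>i. if i = 0 then dot (line_coeffs H) p else dot (line_coeffs H) q)"

lemma res_line_form: "res (line_form H) = lin_form (\<beta> H)"
  by (simp add: line_form_coeffs res_lin_form \<beta>_def)

lemma res_line_form_nonzero:
  assumes "is_line H" "H \<noteq> L"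
  shows "res (line_form H) \<noteq> 0"
proof
  assume "res (line_form H) = 0"
  then obtain c where c: "line_coeffs H = (\<lambda>i. c * line_coeffs L i)"
    using res_lin_form_eq_0 by (auto simp: line_form_coeffs)
  have "x \<in> H" if "x \<in> L" for x
  proof -
    have "dot (line_coeffs H) x = 0" using \<alpha>_vanish[OF that] by (simp add: c dot_smult_left)
    then have "x \<in> ker_form (line_coeffs H)" by (simp add: ker_form_dot)
    then show ?thesis using line_coeffs(2)[OF assms(1)] by simp
  qed
  then have "L = H" using line_subset_eq[OF line assms(1)] by blast
  then show False using assms(2) by simp
qed

lemma \<beta>_nonzero: "is_line H \<Longrightarrow> H \<noteq> L \<Longrightarrow> \<beta> H \<noteq> (\<lambda>i. 0)"
  using res_line_form_nonzero[of H] by (simp add: res_line_form lin_form_eq_0_iff)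

lemma mem_line_iff: "is_line H \<Longrightarrow> (\<lambda>i. x * p i + y * q i) \<in> H \<longleftrightarrow> x * \<beta> H 0 + y * \<beta> H 1 = 0"
proof -
  assume H: "is_line H"
  have "(\<lambda>i. x * p i + y * q i) \<in> H \<longleftrightarrow> dot (line_coeffs H) (\<lambda>i. x * p i + y * q i) = 0"
    by (subst line_coeffs(2)[OF H]) (simp add: ker_form_dot)
  then show ?thesis by (simp add: dot_add dot_smult \<beta>_def)
qed

lemma inter_eq_iff:
  assumes H: "is_line H" "H \<noteq> L" "is_line H'" "H' \<noteq> L"
  shows "L \<inter> H = L \<inter> H' \<longleftrightarrow> (\<exists>c. c \<noteq> 0 \<and> res (line_form H') = Const c * res (line_form H))"
proof
  assume eq: "L \<inter> H = L \<inter> H'"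
  \<comment> \<open>The point of L with coordinates (\<beta>1, -\<beta>0), where the restricted form
    of \<open>H\<close> vanishes.\<close>
  have mem: "(\<lambda>i. \<beta> H 1 * p i + (- \<beta> H 0) * q i) \<in> L" unfolding mem_L_iff by blast
  have "(\<lambda>i. \<beta> H 1 * p i + (- \<beta> H 0) * q i) \<in> H" unfolding mem_line_iff[OF H(1)] by simp
  then have "(\<lambda>i. \<beta> H 1 * p i + (- \<beta> H 0) * q i) \<in> H'" using mem eq by blast
  then have e: "\<beta> H 1 * \<beta> H' 0 = \<beta> H 0 * \<beta> H' 1" unfolding mem_line_iff[OF H(3)] by simp
  have "\<exists>c. \<beta> H' = (\<lambda>j. c * \<beta> H j)"
  proof (cases "\<beta> H 0 = 0")
    case True
    have "\<beta> H 1 \<noteq> 0"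
    proof
      assume "\<beta> H 1 = 0"
      then have "\<beta> H j = 0" for j using True exhaust_2[of j] by auto
      then show False using \<beta>_nonzero[OF H(1,2)] by auto
    qed
    then have "\<beta> H' j = \<beta> H' 1 / \<beta> H 1 * \<beta> H j" for j
      using exhaust_2[of j] True e by (auto simp: field_simps)
    then show ?thesis by blast
  next
    case False
    then have "\<beta> H' j = \<beta> H' 0 / \<beta> H 0 * \<beta> H j" for j
      using exhaust_2[of j] e by (auto simp: field_simps)
    then show ?thesis by blast
  qed
  then obtain c where c: "\<beta> H' = (\<lambda>j. c * \<beta> H j)" by blast
  have "c \<noteq> 0" using c \<beta>_nonzero[OF H(3,4)] by auto
  then show "\<exists>c. c \<noteq> 0 \<and> res (line_form H') = Const c * res (line_form H)"
    unfolding res_line_form c lin_form_smult by blast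
next
  assume "\<exists>c. c \<noteq> 0 \<and> res (line_form H') = Const c * res (line_form H)"
  then obtain c where c: "c \<noteq> 0" "lin_form (\<beta> H') = lin_form (\<lambda>j. c * \<beta> H j)"
    unfolding res_line_form lin_form_smult by blast
  have c': "\<beta> H' = (\<lambda>j. c * \<beta> H j)" by (rule lin_form_inj[OF c(2)])
  have "x \<in> H \<longleftrightarrow> x \<in> H'" if "x \<in> L" for x
  proof -
    obtain y z where x: "x = (\<lambda>i. y * p i + z * q i)" using \<open>x \<in> L\<close> unfolding mem_L_iff by blast
    have "y * \<beta> H' 0 + z * \<beta> H' 1 = c * (y * \<beta> H 0 + z * \<beta> H 1)" by (simp add: c' algebra_simps)
    then show ?thesis unfolding x mem_line_iff[OF H(1)] mem_line_iff[OF H(3)] using c(1) by simp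
  qed
  then show "L \<inter> H = L \<inter> H'" by blast
qed

lemma inter_eq_of_dvd:
  assumes H: "is_line H" "H \<noteq> L" "is_line H'" "H' \<noteq> L" and dvd: "res (line_form H) dvd res (line_form H')"
  shows "L \<inter> H = L \<inter> H'"
proof -
  obtain g where g: "res (line_form H') = res (line_form H) * g" using dvd by (rule dvdE)
  have h1: "homog 1 (res (line_form H))" "homog 1 (res (line_form H'))" by (simp_all add: homog_res homog_line_form)
  have "homog 0 g"
    by (rule homog_mult_cancel[OF h1(1) res_line_form_nonzero[OF H(1,2)]]) (use h1(2) in \<open>simp add: g\<close>)
  then obtain c where c: "g = Const c" using homog_0_Const by blast
  have "c \<noteq> 0" using res_line_form_nonzero[OF H(3,4)] g c by auto
  then show ?thesis unfolding inter_eq_iff[OF H] g c by (auto simp: mult.commute)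
qed

text \<open>The line chosen in \<open>point_form\<close> may lie outside A. It cannot be L itself,
  as then P would be all of L and some other line of A would contain L.\<close>

lemma pf_line: "P \<in> pts \<Longrightarrow> \<exists>H. is_line H \<and> H \<noteq> L \<and> L \<inter> H = P \<and> pf P = res (line_form H)"
proof -
  assume "P \<in> pts"
  then obtain H0 where H0: "H0 \<in> A'" "P = L \<inter> H0" by (auto simp: pts_eq)
  define H where "H = (SOME H. is_line H \<and> L \<inter> H = P)"
  have H: "is_line H" "L \<inter> H = P"
    using someI[of "\<lambda>H. is_line H \<and> L \<inter> H = P" H0] H0 A'_D by (auto simp: H_def)
  have "H \<noteq> L"
  proof
    assume "H = L"
    then have "L \<subseteq> H0" using H(2) H0(2) by auto
    then have "L = H0" using line_subset_eq[OF line A'_D(1)[OF H0(1)]] by blast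
    then show False using A'_D(2)[OF H0(1)] by simp
  qed
  then show ?thesis using H by (auto simp: point_form_def H_def)
qed

lemma prime_pf: "P \<in> pts \<Longrightarrow> prime_elem (pf P)"
proof -
  assume "P \<in> pts"
  then obtain H where H: "is_line H" "H \<noteq> L" "pf P = lin_form (\<beta> H)"
    using pf_line[of P] by (auto simp: res_line_form)
  show ?thesis unfolding H(3) by (rule prime_elem_lin_form_2[OF \<beta>_nonzero[OF H(1,2)]])
qed

lemma pf_nonzero: "P \<in> pts \<Longrightarrow> pf P \<noteq> 0"
  using prime_pf by (auto simp: prime_elem_def)

lemma homog_pf: "P \<in> pts \<Longrightarrow> homog 1 (pf P)"
  using pf_line[of P] by (auto simp: homog_res homog_line_form)

lemma pf_not_dvd:
  assumes "P \<in> pts" "P' \<in> pts" "P \<noteq> P'"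
  shows "\<not> pf P dvd pf P'"
proof
  assume "pf P dvd pf P'"
  moreover obtain H where H: "is_line H" "H \<noteq> L" "L \<inter> H = P" "pf P = res (line_form H)" using pf_line[OF assms(1)] by blast
  moreover obtain H' where H': "is_line H'" "H' \<noteq> L" "L \<inter> H' = P'" "pf P' = res (line_form H')" using pf_line[OF assms(2)] by blast
  ultimately have "P = P'" using inter_eq_of_dvd[OF H(1,2) H'(1,2)] by simp
  then show False using assms(3) by simp
qed

lemma pf_span:
  assumes "P \<in> pts" "P' \<in> pts" "P \<noteq> P'"
  shows "\<exists>c1 c2. Var i = Const c1 * pf P + Const c2 * pf P'"
proof -
  obtain H where H: "is_line H" "H \<noteq> L" "pf P = lin_form (\<beta> H)" using pf_line[OF assms(1)] by (auto simp: res_line_form)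
  obtain H' where H': "pf P' = lin_form (\<beta> H')" using pf_line[OF assms(2)] by (auto simp: res_line_form)
  show ?thesis unfolding H(3) H'
    by (rule lin_form_2_span[OF \<beta>_nonzero[OF H(1,2)]]) (use pf_not_dvd[OF assms] H(3) H' in simp)
qed

lemma res_line_pf: "H \<in> A' \<Longrightarrow> \<exists>c. c \<noteq> 0 \<and> res (line_form H) = Const c * pf (L \<inter> H)"
proof -
  assume H: "H \<in> A'"
  obtain H1 where H1: "is_line H1" "H1 \<noteq> L" "L \<inter> H1 = L \<inter> H" "pf (L \<inter> H) = res (line_form H1)"
    using pf_line[OF in_pts[OF H]] by blast
  show ?thesis
    using inter_eq_iff[OF H1(1,2) A'_D(1,2)[OF H]] H1(3) unfolding H1(4) by blast
qed

text \<open>Lines through the same point of L restrict to proportional forms, so the product is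
  grouped by points. \<open>T = pts\<close> covers all other lines; removing P from it gives the
  lines that miss P.\<close>

lemma prod_res_lines:
  assumes "T \<subseteq> pts"
  shows "\<exists>c. c \<noteq> 0 \<and> (\<Prod>H\<in>{H \<in> A'. L \<inter> H \<in> T}. res (line_form H)) = Const c * (\<Prod>P\<in>T. pf P ^ mlt P)"
proof -
  have "\<forall>H\<in>A'. \<exists>c. c \<noteq> 0 \<and> res (line_form H) = Const c * pf (L \<inter> H)" using res_line_pf by blast
  from bchoice[OF this] obtain c where c: "\<And>H. H \<in> A' \<Longrightarrow> c H \<noteq> 0 \<and> res (line_form H) = Const (c H) * pf (L \<inter> H)" by blast
  let ?S = "{H \<in> A'. L \<inter> H \<in> T}"
  have fin: "finite ?S" "finite T" using finite_A' finite_subset[OF assms finite_pts] by simp_all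
  have Cp: "(\<Prod>H\<in>S. Const (c H)) = Const (\<Prod>H\<in>S. c H)" for S
    by (induct S rule: infinite_finite_induct) (simp_all add: Const_mult)
  have "(\<Prod>H\<in>?S. res (line_form H)) = (\<Prod>H\<in>?S. Const (c H)) * (\<Prod>H\<in>?S. pf (L \<inter> H))"
    unfolding prod.distrib[symmetric] by (rule prod.cong[OF refl]) (use c in auto)
  also have "(\<Prod>H\<in>?S. pf (L \<inter> H)) = (\<Prod>P\<in>T. \<Prod>H\<in>{H \<in> ?S. L \<inter> H = P}. pf (L \<inter> H))"
    by (rule prod.group[symmetric, OF fin]) auto
  also have "\<dots> = (\<Prod>P\<in>T. pf P ^ mlt P)"
  proof (rule prod.cong[OF refl])
    fix P assume "P \<in> T"
    then have "{H \<in> ?S. L \<inter> H = P} = {H \<in> A'. L \<inter> H = P}" by auto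
    then show "(\<Prod>H\<in>{H \<in> ?S. L \<inter> H = P}. pf (L \<inter> H)) = pf P ^ mlt P" by (simp add: mlt_def)
  qed
  finally have "(\<Prod>H\<in>?S. res (line_form H)) = Const (\<Prod>H\<in>?S. c H) * (\<Prod>P\<in>T. pf P ^ mlt P)" by (simp only: Cp)
  moreover have "(\<Prod>H\<in>?S. c H) \<noteq> 0" using fin c by (simp add: prod_zero_iff)
  ultimately show ?thesis by blast
qed

lemma sum_mlt: "T \<subseteq> pts \<Longrightarrow> card {H \<in> A'. L \<inter> H \<in> T} = (\<Sum>P\<in>T. mlt P)"
proof -
  assume T: "T \<subseteq> pts"
  let ?S = "{H \<in> A'. L \<inter> H \<in> T}"
  have fin: "finite ?S" "finite T" using finite_A' finite_subset[OF T finite_pts] by simp_all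
  have "(\<Sum>P\<in>T. \<Sum>H\<in>{H \<in> ?S. L \<inter> H = P}. 1) = (\<Sum>H\<in>?S. 1 :: nat)"
    by (rule sum.group[OF fin]) auto
  moreover have "{H \<in> ?S. L \<inter> H = P} = {H \<in> A'. L \<inter> H = P}" if "P \<in> T" for P using that by auto
  ultimately show ?thesis by (simp add: mlt_def)
qed

lemma mlt_pos: "P \<in> pts \<Longrightarrow> 1 \<le> mlt P"
proof -
  assume "P \<in> pts"
  then obtain H where "H \<in> A'" "P = L \<inter> H" by (auto simp: pts_eq)
  then have "{H \<in> A'. L \<inter> H = P} \<noteq> {}" by blast
  then show ?thesis using finite_A' by (simp add: mlt_def Suc_le_eq card_gt_0_iff One_nat_def)
qed

lemma homog_prod_pf: "T \<subseteq> pts \<Longrightarrow> homog (\<Sum>P\<in>T. int (e P)) (\<Prod>P\<in>T. pf P ^ e P)"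
proof (rule homog_prod)
  fix P assume "T \<subseteq> pts" "P \<in> T"
  then have "homog (1 * int (e P)) (pf P ^ e P)" by (intro homog_power homog_pf) auto
  then show "homog (int (e P)) (pf P ^ e P)" by simp
qed

lemma sum_mlt_minus:
  assumes "T \<subseteq> pts"
  shows "(\<Sum>P\<in>T. int (mlt P - 1)) = int (card {H \<in> A'. L \<inter> H \<in> T}) - int (card T)"
proof -
  have "(\<Sum>P\<in>T. int (mlt P - 1)) = (\<Sum>P\<in>T. int (mlt P) - 1)"
    by (rule sum.cong[OF refl]) (use assms mlt_pos in \<open>auto simp: of_nat_diff\<close>)
  then show ?thesis by (simp add: sum_subtractf sum_mlt[OF assms])
qed

lemma homog_B: "homog (d - 1 - h) B"
proof -
  have "{H \<in> A'. L \<inter> H \<in> pts} = A'" using in_pts by blast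
  then have "(\<Sum>P\<in>pts. int (mlt P - 1)) = d - 1 - h"
    using sum_mlt_minus[OF subset_refl] by (simp add: card_A' h_def)
  then show ?thesis using homog_prod_pf[OF subset_refl, of "\<lambda>P. mlt P - 1"] by (simp add: B_def)
qed

lemma B_nonzero: "B \<noteq> 0"
  using finite_pts pf_nonzero by (simp add: B_def prod_zero_iff)

lemma Q2_eq: "Q2 = (\<Prod>P\<in>pts. pf P)"
  by (simp add: res_poly_def)

lemma Q2_nonzero: "Q2 \<noteq> 0"
  using finite_pts pf_nonzero by (simp add: Q2_eq prod_zero_iff)

lemma homog_Q2: "homog h Q2"
  using homog_prod_pf[OF subset_refl, of "\<lambda>_. 1"] by (simp add: Q2_eq h_def)

lemma prod_pf_mlt: "T \<subseteq> pts \<Longrightarrow> (\<Prod>P\<in>T. pf P ^ mlt P) = (\<Prod>P\<in>T. pf P) * (\<Prod>P\<in>T. pf P ^ (mlt P - 1))"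
proof -
  assume T: "T \<subseteq> pts"
  have "pf P ^ mlt P = pf P * pf P ^ (mlt P - 1)" if "P \<in> T" for P
  proof -
    have "mlt P = Suc (mlt P - 1)" using mlt_pos[of P] T that by (auto simp: One_nat_def)
    then have "pf P ^ mlt P = pf P ^ Suc (mlt P - 1)" by (rule arg_cong)
    then show ?thesis by (simp only: power_Suc)
  qed
  then show ?thesis by (simp add: prod.distrib)
qed

section \<open>Derivations of the arrangement\<close>

lemma line_form_dvd_eq:
  assumes "H \<in> A" "H' \<in> A" "line_form H dvd line_form H'"
  shows "H = H'"
proof (rule ccontr)
  assume "H \<noteq> H'"
  interpret H: plane_line H by standard (rule lines[OF assms(1)])
  have "H.res (line_form H') = 0" using assms(3) H.res_eq_0_iff by simp
  then obtain c where c: "line_coeffs H' = (\<lambda>i. c * line_coeffs H i)"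
    using H.res_lin_form_eq_0 by (auto simp: line_form_coeffs)
  have "x \<in> H'" if "x \<in> H" for x
  proof -
    have "dot (line_coeffs H') x = 0" using H.\<alpha>_vanish[OF that] by (simp add: c dot_smult_left)
    then have "x \<in> ker_form (line_coeffs H')" by (simp add: ker_form_dot)
    then show ?thesis using line_coeffs(2)[OF lines[OF assms(2)]] by simp
  qed
  then have "H = H'" using line_subset_eq[OF lines[OF assms(1)] lines[OF assms(2)]] by blast
  then show False using \<open>H \<noteq> H'\<close> by simp
qed

lemma prime_line_form: "H \<in> A \<Longrightarrow> prime_elem (line_form H)"
  using lines plane_line.prime_\<alpha> plane_line.intro by blast

lemma log_dvd:
  assumes "\<theta> \<in> Der" "Q dvd \<theta> Q" "H \<in> A"
  shows "line_form H dvd \<theta> (line_form H)"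
  by (rule logarithmic_factor_dvd[where l = line_form and I = A and i = H, OF assms(1) finite_A assms(3) prime_line_form[OF assms(3)]])
    (use line_form_dvd_eq[OF assms(3)] assms(2) in \<open>auto simp: def_poly_def\<close>)

definition D0c :: "int \<Rightarrow> ((3, 'k) mpol \<Rightarrow> (3, 'k) mpol) set" where
  "D0c e = {\<theta> \<in> Der. \<theta> Q = 0 \<and> (\<forall>i. homog e (\<theta> (Var i)))}"

lemma D0c_D:
  assumes "\<theta> \<in> D0c e"
  shows "\<theta> \<in> Der" "\<theta> Q = 0" "homog e (\<theta> (Var i))" "\<alpha> dvd \<theta> \<alpha>"
  using assms log_dvd[of \<theta> L] L_in by (auto simp: D0c_def)

lemma homog_Der_lin_form:
  assumes "\<theta> \<in> Der" "\<And>i. homog e (\<theta> (Var i))"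
  shows "homog e (\<theta> (lin_form b))"
  unfolding Der_lin_form[OF assms(1)] by (intro homog_sum homog_Const_mult assms(2))

text \<open>By the Leibniz rule \<open>\<theta>\<close> multiplies \<open>Q\<close> by the sum of the \<open>c H\<close>, and the Euler derivation multiplies
  it by the number of lines.\<close>

lemma D0_projection:
  assumes \<theta>: "\<theta> \<in> Der" "\<And>i. homog e (\<theta> (Var i))" and c: "\<And>H. H \<in> A \<Longrightarrow> \<theta> (line_form H) = c H * line_form H"
    and g: "g = Const (1 / of_nat (card A)) * (\<Sum>H\<in>A. c H)"
  shows "(\<lambda>f. \<theta> f - g * euler f) \<in> D0c e"
proof -
  have c_homog: "homog (e - 1) (c H)" if "H \<in> A" for H
  proof (rule homog_mult_cancel[OF homog_line_form line_form_nonzero[OF lines[OF that]]])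
    have "homog e (\<theta> (line_form H))" unfolding line_form_coeffs by (rule homog_Der_lin_form[OF \<theta>])
    then show "homog (e - 1 + 1) (line_form H * c H)" by (simp add: c[OF that] mult.commute)
  qed
  have g_homog: "homog (e - 1) g" unfolding g by (intro homog_Const_mult homog_sum c_homog)
  have "euler Q = (\<Sum>H\<in>A. 1) * Q"
    unfolding def_poly_def by (rule Der_prod[OF euler_Der finite_A]) (simp add: line_form_coeffs euler_lin_form)
  then have "euler Q = of_nat (card A) * Q" by simp
  moreover have "\<theta> Q = (\<Sum>H\<in>A. c H) * Q"
    unfolding def_poly_def by (rule Der_prod[OF \<theta>(1) finite_A c])
  moreover have "g * of_nat (card A) = (\<Sum>H\<in>A. c H)"
  proof -
    \<comment> \<open>The number of lines is invertible in k because the characteristic is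
      0.\<close>
    have "Const (1 / of_nat (card A)) * Const (of_nat (card A) :: 'k) = (1 :: (3, 'k) mpol)"
      using two by (simp flip: Const_mult)
    have "g * of_nat (card A) = (Const (1 / of_nat (card A)) * Const (of_nat (card A))) * (\<Sum>H\<in>A. c H)"
      unfolding g of_nat_Const by (simp only: mult_ac)
    then show ?thesis unfolding \<open>Const (1 / of_nat (card A)) * Const (of_nat (card A) :: 'k) = (1 :: (3, 'k) mpol)\<close> by simp
  qed
  ultimately have "\<theta> Q - g * euler Q = 0" by (simp add: mult.assoc[symmetric])
  moreover have "homog e (\<theta> (Var i) - g * Var i)" for i
  proof (rule homog_diff[OF \<theta>(2)])
    show "homog e (g * Var i)" using homog_mult[OF g_homog homog_Var, of i] by simp
  qed
  ultimately show ?thesis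
    using Der_minus[OF \<theta>(1) Der_times[OF euler_Der]] by (simp add: D0c_def)
qed

lemma D0c_add: "\<theta> \<in> D0c e \<Longrightarrow> \<theta>' \<in> D0c e \<Longrightarrow> (\<lambda>f. \<theta> f + \<theta>' f) \<in> D0c e"
  by (simp add: D0c_def Der_plus homog_add)

lemma D0c_mult: "\<theta> \<in> D0c e \<Longrightarrow> homog k r \<Longrightarrow> (\<lambda>f. r * \<theta> f) \<in> D0c (k + e)"
  by (simp add: D0c_def Der_times homog_mult)

text \<open>\<open>W \<theta> g\<close> says that \<theta> realizes g, and e is the degree shift
  between them. The zero form has every degree, so its witness may have a degree different from that
  of the other summand; hence the separate cases.\<close>

lemma D0_homog_ideal:
  assumes W_add: "\<And>\<theta> \<theta>' g g'. W \<theta> g \<Longrightarrow> W \<theta>' g' \<Longrightarrow> W (\<lambda>f. \<theta> f + \<theta>' f) (g + g')"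
    and W_mult: "\<And>\<theta> g h. W \<theta> g \<Longrightarrow> W (\<lambda>f. \<tau> h * \<theta> f) (h * g)"
  shows "homog_ideal (\<lambda>g. \<exists>k. \<exists>\<theta>\<in>D0c (k + e). homog k g \<and> W \<theta> g)"
proof
  fix x y :: "(2, 'k) mpol" and k
  assume "\<exists>k. \<exists>\<theta>\<in>D0c (k + e). homog k x \<and> W \<theta> x" and "\<exists>k. \<exists>\<theta>\<in>D0c (k + e). homog k y \<and> W \<theta> y"
    and k: "homog k x" "homog k y"
  then obtain k1 \<theta>1 k2 \<theta>2 where 1: "\<theta>1 \<in> D0c (k1 + e)" "homog k1 x" "W \<theta>1 x"
    and 2: "\<theta>2 \<in> D0c (k2 + e)" "homog k2 y" "W \<theta>2 y" by blast
  show "\<exists>k. \<exists>\<theta>\<in>D0c (k + e). homog k (x + y) \<and> W \<theta> (x + y)"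
  proof (cases "x = 0")
    case True
    then have "x + y = y" by simp
    then show ?thesis using 2 by metis
  next
    case x: False
    show ?thesis
    proof (cases "y = 0")
      case True
      then have "x + y = x" by simp
      then show ?thesis using 1 by metis
    next
      case False
      have "k1 = k" "k2 = k" using homog_unique[OF 1(2) k(1) x] homog_unique[OF 2(2) k(2) False] .
      then have "(\<lambda>f. \<theta>1 f + \<theta>2 f) \<in> D0c (k + e)" using D0c_add 1(1) 2(1) by simp
      then show ?thesis using W_add[OF 1(3) 2(3)] homog_add[OF k] by blast
    qed
  qed
next
  fix x h :: "(2, 'k) mpol" and j
  assume "\<exists>k. \<exists>\<theta>\<in>D0c (k + e). homog k x \<and> W \<theta> x" and h: "homog j h"
  then obtain k \<theta> where 1: "\<theta> \<in> D0c (k + e)" "homog k x" "W \<theta> x" by blast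
  have "(\<lambda>f. \<tau> h * \<theta> f) \<in> D0c ((j + k) + e)" using D0c_mult[OF 1(1) homog_\<tau>[OF h]] by (simp add: add.assoc)
  then show "\<exists>k. \<exists>\<theta>\<in>D0c (k + e). homog k (h * x) \<and> W \<theta> (h * x)"
    using homog_mult[OF h 1(2)] W_mult[OF 1(3)] by blast
qed

text \<open>From local to global: the product in \<open>ex\<close> is invertible near P, so
  \<open>ex\<close> is a statement about a neighbourhood of P. The conclusion is the statement on a
  whole chart.\<close>

lemma D0_saturation:
  assumes W_add: "\<And>\<theta> \<theta>' g g'. W \<theta> g \<Longrightarrow> W \<theta>' g' \<Longrightarrow> W (\<lambda>f. \<theta> f + \<theta>' f) (g + g')"
    and W_mult: "\<And>\<theta> g h. W \<theta> g \<Longrightarrow> W (\<lambda>f. \<tau> h * \<theta> f) (h * g)"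
    and ex: "\<And>P. P \<in> pts \<Longrightarrow> \<exists>k. \<exists>\<theta>\<in>D0c (k + e). homog k (\<Prod>P'\<in>pts - {P}. pf P' ^ m P') \<and> W \<theta> (\<Prod>P'\<in>pts - {P}. pf P' ^ m P')"
  shows "\<exists>N. \<exists>\<theta>\<in>D0c (int N + e). W \<theta> (Var i ^ N)"
proof -
  interpret I: homog_ideal "\<lambda>g. \<exists>k. \<exists>\<theta>\<in>D0c (k + e). homog k g \<and> W \<theta> g"
    by (rule D0_homog_ideal[OF W_add W_mult])
  have "I.sat (Var i) 1"
  proof (rule I.sat_complementary_products[OF homog_Var finite_pts pts_nonempty homog_pf pf_span homog_1])
    fix P assume P: "P \<in> pts"
    show "I.sat (Var i) ((\<Prod>P'\<in>pts - {P}. pf P' ^ m P') * 1)"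
      unfolding I.sat_def
    proof (rule exI[of _ 0])
      let ?x = "Var i ^ 0 * ((\<Prod>P'\<in>pts - {P}. pf P' ^ m P') * 1)"
      show "\<exists>k. \<exists>\<theta>\<in>D0c (k + e). homog k ?x \<and> W \<theta> ?x"
        unfolding power_0 mult_1_left mult_1_right by (rule ex[OF P])
    qed
  qed
  then obtain N k \<theta> where *: "\<theta> \<in> D0c (k + e)" "homog k (Var i ^ N :: (2, 'k) mpol)" "W \<theta> (Var i ^ N)"
    unfolding I.sat_def by auto
  have "(Var i ^ N :: (2, 'k) mpol) \<noteq> 0" using prime_elem_Var_2[of i, where 'k = 'k] by (simp add: prime_elem_def)
  moreover have "homog (int N) (Var i ^ N :: (2, 'k) mpol)" using homog_power[OF homog_Var, of N i] by simp
  ultimately have "k = int N" using homog_unique *(2) by blast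
  then show ?thesis using * by blast
qed

text \<open>The image of a derivation in \<open>D(A'') / S \<theta>_E\<close> is measured by its determinant with the Euler
  derivation. Near a point \<open>P\<close>, the constant derivation in the direction \<open>P\<close> kills the forms of all lines
  through \<open>P\<close>; multiplied by the other forms it has determinant \<open>Q''\<close> up to a unit.\<close>

lemma D0_onto_restriction:
  "\<exists>N. \<exists>\<theta>\<in>D0c (int N + (h - 1)). s_var * res (\<theta> V) - t_var * res (\<theta> U) = Q2 * Var i ^ N"
proof (rule D0_saturation[where W = "\<lambda>\<theta> g. s_var * res (\<theta> V) - t_var * res (\<theta> U) = Q2 * g" and m = "\<lambda>P. mlt P - 1"])
  fix \<theta> \<theta>' g g'
  assume "s_var * res (\<theta> V) - t_var * res (\<theta> U) = Q2 * g" "s_var * res (\<theta>' V) - t_var * res (\<theta>' U) = Q2 * g'"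
  then show "s_var * res (\<theta> V + \<theta>' V) - t_var * res (\<theta> U + \<theta>' U) = Q2 * (g + g')"
    unfolding res_simps distrib_left by (simp add: algebra_simps)
next
  fix \<theta> g f
  assume "s_var * res (\<theta> V) - t_var * res (\<theta> U) = Q2 * g"
  then have "f * (s_var * res (\<theta> V) - t_var * res (\<theta> U)) = f * (Q2 * g)" by simp
  then show "s_var * res (\<tau> f * \<theta> V) - t_var * res (\<tau> f * \<theta> U) = Q2 * (f * g)"
    unfolding res_simps res_\<tau> by (simp only: right_diff_distrib mult.left_commute)
next
  fix P assume P: "P \<in> pts"
  obtain H1 where H1: "is_line H1" "H1 \<noteq> L" "L \<inter> H1 = P" "pf P = lin_form (\<beta> H1)"
    using pf_line[OF P] by (auto simp: res_line_form)
  define b0 b1 where "b0 = \<beta> H1 0" and "b1 = \<beta> H1 1"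
  \<comment> \<open>The point P itself, as the zero (b1, -b0) of its form.\<close>
  define w where "w = (\<lambda>i. b1 * p i + (- b0) * q i)"
  have "w \<in> L" unfolding w_def mem_L_iff by blast
  moreover have "w \<in> H1" unfolding w_def mem_line_iff[OF H1(1)] by (simp add: b0_def b1_def)
  ultimately have wP: "w \<in> P" using H1(3) by blast
  let ?T = "pts - {P}" and ?S = "{H \<in> A'. L \<inter> H \<in> pts - {P}}"
  define R where "R = (\<Prod>H\<in>?S. line_form H)"
  obtain c where c: "c \<noteq> 0" "res R = Const c * (\<Prod>P'\<in>?T. pf P' ^ mlt P')"
    using prod_res_lines[of ?T] by (auto simp: R_def res_simps)
  \<comment> \<open>Multiplying by the lines that miss P makes the derivation logarithmic along
    them; it already kills the forms of the lines through P. The factor -1/c removes the constant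
    from restricting R and the sign from the determinant.\<close>
  define \<theta> where "\<theta> = (\<lambda>f. (Const (- 1 / c) * R) * dir_der w f)"
  have \<theta>: "\<theta> \<in> Der" unfolding \<theta>_def by (rule Der_times[OF dir_der_Der])
  have "homog (\<Sum>H\<in>?S. 1) R" unfolding R_def by (intro homog_prod homog_line_form)
  then have "homog (int (card ?S) + 0) (\<theta> (Var i))" for i
    unfolding \<theta>_def dir_der_Var by (intro homog_mult homog_Const_mult homog_Const) simp
  then have \<theta>h: "homog (int (card ?S)) (\<theta> (Var i))" for i by simp
  have "line_form H dvd \<theta> (line_form H)" if H: "H \<in> A" for H
  proof (cases "H = L \<or> L \<inter> H = P")
    case True
    then have "w \<in> H" using wP \<open>w \<in> L\<close> by auto
    then have "w \<in> ker_form (line_coeffs H)" using line_coeffs(2)[OF lines[OF H]] by simp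
    then show ?thesis by (simp add: \<theta>_def line_form_coeffs dir_der_lin_form ker_form_dot)
  next
    case False
    then have "H \<in> ?S" using H in_pts by (auto simp: A'_def)
    then have "line_form H dvd R" unfolding R_def using finite_A' by (intro dvd_prodI) auto
    then show ?thesis unfolding \<theta>_def by (intro dvd_mult2 dvd_mult)
  qed
  then have "\<forall>H\<in>A. \<exists>x. \<theta> (line_form H) = x * line_form H" by (metis dvdE mult.commute)
  from bchoice[OF this] obtain x where x: "\<And>H. H \<in> A \<Longrightarrow> \<theta> (line_form H) = x H * line_form H" by blast
  define g where "g = Const (1 / of_nat (card A)) * (\<Sum>H\<in>A. x H)"
  have \<theta>0: "(\<lambda>f. \<theta> f - g * euler f) \<in> D0c (int (card ?S))"
    by (rule D0_projection[OF \<theta> \<theta>h x g_def])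
  have eU: "euler U = U" "euler V = V" by (simp_all add: U_def V_def euler_lin_form)
  have dw: "dot u w = b1" "dot v w = - b0" unfolding w_def dot_add dot_smult by (simp_all add: u v)
  have \<theta>UV: "res (\<theta> U) = Const (- 1 / c) * res R * Const b1" "res (\<theta> V) = Const (- 1 / c) * res R * Const (- b0)"
    unfolding \<theta>_def U_def V_def dir_der_lin_form dw res_simps by (rule refl)+
  \<comment> \<open>The determinant with the Euler derivation does not see the correction by a
    multiple of it.\<close>
  have "s_var * res (\<theta> V - g * euler V) - t_var * res (\<theta> U - g * euler U) = s_var * res (\<theta> V) - t_var * res (\<theta> U)"
    unfolding eU res_simps res_U res_V by (simp add: algebra_simps)
  also have "\<dots> = (Const (- 1 / c) * Const (- 1)) * res R * (Const b0 * s_var + Const b1 * t_var)"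
    unfolding \<theta>UV Const_uminus Const_1 by (simp add: algebra_simps)
  also have "Const b0 * s_var + Const b1 * t_var = pf P" unfolding H1(4) lin_form_2 b0_def b1_def ..
  also have "(Const (- 1 / c) * Const (- 1)) * res R = (\<Prod>P'\<in>?T. pf P' ^ mlt P')"
    unfolding c(2) mult.assoc[symmetric] Const_mult[symmetric] using c(1) by simp
  also have "\<dots> * pf P = (pf P * (\<Prod>P'\<in>?T. pf P')) * (\<Prod>P'\<in>?T. pf P' ^ (mlt P' - 1))"
    using prod_pf_mlt[of ?T] by (simp add: mult_ac)
  also have "pf P * (\<Prod>P'\<in>?T. pf P') = Q2"
    unfolding Q2_eq by (rule prod.remove[OF finite_pts P, symmetric])
  finally have W: "s_var * res (\<theta> V - g * euler V) - t_var * res (\<theta> U - g * euler U) = Q2 * (\<Prod>P'\<in>?T. pf P' ^ (mlt P' - 1))" .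
  \<comment> \<open>Degrees: the number of lines missing P is the degree of the realized form plus
    the h - 1 points other than P.\<close>
  have "int (card ?T) = h - 1" using finite_pts P pts_nonempty by (simp add: h_def of_nat_diff card_gt_0_iff Suc_le_eq One_nat_def)
  then have "int (card ?S) = (\<Sum>P'\<in>?T. int (mlt P' - 1)) + (h - 1)" using sum_mlt_minus[of ?T] by simp
  then show "\<exists>k. \<exists>\<theta>\<in>D0c (k + (h - 1)). homog k (\<Prod>P'\<in>?T. pf P' ^ (mlt P' - 1)) \<and>
      s_var * res (\<theta> V) - t_var * res (\<theta> U) = Q2 * (\<Prod>P'\<in>?T. pf P' ^ (mlt P' - 1))"
    using \<theta>0 W homog_prod_pf[of ?T "\<lambda>P'. mlt P' - 1"] by (intro exI[of _ "\<Sum>P'\<in>?T. int (mlt P' - 1)"] bexI[of _ "\<lambda>f. \<theta> f - g * euler f"]) auto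
qed

text \<open>The derivations of the arrangement that restrict to \<open>r \<theta>_E\<close> on the line are, up to multiples
  of the Euler derivation, those of the form \<open>\<alpha> \<psi>\<close> with \<open>\<psi>\<close> logarithmic for the other lines, and
  \<open>r\<close> is then proportional to the restriction of \<open>\<psi> \<alpha>\<close>.\<close>

lemma D0_kernel_locally:
  "\<exists>N. \<exists>\<theta>\<in>D0c (int N + (d - h)). res (\<theta> U) = (B * Var i ^ N) * s_var \<and> res (\<theta> V) = (B * Var i ^ N) * t_var"
proof (rule D0_saturation[where W = "\<lambda>\<theta> g. res (\<theta> U) = (B * g) * s_var \<and> res (\<theta> V) = (B * g) * t_var" and m = "\<lambda>P. 1"])
  fix \<theta> \<theta>' g g'
  assume "res (\<theta> U) = (B * g) * s_var \<and> res (\<theta> V) = (B * g) * t_var"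
    "res (\<theta>' U) = (B * g') * s_var \<and> res (\<theta>' V) = (B * g') * t_var"
  then show "res (\<theta> U + \<theta>' U) = (B * (g + g')) * s_var \<and> res (\<theta> V + \<theta>' V) = (B * (g + g')) * t_var"
    by (simp only: res_simps distrib_left distrib_right simp_thms)
next
  fix \<theta> g f
  assume "res (\<theta> U) = (B * g) * s_var \<and> res (\<theta> V) = (B * g) * t_var"
  then show "res (\<tau> f * \<theta> U) = (B * (f * g)) * s_var \<and> res (\<tau> f * \<theta> V) = (B * (f * g)) * t_var"
    by (simp only: res_simps res_\<tau> mult_ac simp_thms)
next
  fix P assume P: "P \<in> pts"
  let ?G = "\<Prod>P'\<in>pts - {P}. pf P' ^ 1"
  obtain H0 where H0: "H0 \<in> A'" "L \<inter> H0 = P" using P by (auto simp: pts_eq)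
  \<comment> \<open>A direction tangent to one line H0 through P but transversal to L, so that the
    derivation kills the form of H0 and acts nontrivially on \<alpha>.\<close>
  have "\<not> H0 \<subseteq> L"
    using line_subset_eq[OF A'_D(1)[OF H0(1)] line] A'_D(2)[OF H0(1)] by blast
  then obtain w where w: "w \<in> H0" "w \<notin> L" by blast
  define a where "a = dot (line_coeffs L) w"
  have a: "a \<noteq> 0"
  proof
    assume "a = 0"
    then have "w \<in> ker_form (line_coeffs L)" by (simp add: a_def ker_form_dot)
    then show False using w(2) line_coeffs(2)[OF line] by simp
  qed
  have w0: "dot (line_coeffs H0) w = 0"
    using w(1) line_coeffs(2)[OF A'_D(1)[OF H0(1)]] by (auto simp: ker_form_dot)
  define R where "R = (\<Prod>H\<in>A' - {H0}. line_form H)"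
  obtain c1 where c1: "c1 \<noteq> 0" "res (line_form H0) = Const c1 * pf P" using res_line_pf[OF H0(1)] H0(2) by blast
  obtain cA where cA: "cA \<noteq> 0" "(\<Prod>H\<in>A'. res (line_form H)) = Const cA * (\<Prod>P\<in>pts. pf P ^ mlt P)"
  proof -
    have "{H \<in> A'. L \<inter> H \<in> pts} = A'" using in_pts by blast
    then show thesis using prod_res_lines[OF subset_refl] that by auto
  qed
  \<comment> \<open>Among the lines other than L and H0, each point besides P is counted with its
    full multiplicity and P with one less. This is B times the forms of the other points.\<close>
  have resR: "res R = Const (cA / c1) * (B * ?G)"
  proof -
    have "pf P * (Const c1 * res R) = res (line_form H0) * res R" by (simp add: c1(2) mult_ac)
    also have "\<dots> = (\<Prod>H\<in>A'. res (line_form H))"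
      unfolding R_def res_simps by (rule prod.remove[OF finite_A' H0(1), symmetric])
    also have "\<dots> = Const cA * ((\<Prod>P\<in>pts. pf P) * B)" unfolding cA(2) prod_pf_mlt[OF subset_refl] B_def ..
    also have "(\<Prod>P\<in>pts. pf P) = pf P * ?G" using prod.remove[OF finite_pts P, of pf] by simp
    also have "Const cA * (pf P * ?G * B) = pf P * (Const cA * (B * ?G))" by (simp only: mult_ac)
    finally have e: "Const c1 * res R = Const cA * (B * ?G)" using pf_nonzero[OF P] by (simp only: mult_cancel_left) simp
    have "res R = Const (1 / c1) * (Const c1 * res R)"
      unfolding mult.assoc[symmetric] Const_mult[symmetric] using c1(1) by simp
    also have "\<dots> = Const (1 / c1 * cA) * (B * ?G)" unfolding e Const_mult by (simp only: mult.assoc)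
    finally show ?thesis by simp
  qed
  \<comment> \<open>Normalized so that the Euler correction g restricts to - B ?G. The derivation
    itself has the factor \<alpha> and vanishes on L, so the corrected one restricts to B ?G times
    Euler.\<close>
  define c0 where "c0 = - (of_nat (card A) * c1 / (a * cA))"
  define \<theta> where "\<theta> = (\<lambda>f. (Const c0 * (\<alpha> * R)) * dir_der w f)"
  \<comment> \<open>The logarithmic factors: \<alpha> cancels for L, the direction w lies in H0, and
    the form of any other line is taken out of R.\<close>
  define x where "x = (\<lambda>H. if H = L then Const (c0 * a) * R else if H = H0 then 0
    else \<alpha> * (Const (c0 * dot (line_coeffs H) w) * (\<Prod>H'\<in>A' - {H0} - {H}. line_form H')))"
  have \<theta>: "\<theta> \<in> Der" unfolding \<theta>_def by (rule Der_times[OF dir_der_Der])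
  have cardR: "int (card (A' - {H0})) = d - 2"
    using card_Suc_Diff1[OF finite_A' H0(1)] card_A' by linarith
  have hR: "homog (d - 2) R" using homog_prod[of "A' - {H0}" "\<lambda>_. 1" line_form, OF homog_line_form] cardR by (simp add: R_def)
  have "homog (1 + (d - 2) + 0) (\<theta> (Var i))" for i
    unfolding \<theta>_def dir_der_Var by (intro homog_mult homog_Const_mult homog_Const homog_line_form hR)
  then have \<theta>h: "homog (d - 1) (\<theta> (Var i))" for i by simp
  have x: "\<theta> (line_form H) = x H * line_form H" if H: "H \<in> A" for H
  proof -
    have eq: "\<theta> (line_form H) = (Const c0 * (\<alpha> * R)) * Const (dot (line_coeffs H) w)"
      unfolding \<theta>_def line_form_coeffs[of H] dir_der_lin_form ..
    consider "H = L" | "H = H0" | "H \<in> A' - {H0}" "H \<noteq> L" using H L_notin by (auto simp: A'_def)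
    then show ?thesis
    proof cases
      case 1
      then show ?thesis unfolding eq x_def by (simp add: a_def Const_mult mult_ac)
    next
      case 2
      then show ?thesis unfolding eq x_def using A'_D(2)[OF H0(1)] by (simp add: w0)
    next
      case 3
      have "R = line_form H * (\<Prod>H'\<in>A' - {H0} - {H}. line_form H')"
        unfolding R_def using finite_A' 3(1) by (intro prod.remove) auto
      then show ?thesis unfolding eq x_def using 3 by (simp add: Const_mult mult_ac)
    qed
  qed
  define g where "g = Const (1 / of_nat (card A)) * (\<Sum>H\<in>A. x H)"
  have \<theta>0: "(\<lambda>f. \<theta> f - g * euler f) \<in> D0c (d - 1)"
    by (rule D0_projection[OF \<theta> \<theta>h x g_def])
  \<comment> \<open>Only the factor belonging to L survives restriction, since the others are 0 or
    contain \<alpha>.\<close>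
  have "res (x H) = 0" if "H \<in> A'" for H
    using A'_D(2)[OF that] by (simp add: x_def res_simps res_\<alpha>)
  moreover have "(\<Sum>H\<in>A. res (x H)) = res (x L) + (\<Sum>H\<in>A'. res (x H))"
    unfolding A'_def by (rule sum.remove[OF finite_A L_in])
  ultimately have "(\<Sum>H\<in>A. res (x H)) = res (x L)" by simp
  also have "\<dots> = Const (c0 * a) * (Const (cA / c1) * (B * ?G))" by (simp add: x_def res_simps resR)
  finally have "res g = Const (1 / of_nat (card A)) * (Const (c0 * a) * (Const (cA / c1) * (B * ?G)))"
    unfolding g_def res_simps by simp
  also have "\<dots> = Const (1 / of_nat (card A) * (c0 * a * (cA / c1))) * (B * ?G)"
    unfolding Const_mult by (simp only: mult.assoc)
  also have "1 / of_nat (card A) * (c0 * a * (cA / c1)) = - 1"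
  proof -
    have "of_nat (card A) \<noteq> (0 :: 'k)" using two by simp
    then show ?thesis using a cA(1) c1(1) by (simp add: c0_def field_simps)
  qed
  finally have g: "res g = - (B * ?G)" by (simp add: Const_uminus)
  have eU: "euler U = U" "euler V = V" by (simp_all add: U_def V_def euler_lin_form)
  have \<theta>0_res: "res (\<theta> f) = 0" for f by (simp add: \<theta>_def res_simps res_\<alpha>)
  have W: "res (\<theta> U - g * euler U) = (B * ?G) * s_var" "res (\<theta> V - g * euler V) = (B * ?G) * t_var"
    unfolding res_simps eU res_U res_V \<theta>0_res g by simp_all
  have "int (card (pts - {P})) = h - 1" using finite_pts P pts_nonempty by (simp add: h_def of_nat_diff card_gt_0_iff Suc_le_eq One_nat_def)
  then have "homog (h - 1) ?G" using homog_prod_pf[of "pts - {P}" "\<lambda>_. 1"] by simp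
  moreover have "h - 1 + (d - h) = d - 1" by simp
  ultimately show "\<exists>k. \<exists>\<theta>\<in>D0c (k + (d - h)). homog k ?G \<and>
      res (\<theta> U) = (B * ?G) * s_var \<and> res (\<theta> V) = (B * ?G) * t_var"
    using \<theta>0 W by (intro exI[of _ "h - 1"] bexI[of _ "\<lambda>f. \<theta> f - g * euler f"]) simp_all
qed

text \<open>The derivation minus the lift of r times Euler vanishes on L, so it is \<alpha> \<psi>
  with \<psi> logarithmic along the other lines, and \<psi> \<alpha> restricts to -|A| r. At a point
  P, comparing the lines through P with a fixed one shows that mlt P - 1 of their forms divide
  \<psi> \<alpha> modulo \<alpha>; restricted to L they are proportional to the form of P.\<close>

lemma B_dvd_kernel:
  assumes \<theta>: "\<theta> \<in> Der" "\<theta> Q = 0" and r: "res (\<theta> U) = r * s_var" "res (\<theta> V) = r * t_var"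
  shows "B dvd r"
proof -
  have log: "line_form H dvd \<theta> (line_form H)" if "H \<in> A" for H
    by (rule log_dvd[OF \<theta>(1) _ that]) (simp add: \<theta>(2))
  have \<theta>\<alpha>: "\<alpha> dvd \<theta> \<alpha>" by (rule log[OF L_in])
  have dres_euler: "dres \<theta> = (\<lambda>f. r * euler f)"
  proof (rule Der_eqI[OF dres_Der[OF \<theta>(1)] Der_times[OF euler_Der]])
    fix i :: 2 show "dres \<theta> (Var i) = r * euler (Var i)"
      using exhaust_2[of i] by (auto simp: dres_s dres_t r)
  qed
  define \<zeta> where "\<zeta> = (\<lambda>f. \<theta> f - \<tau> r * euler f)"
  have \<zeta>: "\<zeta> \<in> Der" unfolding \<zeta>_def by (rule Der_minus[OF \<theta>(1) Der_times[OF euler_Der]])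
  have eL: "euler (line_form H) = line_form H" for H by (simp add: line_form_coeffs euler_lin_form)
  have \<zeta>l: "line_form H dvd \<zeta> (line_form H)" if "H \<in> A" for H
    unfolding \<zeta>_def eL using log[OF that] by (intro dvd_diff) simp_all
  have eU: "euler U = U" "euler V = V" by (simp_all add: U_def V_def euler_lin_form)
  have "res (\<zeta> U) = 0" "res (\<zeta> V) = 0"
    unfolding \<zeta>_def eU res_simps res_\<tau> res_U res_V r by simp_all
  then have "\<And>i. \<alpha> dvd \<zeta> (Var i)" by (rule res_Der_eq_0[OF \<zeta> \<zeta>l[OF L_in]])
  then obtain \<psi> where \<psi>: "\<psi> \<in> Der" "\<zeta> = (\<lambda>f. \<alpha> * \<psi> f)" by (rule Der_divide[OF \<zeta>])
  have \<psi>l: "line_form H dvd \<psi> (line_form H)" if H: "H \<in> A'" for H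
  proof -
    have HA: "H \<in> A" "H \<noteq> L" using A'_D[OF H] by simp_all
    have "line_form H dvd \<alpha> * \<psi> (line_form H)" using \<zeta>l[OF HA(1)] unfolding \<psi>(2) .
    moreover have "\<not> line_form H dvd \<alpha>" using line_form_dvd_eq[OF HA(1) L_in] HA(2) by blast
    ultimately show ?thesis using prime_elem_dvd_mult_iff[OF prime_line_form[OF HA(1)]] by blast
  qed
  obtain c where c: "\<theta> \<alpha> = \<alpha> * c" using \<theta>\<alpha> by (rule dvdE)
  have \<alpha>0: "\<alpha> \<noteq> 0" by (rule line_form_nonzero[OF line])
  have "\<alpha> * \<psi> \<alpha> = \<alpha> * (c - \<tau> r)"
    using fun_cong[OF \<psi>(2), of \<alpha>] unfolding \<zeta>_def c eL by (simp add: algebra_simps)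
  then have \<psi>\<alpha>: "\<psi> \<alpha> = c - \<tau> r" using \<alpha>0 by (simp only: mult_cancel_left) simp
  define Q' where "Q' = (\<Prod>H\<in>A'. line_form H)"
  have Q: "Q = \<alpha> * Q'" unfolding def_poly_def Q'_def A'_def by (rule prod.remove[OF finite_A L_in])
  \<comment> \<open>Here \<theta> Q = 0 enters. On L, \<theta> multiplies the product of the other
    lines by (|A| - 1) r, so c restricts to the negative of that.\<close>
  have "\<alpha> * (\<theta> Q' + c * Q') = 0" using \<theta>(2) unfolding Q Der_mult[OF \<theta>(1)] c by (simp add: algebra_simps)
  then have "\<theta> Q' + c * Q' = 0" using \<alpha>0 by simp
  then have "res (\<theta> Q') + res c * res Q' = 0" by (metis res_simps(1,2,6))
  moreover have "res (\<theta> Q') = r * (of_nat (card A') * res Q')"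
  proof -
    have "res (\<theta> Q') = r * euler (res Q')" using dres_res[OF \<theta>(1) \<theta>\<alpha>, of Q'] by (simp add: dres_euler)
    also have "euler (res Q') = (\<Sum>H\<in>A'. 1) * res Q'"
      unfolding Q'_def res_simps
      by (rule Der_prod[OF euler_Der finite_A']) (simp add: res_line_form euler_lin_form)
    finally show ?thesis by simp
  qed
  ultimately have "(of_nat (card A') * r + res c) * res Q' = 0" by (simp add: algebra_simps)
  moreover have "res Q' \<noteq> 0"
    unfolding Q'_def res_simps using finite_A' res_line_form_nonzero A'_D by (simp add: prod_zero_iff)
  ultimately have "res c = - (of_nat (card A') * r)" by (simp add: eq_neg_iff_add_eq_0 add.commute)
  then have "res (\<psi> \<alpha>) = - (of_nat (card A') * r) - r" unfolding \<psi>\<alpha> res_simps res_\<tau> by simp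
  also have "\<dots> = Const (- of_nat (card A)) * r"
  proof -
    have "card A = card A' + 1" using card_A' by (simp add: d_def)
    then have "Const (- of_nat (card A)) = - of_nat (card A') - (1 :: (2, 'k) mpol)"
      unfolding Const_uminus of_nat_Const[symmetric] by simp
    then show ?thesis by (simp only: left_diff_distrib mult_minus_left mult_1_left)
  qed
  finally have res\<psi>: "res (\<psi> \<alpha>) = Const (- of_nat (card A)) * r" .
  have "pf P ^ (mlt P - 1) dvd r" if P: "P \<in> pts" for P
  proof -
    let ?S = "{H \<in> A'. L \<inter> H = P}"
    obtain H1 where H1: "H1 \<in> A'" "L \<inter> H1 = P" using P by (auto simp: pts_eq)
    obtain f1 where f1: "\<psi> (line_form H1) = line_form H1 * f1" using \<psi>l[OF H1(1)] by (rule dvdE)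
    have dvd: "line_form H dvd \<psi> \<alpha> - f1 * \<alpha>" if H: "H \<in> ?S - {H1}" for H
    proof -
      have HA: "H \<in> A'" "L \<inter> H = L \<inter> H1" "H \<noteq> H1" using H H1 by auto
      obtain b where b: "b \<noteq> 0" "res (line_form H) = Const b * res (line_form H1)"
        using inter_eq_iff[OF A'_D(1,2)[OF H1(1)] A'_D(1,2)[OF HA(1)]] HA(2) by auto
      have e: "lin_form (\<lambda>j. line_coeffs H j - b * line_coeffs H1 j) = line_form H - Const b * line_form H1"
        unfolding lin_form_diff lin_form_smult line_form_coeffs ..
      have "res (lin_form (\<lambda>j. line_coeffs H j - b * line_coeffs H1 j)) = 0"
        unfolding e res_simps b(2) by simp
      then obtain a where "(\<lambda>j. line_coeffs H j - b * line_coeffs H1 j) = (\<lambda>j. a * line_coeffs L j)"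
        using res_lin_form_eq_0 by blast
      then have "lin_form (\<lambda>j. line_coeffs H j - b * line_coeffs H1 j) = lin_form (\<lambda>j. a * line_coeffs L j)" by (rule arg_cong)
      \<comment> \<open>The lines through P form the pencil spanned by L and H1. Since \<psi>
        multiplies the form of H1 by \<open>f1\<close>, the difference of \<psi> and
        \<open>f1\<close> sees only the \<alpha> component.\<close>
      then have eq: "line_form H = Const a * \<alpha> + Const b * line_form H1"
        unfolding e lin_form_smult line_form_coeffs[of L, symmetric] by (simp add: algebra_simps)
      have "a \<noteq> 0"
      proof
        assume "a = 0"
        then have "line_form H1 dvd line_form H" using eq by simp
        then show False using line_form_dvd_eq[OF A'_D(3)[OF H1(1)] A'_D(3)[OF HA(1)]] HA(3) by simp
      qed
      have "\<psi> (line_form H) - f1 * line_form H = Const a * (\<psi> \<alpha> - f1 * \<alpha>)"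
        unfolding eq Der_add[OF \<psi>(1)] Der_smult[OF \<psi>(1)] f1 by (simp add: algebra_simps)
      moreover have "line_form H dvd \<psi> (line_form H) - f1 * line_form H"
        using \<psi>l[OF HA(1)] by (intro dvd_diff) simp_all
      ultimately show ?thesis using Const_unit_dvd[OF \<open>a \<noteq> 0\<close>] by metis
    qed
    have "(\<Prod>H\<in>?S - {H1}. line_form H) dvd \<psi> \<alpha> - f1 * \<alpha>"
    proof (rule prod_primes_dvd)
      show "finite (?S - {H1})" using finite_A' by simp
      show "prime_elem (line_form H)" if "H \<in> ?S - {H1}" for H
        using prime_line_form A'_D(3) that by blast
      show "\<not> line_form H dvd line_form H'" if "H \<in> ?S - {H1}" "H' \<in> ?S - {H1}" "H \<noteq> H'" for H H'
        using line_form_dvd_eq[of H H'] A'_D(3) that by blast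
    qed (rule dvd)
    then obtain z where z: "\<psi> \<alpha> - f1 * \<alpha> = (\<Prod>H\<in>?S - {H1}. line_form H) * z" by (rule dvdE)
    have "res (\<psi> \<alpha>) = res (\<psi> \<alpha> - f1 * \<alpha>)" by (simp add: res_simps res_\<alpha>)
    then have "(\<Prod>H\<in>?S - {H1}. res (line_form H)) dvd res (\<psi> \<alpha>)" unfolding z res_simps by simp
    moreover have "\<exists>c. c \<noteq> 0 \<and> (\<Prod>H\<in>?S - {H1}. res (line_form H)) = Const c * pf P ^ (mlt P - 1)"
    proof -
      have "\<forall>H\<in>?S. \<exists>c. c \<noteq> 0 \<and> res (line_form H) = Const c * pf P" using res_line_pf by auto
      from bchoice[OF this] obtain c where c: "\<And>H. H \<in> ?S \<Longrightarrow> c H \<noteq> 0 \<and> res (line_form H) = Const (c H) * pf P" by blast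
      have Cp: "(\<Prod>H\<in>S. Const (c H)) = Const (\<Prod>H\<in>S. c H)" for S
        by (induct S rule: infinite_finite_induct) (simp_all add: Const_mult)
      have "(\<Prod>H\<in>?S - {H1}. res (line_form H)) = (\<Prod>H\<in>?S - {H1}. Const (c H)) * (\<Prod>H\<in>?S - {H1}. pf P)"
        unfolding prod.distrib[symmetric] by (rule prod.cong[OF refl]) (use c in auto)
      also have "(\<Prod>H\<in>?S - {H1}. pf P) = pf P ^ (mlt P - 1)"
        using finite_A' H1 by (simp add: mlt_def One_nat_def)
      finally have "(\<Prod>H\<in>?S - {H1}. res (line_form H)) = Const (\<Prod>H\<in>?S - {H1}. c H) * pf P ^ (mlt P - 1)" unfolding Cp .
      moreover have "(\<Prod>H\<in>?S - {H1}. c H) \<noteq> 0" using finite_A' c by (simp add: prod_zero_iff)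
      ultimately show ?thesis by blast
    qed
    then obtain c where c: "c \<noteq> 0" "(\<Prod>H\<in>?S - {H1}. res (line_form H)) = Const c * pf P ^ (mlt P - 1)" by blast
    ultimately have "Const c * pf P ^ (mlt P - 1) dvd Const (- of_nat (card A)) * r"
      unfolding res\<psi> by simp
    then have "pf P ^ (mlt P - 1) dvd Const (- of_nat (card A)) * r"
      unfolding Const_unit_dvd_left[OF c(1)] .
    moreover have "- of_nat (card A) \<noteq> (0 :: 'k)" using two by simp
    ultimately show ?thesis by (simp only: Const_unit_dvd not_False_eq_True)
  qed
  then show ?thesis
    unfolding B_def by (intro prod_prime_powers_dvd[OF finite_pts prime_pf pf_not_dvd])
qed

text \<open>Both \<eta> and the Euler derivation preserve the ideal of each point. If b0 and b1 are
  the coefficients of the point's form, then b0 and b1 times the determinant are combinations of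
  that form and its image under \<eta>, and one of b0, b1 is invertible.\<close>

lemma Q2_dvd_determinant:
  assumes \<eta>: "\<eta> \<in> Der" "Q2 dvd \<eta> Q2"
  shows "Q2 dvd s_var * \<eta> t_var - t_var * \<eta> s_var"
  unfolding Q2_eq
proof (rule prod_primes_dvd[OF finite_pts prime_pf pf_not_dvd])
  fix P assume P: "P \<in> pts"
  have log: "pf P dvd \<eta> (pf P)"
    by (rule logarithmic_factor_dvd[where l = pf and I = pts and i = P, OF \<eta>(1) finite_pts P prime_pf[OF P]])
      (use pf_not_dvd[OF P] \<eta>(2) in \<open>auto simp: Q2_eq\<close>)
  obtain H where H: "is_line H" "H \<noteq> L" "pf P = lin_form (\<beta> H)" using pf_line[OF P] by (auto simp: res_line_form)
  define b0 b1 where "b0 = \<beta> H 0" and "b1 = \<beta> H 1"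
  have pf: "pf P = Const b0 * s_var + Const b1 * t_var" unfolding H(3) lin_form_2 b0_def b1_def ..
  have \<eta>pf: "\<eta> (pf P) = Const b0 * \<eta> s_var + Const b1 * \<eta> t_var"
    unfolding pf Der_add[OF \<eta>(1)] Der_smult[OF \<eta>(1)] ..
  have "Const b0 * (s_var * \<eta> t_var - t_var * \<eta> s_var) = pf P * \<eta> t_var - t_var * \<eta> (pf P)"
    unfolding \<eta>pf unfolding pf by (simp add: algebra_simps)
  then have d0: "pf P dvd Const b0 * (s_var * \<eta> t_var - t_var * \<eta> s_var)"
    using log by (simp only:) (intro dvd_diff dvd_mult dvd_triv_left)
  have "Const b1 * (s_var * \<eta> t_var - t_var * \<eta> s_var) = s_var * \<eta> (pf P) - pf P * \<eta> s_var"
    unfolding \<eta>pf unfolding pf by (simp add: algebra_simps)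
  then have d1: "pf P dvd Const b1 * (s_var * \<eta> t_var - t_var * \<eta> s_var)"
    using log by (simp only:) (intro dvd_diff dvd_mult dvd_triv_left)
  have "b0 \<noteq> 0 \<or> b1 \<noteq> 0"
  proof (rule ccontr)
    assume n: "\<not> (b0 \<noteq> 0 \<or> b1 \<noteq> 0)"
    have "\<beta> H j = 0" for j using exhaust_2[of j] n by (auto simp: b0_def b1_def)
    then show False using \<beta>_nonzero[OF H(1,2)] by auto
  qed
  then show "pf P dvd s_var * \<eta> t_var - t_var * \<eta> s_var"
  proof
    assume b0: "b0 \<noteq> 0"
    from d0 show ?thesis unfolding Const_unit_dvd[OF b0] .
  next
    assume b1: "b1 \<noteq> 0"
    from d1 show ?thesis unfolding Const_unit_dvd[OF b1] .
  qed
qed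

lemma dres_log:
  assumes "\<theta> \<in> Der" "\<theta> Q = 0"
  shows "dres \<theta> \<in> log_der Q2"
proof -
  have log: "line_form H dvd \<theta> (line_form H)" if "H \<in> A" for H
    by (rule log_dvd[OF assms(1) _ that]) (simp add: assms(2))
  have "\<exists>x. dres \<theta> (pf P) = x * pf P" if P: "P \<in> pts" for P
  proof -
    obtain H where H: "H \<in> A'" "P = L \<inter> H" using P by (auto simp: pts_eq)
    obtain c where c: "c \<noteq> 0" "res (line_form H) = Const c * pf P" using res_line_pf[OF H(1)] H(2) by blast
    obtain z where z: "\<theta> (line_form H) = line_form H * z" using log[OF A'_D(3)[OF H(1)]] by (rule dvdE)
    have "dres \<theta> (res (line_form H)) = res (line_form H) * res z"
      unfolding dres_res[OF assms(1) log[OF L_in]] z res_simps ..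
    then have "Const c * dres \<theta> (pf P) = Const c * (pf P * res z)"
      unfolding c(2) Der_smult[OF dres_Der[OF assms(1)]] by (simp only: mult.assoc)
    then have "dres \<theta> (pf P) = pf P * res z" using c(1) by (simp only: mult_cancel_left Const_eq_0_iff) simp
    then show ?thesis by (auto simp: mult.commute)
  qed
  then have "\<forall>P\<in>pts. \<exists>x. dres \<theta> (pf P) = x * pf P" by blast
  from bchoice[OF this] obtain x where x: "\<And>P. P \<in> pts \<Longrightarrow> dres \<theta> (pf P) = x P * pf P" by blast
  have "dres \<theta> Q2 = (\<Sum>P\<in>pts. x P) * Q2"
    unfolding Q2_eq by (rule Der_prod[OF dres_Der[OF assms(1)] finite_pts x])
  then show ?thesis using dres_Der[OF assms(1)] by (simp add: log_der_def)
qed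

end

section \<open>The embedded modules and the exact sequence of L\<close>

section \<open>Embedding the quotient modules\<close>

lemma graded_quotient_via_simps:
  "carrier (graded_quotient_via \<rho> M N) = carrier (quotient_via \<rho> M N)"
  "zero (graded_quotient_via \<rho> M N) = zero (quotient_via \<rho> M N)"
  "add (graded_quotient_via \<rho> M N) = add (quotient_via \<rho> M N)"
  "smult (graded_quotient_via \<rho> M N) = smult (quotient_via \<rho> M N)"
  "component (graded_quotient_via \<rho> M N) n = (\<lambda>x. N +>\<^bsub>M\<^esub> x) ` component M n"
  by (simp_all add: graded_quotient_via_def quotient_via_def module.extend_def graded_module.fields_def)

text \<open>A linear map \<open>val\<close> with kernel \<open>N\<close> descends to an embedding of
  the quotient. For the grading, it is enough that each form has some preimage under \<rho> acting
  with the right degree.\<close>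

locale quotient_embedding = module_quotient G N \<rho> + vs: vector_space sc
  for G :: "('r, 'm) graded_module" (structure) and N and \<rho> :: "'r \<Rightarrow> (2, 'k::field) mpol"
    and sc :: "(2, 'k) mpol fract \<Rightarrow> 'v::ab_group_add \<Rightarrow> 'v" +
  fixes val :: "'m \<Rightarrow> 'v"
  assumes val_add: "x \<in> carrier G \<Longrightarrow> y \<in> carrier G \<Longrightarrow> val (x \<oplus> y) = val x + val y"
    and val_smult: "x \<in> carrier G \<Longrightarrow> val (r \<odot> x) = sc (to_fract (\<rho> r)) (val x)"
    and val_0_iff: "x \<in> carrier G \<Longrightarrow> val x = 0 \<longleftrightarrow> x \<in> N"
    and G_comp_sub: "x \<in> component G n \<Longrightarrow> x \<in> carrier G"
    and G_comp_add: "x \<in> component G n \<Longrightarrow> y \<in> component G n \<Longrightarrow> x \<oplus> y \<in> component G n"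
    and G_comp_zero: "\<zero> \<in> component G n"
    and G_comp_smult: "x \<in> component G n \<Longrightarrow> homog k f \<Longrightarrow> \<exists>r. \<rho> r = f \<and> r \<odot> x \<in> component G (n + k)"
begin

definition \<iota> :: "'m set \<Rightarrow> 'v" where
  "\<iota> X = val (SOME x. x \<in> X)"

abbreviation M where "M \<equiv> graded_quotient_via \<rho> G N"

lemma val_cong: "x \<in> carrier G \<Longrightarrow> y \<in> carrier G \<Longrightarrow> N +> x = N +> y \<longleftrightarrow> val x = val y"
proof -
  assume x: "x \<in> carrier G" and y: "y \<in> carrier G"
  have "x = (x \<ominus> y) \<oplus> y" using x y by (simp add: a_minus_def a_assoc l_neg)
  then have "val x = val ((x \<ominus> y) \<oplus> y)" by (rule arg_cong)
  also have "\<dots> = val (x \<ominus> y) + val y" using x y by (simp add: val_add)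
  finally have "val x = val y \<longleftrightarrow> val (x \<ominus> y) = 0" by simp
  then show ?thesis using x y by (simp add: coset_eq_iff val_0_iff)
qed

lemma \<iota>_coset: "x \<in> carrier G \<Longrightarrow> \<iota> (N +> x) = val x"
proof -
  assume x: "x \<in> carrier G"
  define x' where "x' = (SOME x'. x' \<in> N +> x)"
  have x': "x' \<in> N +> x" unfolding x'_def by (rule someI[of _ x]) (rule a_rcos_self[OF x])
  have x'G: "x' \<in> carrier G" by (rule mem_coset_carrier[OF x' x])
  have "N +> x = N +> x'" using a_repr_independence[OF x' x a_subgroup] .
  then have "val x = val x'" using val_cong[OF x x'G] by simp
  then show ?thesis by (simp add: \<iota>_def x'_def)
qed

lemma M_simps: "carrier M = (\<lambda>x. N +> x) ` carrier G" "zero M = N +> \<zero>"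
  "component M n = (\<lambda>x. N +> x) ` component G n"
  by (simp_all add: graded_quotient_via_simps quot_carrier quot_zero)

lemma M_add: "x \<in> carrier G \<Longrightarrow> y \<in> carrier G \<Longrightarrow> (N +> x) \<oplus>\<^bsub>M\<^esub> (N +> y) = N +> (x \<oplus> y)"
  by (simp add: graded_quotient_via_simps quot_add)

lemma M_smult: "x \<in> carrier G \<Longrightarrow> \<rho> r = s \<Longrightarrow> s \<odot>\<^bsub>M\<^esub> (N +> x) = N +> (r \<odot> x)"
  by (simp add: graded_quotient_via_simps quot_smult)

lemma emb: "emb_module sc M \<iota>"
proof
  show "x \<in> carrier M" if "x \<in> component M n" for x n
    using that G_comp_sub by (auto simp: M_simps)
  show "x \<oplus>\<^bsub>M\<^esub> y \<in> component M n" if "x \<in> component M n" "y \<in> component M n" for x y n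
    using that G_comp_add G_comp_sub by (auto simp: M_simps M_add)
  show "\<zero>\<^bsub>M\<^esub> \<in> component M n" for n using G_comp_zero by (auto simp: M_simps)
  show "f \<odot>\<^bsub>M\<^esub> x \<in> component M (n + k)" if x: "x \<in> component M n" and f: "homog k f" for x n k f
  proof -
    obtain y where y: "y \<in> component G n" "x = N +> y" using x by (auto simp: M_simps)
    obtain r where r: "\<rho> r = f" "r \<odot> y \<in> component G (n + k)" using G_comp_smult[OF y(1) f] by blast
    have "f \<odot>\<^bsub>M\<^esub> x = N +> (r \<odot> y)" unfolding y(2) by (rule M_smult[OF G_comp_sub[OF y(1)] r(1)])
    then show ?thesis using r(2) by (auto simp: M_simps)
  qed
  show "x \<oplus>\<^bsub>M\<^esub> y \<in> carrier M" if "x \<in> carrier M" "y \<in> carrier M" for x y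
    using that by (auto simp: M_simps M_add)
  show "f \<odot>\<^bsub>M\<^esub> x \<in> carrier M" if x: "x \<in> carrier M" for x f
  proof -
    obtain y where y: "y \<in> carrier G" "x = N +> y" using x by (auto simp: M_simps)
    obtain r where r: "\<rho> r = f" using surj by blast
    have "f \<odot>\<^bsub>M\<^esub> x = N +> (r \<odot> y)" unfolding y(2) by (rule M_smult[OF y(1) r])
    then show ?thesis using smult_closed[OF y(1)] by (auto simp: M_simps)
  qed
  show "\<iota> (x \<oplus>\<^bsub>M\<^esub> y) = \<iota> x + \<iota> y" if "x \<in> carrier M" "y \<in> carrier M" for x y
    using that by (auto simp: M_simps M_add \<iota>_coset val_add)
  show "\<iota> (f \<odot>\<^bsub>M\<^esub> x) = sc (to_fract f) (\<iota> x)" if x: "x \<in> carrier M" for x f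
  proof -
    obtain y where y: "y \<in> carrier G" "x = N +> y" using x by (auto simp: M_simps)
    obtain r where r: "\<rho> r = f" using surj by blast
    have "f \<odot>\<^bsub>M\<^esub> x = N +> (r \<odot> y)" unfolding y(2) by (rule M_smult[OF y(1) r])
    then show ?thesis using smult_closed[OF y(1)] by (simp add: \<iota>_coset y val_smult r)
  qed
  have "val \<zero> = 0" using val_0_iff[OF zero_closed] additive_subgroup.zero_closed[OF N] by simp
  then show "\<iota> \<zero>\<^bsub>M\<^esub> = 0" by (simp add: M_simps \<iota>_coset)
  show "inj_on \<iota> (carrier M)"
  proof (rule inj_onI)
    fix X Y assume "X \<in> carrier M" "Y \<in> carrier M" and eq: "\<iota> X = \<iota> Y"
    then obtain x y where x: "x \<in> carrier G" "X = N +> x" and y: "y \<in> carrier G" "Y = N +> y"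
      unfolding M_simps by blast
    have "val x = val y" using eq by (simp only: x(2) y(2) \<iota>_coset[OF x(1)] \<iota>_coset[OF y(1)])
    then show "X = Y" unfolding x(2) y(2) val_cong[OF x(1) y(1)] .
  qed
qed

end

lemma der_module_simps: "carrier (der_module N) = N" "zero (der_module N) = (\<lambda>f. 0)"
  "add (der_module N) \<theta> \<eta> = (\<lambda>f. \<theta> f + \<eta> f)" "smult (der_module N) r \<theta> = (\<lambda>f. r * \<theta> f)"
  "component (der_module N) n = {\<theta> \<in> N. \<forall>i. homog n (\<theta> (Var i))}"
  by (simp_all add: der_module_def)

locale der_submodule =
  fixes X :: "(('n::finite, 'k::comm_ring_1) mpol \<Rightarrow> ('n, 'k) mpol) set"
  assumes X_zero: "(\<lambda>f. 0) \<in> X" and X_plus: "\<theta> \<in> X \<Longrightarrow> \<eta> \<in> X \<Longrightarrow> (\<lambda>f. \<theta> f + \<eta> f) \<in> X"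
    and X_times: "\<theta> \<in> X \<Longrightarrow> (\<lambda>f. r * \<theta> f) \<in> X"
begin

lemma X_neg: "\<theta> \<in> X \<Longrightarrow> (\<lambda>f. - \<theta> f) \<in> X"
  using X_times[of \<theta> "- 1"] by simp

lemma abelian: "abelian_group (der_module X)"
proof (rule abelian_groupI; simp only: der_module_simps)
  show "\<exists>\<eta>\<in>X. (\<lambda>f. \<eta> f + \<theta> f) = (\<lambda>f. 0)" if "\<theta> \<in> X" for \<theta>
    by (rule bexI[OF _ X_neg[OF that]]) simp
qed (auto intro: X_zero X_plus simp: add_ac)

lemma minus: "\<theta> \<in> X \<Longrightarrow> \<eta> \<in> X \<Longrightarrow> \<theta> \<ominus>\<^bsub>der_module X\<^esub> \<eta> = (\<lambda>f. \<theta> f - \<eta> f)"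
proof -
  interpret abelian_group "der_module X" by (rule abelian)
  assume "\<theta> \<in> X" "\<eta> \<in> X"
  then have "\<ominus>\<^bsub>der_module X\<^esub> \<eta> = (\<lambda>f. - \<eta> f)"
    using X_neg by (intro minus_equality) (simp_all add: der_module_simps)
  then show ?thesis by (simp add: a_minus_def der_module_simps)
qed

lemma submodule_additive:
  assumes "N \<subseteq> X" "(\<lambda>f. 0) \<in> N" "\<And>\<theta> \<eta>. \<theta> \<in> N \<Longrightarrow> \<eta> \<in> N \<Longrightarrow> (\<lambda>f. \<theta> f + \<eta> f) \<in> N"
    and neg: "\<And>\<theta>. \<theta> \<in> N \<Longrightarrow> (\<lambda>f. - \<theta> f) \<in> N"
  shows "additive_subgroup N (der_module X)"
proof -
  interpret abelian_group "der_module X" by (rule abelian)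
  have m: "\<ominus>\<^bsub>der_module X\<^esub> \<theta> = (\<lambda>f. - \<theta> f)" if "\<theta> \<in> N" for \<theta>
    using assms(1) neg that by (intro minus_equality) (auto simp: der_module_simps)
  show ?thesis
    unfolding additive_subgroup_def
    by (rule add.subgroupI) (use assms m in \<open>auto simp: der_module_simps\<close>)
qed

end

lemma vector_space_mult: "vector_space ((*) :: 'a::field \<Rightarrow> 'a \<Rightarrow> 'a)"
  by standard (simp_all add: algebra_simps)

definition pair_scale :: "'a::field \<Rightarrow> 'a \<times> 'a \<Rightarrow> 'a \<times> 'a" where
  "pair_scale c x = (c * fst x, c * snd x)"

lemma vector_space_pair: "vector_space pair_scale"
  by standard (simp_all add: pair_scale_def algebra_simps plus_prod_def)

lemma s_dvd_cancel_t: "s_var dvd t_var * f \<Longrightarrow> s_var dvd f" for f :: "(2, 'k::field) mpol"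
proof -
  assume "s_var dvd t_var * f"
  moreover have "\<not> s_var dvd (t_var :: (2, 'k) mpol)"
  proof
    assume "s_var dvd (t_var :: (2, 'k) mpol)"
    then obtain z where "t_var = (s_var * z :: (2, 'k) mpol)" by (rule dvdE)
    then have "Poly_Mapping.lookup (t_var :: (2, 'k) mpol) (bi 0 1) = 0"
      using lookup_Var_power_mult[of 0 1 z "bi 0 1"] by simp
    then show False using lookup_bi_monomial[of 0 1 0 1, where 'k = 'k] by simp
  qed
  ultimately show "s_var dvd f" using prime_elem_dvd_mult_iff[OF prime_elem_Var_2] by blast
qed

context arrangement_line
begin

lemma D0_submodule: "der_submodule (log_der0 Q)"
  by standard (auto simp: log_der0_def Der_zero Der_plus Der_times)

text \<open>The components along s and t of the derivation on L; they embed the restriction of the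
  rank two module D0 to L in F x F.\<close>

definition \<nu> :: "((3, 'k) mpol \<Rightarrow> (3, 'k) mpol) \<Rightarrow> (2, 'k) mpol fract \<times> (2, 'k) mpol fract" where
  "\<nu> \<theta> = (to_fract (res (\<theta> U)), to_fract (res (\<theta> V)))"

lemma D0_log: "\<theta> \<in> log_der0 Q \<Longrightarrow> \<theta> \<in> Der \<and> \<theta> Q = 0 \<and> \<alpha> dvd \<theta> \<alpha>"
  using log_dvd[of \<theta> L] L_in by (auto simp: log_der0_def)

lemma D0_comp: "component (D0 A) n = D0c n"
  by (auto simp: D0_def der_module_simps D0c_def log_der0_def)

lemma D0_carrier: "carrier (D0 A) = log_der0 Q"
  by (simp add: D0_def der_module_simps)

lemma alpha_multiples: "(\<lambda>x. \<alpha> \<odot>\<^bsub>D0 A\<^esub> x) ` carrier (D0 A) = {\<lambda>f. \<alpha> * \<psi> f | \<psi>. \<psi> \<in> log_der0 Q}"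
  by (auto simp: D0_def der_module_simps)

text \<open>A derivation of D0 preserves the ideal of L, so once these values vanish \<alpha>
  divides it. The quotient by \<alpha> still annihilates Q.\<close>

lemma \<nu>_0_iff:
  assumes "\<theta> \<in> log_der0 Q"
  shows "\<nu> \<theta> = 0 \<longleftrightarrow> \<theta> \<in> {\<lambda>f. \<alpha> * \<psi> f | \<psi>. \<psi> \<in> log_der0 Q}"
proof
  assume "\<nu> \<theta> = 0"
  then have uv: "res (\<theta> U) = 0" "res (\<theta> V) = 0" by (simp_all add: \<nu>_def zero_prod_def)
  have \<theta>: "\<theta> \<in> Der" "\<theta> Q = 0" "\<alpha> dvd \<theta> \<alpha>" using D0_log[OF assms] by simp_all
  obtain \<psi> where \<psi>: "\<psi> \<in> Der" "\<theta> = (\<lambda>f. \<alpha> * \<psi> f)"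
    by (rule Der_divide[OF \<theta>(1)]) (rule res_Der_eq_0[OF \<theta>(1,3) uv])
  have "\<alpha> * \<psi> Q = 0" using \<theta>(2) \<psi>(2) by simp
  then have "\<psi> Q = 0" using line_form_nonzero[OF line] by simp
  then have "\<psi> \<in> log_der0 Q" using \<psi>(1) by (simp add: log_der0_def)
  then show "\<theta> \<in> {\<lambda>f. \<alpha> * \<psi> f | \<psi>. \<psi> \<in> log_der0 Q}" using \<psi>(2) by blast
qed (auto simp: \<nu>_def res_simps res_\<alpha> zero_prod_def)

lemma restriction_embedding:
  "quotient_embedding (D0 A) ((\<lambda>x. \<alpha> \<odot>\<^bsub>D0 A\<^esub> x) ` carrier (D0 A)) res pair_scale \<nu>"
proof -
  interpret X: der_submodule "log_der0 Q" by (rule D0_submodule)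
  interpret vector_space "pair_scale :: (2, 'k) mpol fract \<Rightarrow> _" by (rule vector_space_pair)
  have mem: "\<theta> \<in> {\<lambda>f. \<alpha> * \<psi> f | \<psi>. \<psi> \<in> log_der0 Q}" if "\<psi> \<in> log_der0 Q" "\<theta> = (\<lambda>f. \<alpha> * \<psi> f)" for \<theta> \<psi>
    using that by blast
  have N: "additive_subgroup {\<lambda>f. \<alpha> * \<psi> f | \<psi>. \<psi> \<in> log_der0 Q} (der_module (log_der0 Q))"
  proof (rule X.submodule_additive)
    show "{\<lambda>f. \<alpha> * \<psi> f | \<psi>. \<psi> \<in> log_der0 Q} \<subseteq> log_der0 Q" using X.X_times by blast
    show "(\<lambda>f. 0) \<in> {\<lambda>f. \<alpha> * \<psi> f | \<psi>. \<psi> \<in> log_der0 Q}" using X.X_zero by force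
    show "(\<lambda>f. \<theta> f + \<eta> f) \<in> {\<lambda>f. \<alpha> * \<psi> f | \<psi>. \<psi> \<in> log_der0 Q}"
      if "\<theta> \<in> {\<lambda>f. \<alpha> * \<psi> f | \<psi>. \<psi> \<in> log_der0 Q}" "\<eta> \<in> {\<lambda>f. \<alpha> * \<psi> f | \<psi>. \<psi> \<in> log_der0 Q}" for \<theta> \<eta>
    proof -
      obtain \<psi> \<psi>' where "\<psi> \<in> log_der0 Q" "\<psi>' \<in> log_der0 Q" "\<theta> = (\<lambda>f. \<alpha> * \<psi> f)" "\<eta> = (\<lambda>f. \<alpha> * \<psi>' f)"
        using \<open>\<theta> \<in> _\<close> \<open>\<eta> \<in> _\<close> by blast
      then show ?thesis using X.X_plus[of \<psi> \<psi>'] by (auto simp: distrib_left[symmetric])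
    qed
    show "(\<lambda>f. - \<theta> f) \<in> {\<lambda>f. \<alpha> * \<psi> f | \<psi>. \<psi> \<in> log_der0 Q}"
      if "\<theta> \<in> {\<lambda>f. \<alpha> * \<psi> f | \<psi>. \<psi> \<in> log_der0 Q}" for \<theta>
    proof -
      obtain \<psi> where "\<psi> \<in> log_der0 Q" "\<theta> = (\<lambda>f. \<alpha> * \<psi> f)" using \<open>\<theta> \<in> _\<close> by blast
      then show ?thesis using X.X_neg[of \<psi>] by (auto simp: mult_minus_right[symmetric] simp del: mult_minus_right)
    qed
  qed
  show ?thesis
    unfolding alpha_multiples unfolding D0_def
  proof (intro quotient_embedding.intro module_quotient.intro quotient_embedding_axioms.intro)
    show "abelian_group (der_module (log_der0 Q))" by (rule X.abelian)
    show "additive_subgroup {\<lambda>f. \<alpha> * \<psi> f | \<psi>. \<psi> \<in> log_der0 Q} (der_module (log_der0 Q))" by (rule N)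
    show "vector_space (pair_scale :: (2, 'k) mpol fract \<Rightarrow> _)" by (rule vector_space_pair)
    show "\<exists>r. res r = s" for s using res_\<tau> by blast
    show "r \<odot>\<^bsub>der_module (log_der0 Q)\<^esub> x \<in> {\<lambda>f. \<alpha> * \<psi> f | \<psi>. \<psi> \<in> log_der0 Q}"
      if x: "x \<in> {\<lambda>f. \<alpha> * \<psi> f | \<psi>. \<psi> \<in> log_der0 Q}" for x r
    proof -
      obtain \<psi> where \<psi>: "\<psi> \<in> log_der0 Q" "x = (\<lambda>f. \<alpha> * \<psi> f)" using x by blast
      then have "r \<odot>\<^bsub>der_module (log_der0 Q)\<^esub> x = (\<lambda>f. \<alpha> * (r * \<psi> f))"
        by (simp add: der_module_simps mult.left_commute)
      then show ?thesis by (rule mem[OF X.X_times[OF \<psi>(1)]])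
    qed
    show "r \<odot>\<^bsub>der_module (log_der0 Q)\<^esub> x \<ominus>\<^bsub>der_module (log_der0 Q)\<^esub> r' \<odot>\<^bsub>der_module (log_der0 Q)\<^esub> x
        \<in> {\<lambda>f. \<alpha> * \<psi> f | \<psi>. \<psi> \<in> log_der0 Q}"
      if x: "x \<in> carrier (der_module (log_der0 Q))" and r: "res r = res r'" for x r r'
    proof -
      have x: "x \<in> log_der0 Q" using x by (simp add: der_module_simps)
      have "res (r - r') = 0" using r by (simp add: res_simps)
      then obtain z where z: "r - r' = \<alpha> * z" unfolding res_eq_0_iff by (rule dvdE)
      have "r \<odot>\<^bsub>der_module (log_der0 Q)\<^esub> x \<ominus>\<^bsub>der_module (log_der0 Q)\<^esub> r' \<odot>\<^bsub>der_module (log_der0 Q)\<^esub> x = (\<lambda>f. r * x f - r' * x f)"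
        using X.minus[OF X.X_times[OF x] X.X_times[OF x]] by (simp add: der_module_simps)
      also have "\<dots> = (\<lambda>f. \<alpha> * (z * x f))" by (simp only: left_diff_distrib[symmetric] z mult.assoc)
      finally show ?thesis by (rule mem[OF X.X_times[OF x]])
    qed
    show "\<nu> x = 0 \<longleftrightarrow> x \<in> {\<lambda>f. \<alpha> * \<psi> f | \<psi>. \<psi> \<in> log_der0 Q}"
      if "x \<in> carrier (der_module (log_der0 Q))" for x
      using that \<nu>_0_iff by (simp add: der_module_simps)
    show "\<exists>r. res r = f \<and> r \<odot>\<^bsub>der_module (log_der0 Q)\<^esub> x \<in> component (der_module (log_der0 Q)) (n + k)"
      if "x \<in> component (der_module (log_der0 Q)) n" "homog k f" for x n k f
    proof (intro exI conjI)
      have "homog (k + n) (\<tau> f * x (Var i))" for i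
        by (rule homog_mult[OF homog_\<tau>[OF that(2)]]) (use that(1) in \<open>simp add: der_module_simps\<close>)
      then show "\<tau> f \<odot>\<^bsub>der_module (log_der0 Q)\<^esub> x \<in> component (der_module (log_der0 Q)) (n + k)"
        using that(1) X.X_times by (simp add: der_module_simps add.commute[of n k])
    qed (rule res_\<tau>)
  qed (auto simp: der_module_simps \<nu>_def res_simps pair_scale_def plus_prod_def X.X_zero X.X_plus X.X_times distrib_left homog_add)
qed

lemma Q2_submodule: "der_submodule (log_der Q2)"
proof
  show "(\<lambda>f. 0) \<in> log_der Q2" by (simp add: log_der_def Der_zero)
  show "(\<lambda>f. \<theta> f + \<eta> f) \<in> log_der Q2" if "\<theta> \<in> log_der Q2" "\<eta> \<in> log_der Q2" for \<theta> \<eta>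
    using that by (auto simp: log_der_def Der_plus)
  show "(\<lambda>f. r * \<theta> f) \<in> log_der Q2" if "\<theta> \<in> log_der Q2" for \<theta> r
    using that by (auto simp: log_der_def Der_times)
qed

definition \<mu> :: "((2, 'k) mpol \<Rightarrow> (2, 'k) mpol) \<Rightarrow> (2, 'k) mpol fract" where
  "\<mu> \<eta> = to_fract (s_var * \<eta> t_var - t_var * \<eta> s_var)"

lemma euler_multiples_log: "(\<lambda>f. r * euler f) \<in> log_der Q2"
proof -
  have "euler Q2 = (\<Sum>P\<in>pts. 1) * Q2"
    unfolding Q2_eq
  proof (rule Der_prod[OF euler_Der finite_pts])
    fix P assume "P \<in> pts"
    then obtain H where "pf P = lin_form (\<beta> H)" using pf_line by (auto simp: res_line_form)
    then show "euler (pf P) = 1 * pf P" by (simp add: euler_lin_form)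
  qed
  then show ?thesis by (simp add: log_der_def Der_times[OF euler_Der])
qed

text \<open>The determinant vanishes when s (\<eta> t) = t (\<eta> s). As s and t are coprime, s
  divides \<eta> s, and the quotient is the Euler coefficient.\<close>

lemma \<mu>_0_iff:
  assumes "\<eta> \<in> Der"
  shows "\<mu> \<eta> = 0 \<longleftrightarrow> \<eta> \<in> euler_multiples"
proof
  assume "\<mu> \<eta> = 0"
  then have eq: "s_var * \<eta> t_var = t_var * \<eta> s_var" by (simp only: \<mu>_def to_fract_eq_0_iff) simp
  have "s_var dvd t_var * \<eta> s_var" unfolding eq[symmetric] by simp
  then have "s_var dvd \<eta> s_var" by (rule s_dvd_cancel_t)
  then obtain r where r: "\<eta> s_var = s_var * r" by (rule dvdE)
  have "s_var * \<eta> t_var = s_var * (t_var * r)" unfolding eq r by (rule mult.left_commute)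
  moreover have "s_var \<noteq> (0 :: (2, 'k) mpol)" using prime_elem_Var_2[of 0, where 'k = 'k] by (simp add: prime_elem_def)
  ultimately have t: "\<eta> t_var = t_var * r" by simp
  have "\<eta> = (\<lambda>f. r * euler f)"
  proof (rule Der_eqI[OF assms Der_times[OF euler_Der]])
    fix i :: 2 show "\<eta> (Var i) = r * euler (Var i)"
      using exhaust_2[of i] r t by (auto simp: mult.commute)
  qed
  then show "\<eta> \<in> euler_multiples" by (auto simp: euler_multiples_def)
qed (auto simp: euler_multiples_def \<mu>_def algebra_simps)

lemma euler_quotient_embedding:
  "quotient_embedding (der_module (log_der Q2)) euler_multiples id (*) \<mu>"
proof -
  interpret X: der_submodule "log_der Q2" by (rule Q2_submodule)
  have N: "additive_subgroup euler_multiples (der_module (log_der Q2))"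
  proof (rule X.submodule_additive)
    show "euler_multiples \<subseteq> log_der Q2" using euler_multiples_log by (auto simp: euler_multiples_def)
    have "(\<lambda>f. 0 * euler f) \<in> (euler_multiples :: ((2, 'k) mpol \<Rightarrow> _) set)" unfolding euler_multiples_def by blast
    then show "(\<lambda>f. 0) \<in> (euler_multiples :: ((2, 'k) mpol \<Rightarrow> _) set)" by simp
    show "(\<lambda>f. \<theta> f + \<eta> f) \<in> euler_multiples" if "\<theta> \<in> euler_multiples" "\<eta> \<in> euler_multiples" for \<theta> \<eta> :: "(2, 'k) mpol \<Rightarrow> _"
      using that unfolding euler_multiples_def by (auto simp: distrib_right[symmetric])
    show "(\<lambda>f. - \<theta> f) \<in> euler_multiples" if "\<theta> \<in> euler_multiples" for \<theta> :: "(2, 'k) mpol \<Rightarrow> _"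
      using that unfolding euler_multiples_def by (auto simp: mult_minus_left[symmetric] simp del: mult_minus_left)
  qed
  show ?thesis
  proof (intro quotient_embedding.intro module_quotient.intro quotient_embedding_axioms.intro)
    show "abelian_group (der_module (log_der Q2))" by (rule X.abelian)
    show "additive_subgroup euler_multiples (der_module (log_der Q2))" by (rule N)
    show "vector_space ((*) :: (2, 'k) mpol fract \<Rightarrow> _)" by (rule vector_space_mult)
    show "r \<odot>\<^bsub>der_module (log_der Q2)\<^esub> x \<in> euler_multiples" if "x \<in> euler_multiples" for x r
      using that unfolding euler_multiples_def by (auto simp: der_module_simps mult.assoc[symmetric])
    show "r \<odot>\<^bsub>der_module (log_der Q2)\<^esub> x \<ominus>\<^bsub>der_module (log_der Q2)\<^esub> r' \<odot>\<^bsub>der_module (log_der Q2)\<^esub> x \<in> euler_multiples"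
      if x: "x \<in> carrier (der_module (log_der Q2))" and r: "id r = id r'" for x r r'
    proof -
      have "x \<in> log_der Q2" using x by (simp add: der_module_simps)
      then have "r \<odot>\<^bsub>der_module (log_der Q2)\<^esub> x \<ominus>\<^bsub>der_module (log_der Q2)\<^esub> r' \<odot>\<^bsub>der_module (log_der Q2)\<^esub> x = (\<lambda>f. 0)"
        using X.minus[OF X.X_times X.X_times] r by (simp add: der_module_simps)
      then show ?thesis using additive_subgroup.zero_closed[OF N] by (simp add: der_module_simps)
    qed
    show "\<mu> x = 0 \<longleftrightarrow> x \<in> euler_multiples" if "x \<in> carrier (der_module (log_der Q2))" for x
      using that \<mu>_0_iff by (simp add: der_module_simps log_der_def)
    show "\<exists>r. id r = f \<and> r \<odot>\<^bsub>der_module (log_der Q2)\<^esub> x \<in> component (der_module (log_der Q2)) (n + k)"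
      if "x \<in> component (der_module (log_der Q2)) n" "homog k f" for x n k f
    proof (intro exI conjI)
      have "homog (k + n) (f * x (Var i))" for i
        by (rule homog_mult[OF that(2)]) (use that(1) in \<open>simp add: der_module_simps\<close>)
      then show "f \<odot>\<^bsub>der_module (log_der Q2)\<^esub> x \<in> component (der_module (log_der Q2)) (n + k)"
        using that(1) X.X_times by (simp add: der_module_simps add.commute[of n k])
    qed simp
    show "\<mu> (x \<oplus>\<^bsub>der_module (log_der Q2)\<^esub> y) = \<mu> x + \<mu> y" for x y
      unfolding \<mu>_def der_module_simps to_fract_add[symmetric] by (simp add: algebra_simps)
    show "\<mu> (r \<odot>\<^bsub>der_module (log_der Q2)\<^esub> x) = to_fract (id r) * \<mu> x" for r x
      unfolding \<mu>_def der_module_simps to_fract_mult[symmetric] id_apply by (simp only: right_diff_distrib mult.left_commute)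
  qed (auto simp: der_module_simps X.X_zero X.X_plus X.X_times distrib_left homog_add)
qed

end

section \<open>The sequence of a line of the arrangement\<close>

context arrangement_line
begin

sublocale MQ: quotient_embedding "D0 A" "(\<lambda>x. \<alpha> \<odot>\<^bsub>D0 A\<^esub> x) ` carrier (D0 A)" res pair_scale \<nu>
  by (rule restriction_embedding)

sublocale NQ: quotient_embedding "der_module (log_der Q2)" euler_multiples id "(*)" \<mu>
  by (rule euler_quotient_embedding)

definition cM where "cM \<theta> = ((\<lambda>x. \<alpha> \<odot>\<^bsub>D0 A\<^esub> x) ` carrier (D0 A)) +>\<^bsub>D0 A\<^esub> \<theta>"

definition cN where "cN \<eta> = euler_multiples +>\<^bsub>der_module (log_der Q2)\<^esub> \<eta>"

abbreviation "RM \<equiv> restrict_to_line L (D0 A)"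
abbreviation "RN \<equiv> D_restricted A L"

lemma RM_simps: "carrier RM = cM ` log_der0 Q" "component RM n = cM ` D0c n"
  unfolding restrict_to_line_def MQ.M_simps cM_def[abs_def] D0_comp by (simp_all only: D0_carrier)

lemma RN_simps: "carrier RN = cN ` log_der Q2"
  "component RN n = cN ` {\<eta> \<in> log_der Q2. \<forall>i. homog n (\<eta> (Var i))}"
  unfolding D_restricted_def NQ.M_simps by (simp_all add: cN_def[abs_def] der_module_simps)

lemma \<iota>_cM: "\<theta> \<in> log_der0 Q \<Longrightarrow> MQ.\<iota> (cM \<theta>) = \<nu> \<theta>"
  unfolding cM_def by (rule MQ.\<iota>_coset) (simp add: D0_carrier)

lemma \<iota>_cN: "\<eta> \<in> log_der Q2 \<Longrightarrow> NQ.\<iota> (cN \<eta>) = \<mu> \<eta>"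
  unfolding cN_def by (rule NQ.\<iota>_coset) (simp add: der_module_simps)

lemma cN_cong: "\<eta> \<in> log_der Q2 \<Longrightarrow> \<eta>' \<in> log_der Q2 \<Longrightarrow> cN \<eta> = cN \<eta>' \<longleftrightarrow> \<mu> \<eta> = \<mu> \<eta>'"
  unfolding cN_def by (rule NQ.val_cong) (simp_all add: der_module_simps)

lemma RN_smult: "\<eta> \<in> log_der Q2 \<Longrightarrow> f \<odot>\<^bsub>RN\<^esub> cN \<eta> = cN (\<lambda>g. f * \<eta> g)"
  unfolding cN_def D_restricted_def using NQ.M_smult[of \<eta> f f] by (simp add: der_module_simps)

lemma D0c_log: "\<theta> \<in> D0c n \<Longrightarrow> \<theta> \<in> log_der0 Q"
  by (simp add: D0c_def log_der0_def)

lemma dres_log0: "\<theta> \<in> log_der0 Q \<Longrightarrow> dres \<theta> \<in> log_der Q2"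
  using dres_log by (simp add: log_der0_def)

text \<open>The determinant with the Euler vector (s, t), as a linear form on F x F.\<close>

definition \<Phi> :: "(2, 'k) mpol fract \<times> (2, 'k) mpol fract \<Rightarrow> (2, 'k) mpol fract" where
  "\<Phi> x = to_fract s_var * snd x - to_fract t_var * fst x"

lemma \<mu>_dres: "\<mu> (dres \<theta>) = \<Phi> (\<nu> \<theta>)"
  by (simp add: \<mu>_def \<Phi>_def \<nu>_def dres_s dres_t)

text \<open>\<open>res_map\<close> unites the images of all representatives of a coset; these have
  the same value under \<nu>, hence the same determinant and the same class.\<close>

lemma res_map_cM:
  assumes \<theta>: "\<theta> \<in> log_der0 Q"
  shows "res_map A L (cM \<theta>) = cN (dres \<theta>)"
proof -
  have G: "\<theta> \<in> carrier (D0 A)" using \<theta> by (simp add: D0_carrier)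
  have *: "euler_multiples +>\<^bsub>der_module (log_der Q2)\<^esub> res_der L \<theta>' = cN (dres \<theta>)" if \<theta>': "\<theta>' \<in> cM \<theta>" for \<theta>'
  proof -
    have G': "\<theta>' \<in> carrier (D0 A)" using MQ.mem_coset_carrier[OF \<theta>'[unfolded cM_def] G] .
    then have l': "\<theta>' \<in> log_der0 Q" by (simp add: D0_carrier)
    have "\<nu> \<theta> = \<nu> \<theta>'"
      using MQ.val_cong[OF G G'] MQ.a_repr_independence[OF \<theta>'[unfolded cM_def] G MQ.a_subgroup] by simp
    then have "cN (dres \<theta>') = cN (dres \<theta>)"
      using cN_cong[OF dres_log0[OF l'] dres_log0[OF \<theta>]] by (simp add: \<mu>_dres)
    moreover have "res_der L \<theta>' = dres \<theta>'" using D0_log[OF l'] by (simp add: res_der_eq)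
    ultimately show ?thesis by (simp add: cN_def)
  qed
  have "\<theta> \<in> cM \<theta>" unfolding cM_def by (rule MQ.a_rcos_self[OF G])
  then show ?thesis unfolding res_map_def by (intro Union_const) (use * in auto)
qed

lemma onto_restriction_form:
  assumes g: "homog (n + 1 - h) g"
  shows "\<exists>N. \<exists>\<theta>\<in>D0c (n + int N). \<mu> (dres \<theta>) = to_fract (Q2 * (Var i ^ N * g))"
proof -
  obtain N \<theta> where \<theta>: "\<theta> \<in> D0c (int N + (h - 1))" "s_var * res (\<theta> V) - t_var * res (\<theta> U) = Q2 * Var i ^ N"
    using D0_onto_restriction[of i] by blast
  have "(\<lambda>f. \<tau> g * \<theta> f) \<in> D0c (n + 1 - h + (int N + (h - 1)))" by (rule D0c_mult[OF \<theta>(1) homog_\<tau>[OF g]])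
  then have 1: "(\<lambda>f. \<tau> g * \<theta> f) \<in> D0c (n + int N)" by (simp add: algebra_simps)
  have "s_var * (g * res (\<theta> V)) - t_var * (g * res (\<theta> U)) = g * (s_var * res (\<theta> V) - t_var * res (\<theta> U))"
    by (simp only: right_diff_distrib mult.left_commute)
  also have "\<dots> = Q2 * (Var i ^ N * g)" unfolding \<theta>(2) by (simp only: mult_ac)
  finally have "\<mu> (dres (\<lambda>f. \<tau> g * \<theta> f)) = to_fract (Q2 * (Var i ^ N * g))"
    unfolding \<mu>_def dres_s dres_t res_simps res_\<tau> by (rule arg_cong)
  then show ?thesis using 1 by blast
qed

lemma \<mu>_form:
  assumes \<eta>: "\<eta> \<in> log_der Q2" "\<And>i. homog n (\<eta> (Var i))"
  shows "\<exists>g. homog (n + 1 - h) g \<and> \<mu> \<eta> = to_fract (Q2 * g)"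
proof -
  obtain g where g: "s_var * \<eta> t_var - t_var * \<eta> s_var = Q2 * g"
    using Q2_dvd_determinant[of \<eta>] \<eta>(1) unfolding log_der_def by (auto elim: dvdE)
  have "homog (1 + n) (s_var * \<eta> t_var - t_var * \<eta> s_var)"
    by (intro homog_diff homog_mult homog_Var \<eta>(2))
  then have "homog ((n + 1 - h) + h) (Q2 * g)" unfolding g by (simp add: add.commute)
  then have "homog (n + 1 - h) g" by (rule homog_mult_cancel[OF homog_Q2 Q2_nonzero])
  moreover have "\<mu> \<eta> = to_fract (Q2 * g)" unfolding \<mu>_def g ..
  ultimately show ?thesis by (intro exI conjI)
qed

lemma dres_homog:
  assumes "\<theta> \<in> D0c n"
  shows "homog n (dres \<theta> (Var j))"
  unfolding dres_def by (rule homog_res)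
    (use homog_Der_lin_form[OF D0c_D(1)[OF assms] D0c_D(3)[OF assms]] in \<open>simp add: \<tau>_def U_def V_def\<close>)

text \<open>Degree: the determinant of a derivation of degree n with Euler has degree n + 1, and
  dividing by Q'' lowers it by h.\<close>

sublocale NN: line_bundle RN NQ.\<iota> Q2 "1 - h"
proof (intro line_bundle.intro line_bundle_axioms.intro)
  show "emb_module (*) RN NQ.\<iota>" unfolding D_restricted_def by (rule NQ.emb)
  show "Q2 \<noteq> 0" by (rule Q2_nonzero)
  show "\<exists>g. homog (n + (1 - h)) g \<and> NQ.\<iota> m = to_fract (Q2 * g)" if m: "m \<in> component RN n" for m n
  proof -
    obtain \<eta> where \<eta>: "\<eta> \<in> log_der Q2" "\<And>i. homog n (\<eta> (Var i))" "m = cN \<eta>" using m unfolding RN_simps by blast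
    show ?thesis using \<mu>_form[OF \<eta>(1,2)] unfolding \<eta>(3) \<iota>_cN[OF \<eta>(1)] by (simp add: add_diff_eq)
  qed
  show "\<exists>N. \<exists>m\<in>component RN (n + int N). NQ.\<iota> m = to_fract (Q2 * (f ^ N * g))"
    if g: "homog (n + (1 - h)) g" and f: "f = s_var \<or> f = t_var" for n g f
  proof -
    obtain i where i: "f = Var i" using f by blast
    obtain N \<theta> where \<theta>: "\<theta> \<in> D0c (n + int N)" "\<mu> (dres \<theta>) = to_fract (Q2 * (f ^ N * g))"
      using onto_restriction_form[of n g i] g unfolding i by (auto simp: add_diff_eq)
    have l: "dres \<theta> \<in> log_der Q2" by (rule dres_log0[OF D0c_log[OF \<theta>(1)]])
    then have "cN (dres \<theta>) \<in> component RN (n + int N)" unfolding RN_simps using dres_homog[OF \<theta>(1)] by blast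
    moreover have "NQ.\<iota> (cN (dres \<theta>)) = to_fract (Q2 * (f ^ N * g))" unfolding \<iota>_cN[OF l] by (rule \<theta>(2))
    ultimately show ?thesis by blast
  qed
qed

sublocale E: emb_epi pair_scale RM MQ.\<iota> "(*)" RN NQ.\<iota> "res_map A L" \<Phi>
proof (intro emb_epi.intro emb_epi_axioms.intro)
  show "emb_module pair_scale RM MQ.\<iota>" unfolding restrict_to_line_def by (rule MQ.emb)
  show "emb_module (*) RN NQ.\<iota>" unfolding D_restricted_def by (rule NQ.emb)
  show "res_map A L m \<in> carrier RN" if m: "m \<in> carrier RM" for m
  proof -
    obtain \<theta> where \<theta>: "\<theta> \<in> log_der0 Q" "m = cM \<theta>" using m unfolding RM_simps by blast
    show ?thesis unfolding \<theta>(2) res_map_cM[OF \<theta>(1)] RN_simps by (rule imageI[OF dres_log0[OF \<theta>(1)]])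
  qed
  show "res_map A L m \<in> component RN n" if m: "m \<in> component RM n" for m n
  proof -
    obtain \<theta> where \<theta>: "\<theta> \<in> D0c n" "m = cM \<theta>" using m unfolding RM_simps by blast
    have "dres \<theta> \<in> {\<eta> \<in> log_der Q2. \<forall>i. homog n (\<eta> (Var i))}"
      using dres_log0[OF D0c_log[OF \<theta>(1)]] dres_homog[OF \<theta>(1)] by simp
    then show ?thesis unfolding \<theta>(2) res_map_cM[OF D0c_log[OF \<theta>(1)]] RN_simps by (rule imageI)
  qed
  show "\<Phi> (x + y) = \<Phi> x + \<Phi> y" for x y by (simp add: \<Phi>_def plus_prod_def algebra_simps)
  show "\<Phi> (pair_scale a x) = a * \<Phi> x" for a x 
    by (simp only: \<Phi>_def pair_scale_def fst_conv snd_conv right_diff_distrib mult.left_commute)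
  show "NQ.\<iota> (res_map A L m) = \<Phi> (MQ.\<iota> m)" if m: "m \<in> carrier RM" for m
  proof -
    obtain \<theta> where \<theta>: "\<theta> \<in> log_der0 Q" "m = cM \<theta>" using m unfolding RM_simps by blast
    show ?thesis unfolding \<theta>(2) res_map_cM[OF \<theta>(1)] \<iota>_cN[OF dres_log0[OF \<theta>(1)]] \<iota>_cM[OF \<theta>(1)] by (rule \<mu>_dres)
  qed
  \<comment> \<open>Classes in D(A'') modulo Euler are told apart by their determinants, so it
    suffices to attain the determinant of \<open>f ^ N\<close> times the given class.\<close>
  show "\<exists>N m. m \<in> component RM (n + int N) \<and> res_map A L m = f ^ N \<odot>\<^bsub>RN\<^esub> m2"
    if m2: "m2 \<in> component RN n" and f: "f = s_var \<or> f = t_var" for m2 n f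
  proof -
    obtain i where i: "f = Var i" using f by blast
    obtain \<eta> where \<eta>: "\<eta> \<in> log_der Q2" "\<And>i. homog n (\<eta> (Var i))" "m2 = cN \<eta>" using m2 unfolding RN_simps by blast
    obtain g where g: "homog (n + 1 - h) g" "\<mu> \<eta> = to_fract (Q2 * g)" using \<mu>_form[OF \<eta>(1,2)] by blast
    obtain N \<theta> where \<theta>: "\<theta> \<in> D0c (n + int N)" "\<mu> (dres \<theta>) = to_fract (Q2 * (f ^ N * g))"
      using onto_restriction_form[OF g(1), of i] unfolding i by blast
    have l: "dres \<theta> \<in> log_der Q2" "(\<lambda>g. f ^ N * \<eta> g) \<in> log_der Q2"
      using dres_log0[OF D0c_log[OF \<theta>(1)]] der_submodule.X_times[OF Q2_submodule \<eta>(1)] by simp_all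
    have "\<mu> (\<lambda>g. f ^ N * \<eta> g) = to_fract (f ^ N) * \<mu> \<eta>"
      unfolding \<mu>_def to_fract_mult[symmetric] by (simp only: right_diff_distrib mult.left_commute)
    also have "\<dots> = \<mu> (dres \<theta>)" unfolding g(2) \<theta>(2) to_fract_mult[symmetric] by (simp only: mult_ac)
    finally have "cN (dres \<theta>) = cN (\<lambda>g. f ^ N * \<eta> g)" unfolding cN_cong[OF l] by simp
    then have "res_map A L (cM \<theta>) = f ^ N \<odot>\<^bsub>RN\<^esub> m2"
      unfolding res_map_cM[OF D0c_log[OF \<theta>(1)]] \<eta>(3) RN_smult[OF \<eta>(1)] .
    moreover have "cM \<theta> \<in> component RM (n + int N)" unfolding RM_simps by (rule imageI[OF \<theta>(1)])
    ultimately show ?thesis by blast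
  qed
qed

abbreviation "RK \<equiv> res_kernel A L"

text \<open>In the kernel the pair of values is a multiple r (s, t) of the Euler vector; this reads
  off r.\<close>

definition \<kappa> where "\<kappa> X = fst (MQ.\<iota> X) / to_fract s_var"

lemma RK_simps: "carrier RK = cM ` {\<theta> \<in> log_der0 Q. \<Phi> (\<nu> \<theta>) = 0}" "component RK n = cM ` {\<theta> \<in> D0c n. \<Phi> (\<nu> \<theta>) = 0}"
  unfolding res_kernel_def E.K_simps RM_simps using \<iota>_cM[OF D0c_log] by (auto simp: \<iota>_cM)

text \<open>Coprimality of s and t makes r a polynomial. It has degree n - 1, and dividing by B, of
  degree d - 1 - h, leaves n + h - d.\<close>

lemma kernel_form:
  assumes \<theta>: "\<theta> \<in> D0c n" "\<Phi> (\<nu> \<theta>) = 0"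
  shows "\<exists>g. homog (n + (h - d)) g \<and> fst (\<nu> \<theta>) / to_fract s_var = to_fract (B * g)"
proof -
  have nz: "to_fract s_var \<noteq> (0 :: (2, 'k) mpol fract)" "s_var \<noteq> (0 :: (2, 'k) mpol)"
    using NN.s_t_nonzero by simp_all
  have "to_fract (s_var * res (\<theta> V) - t_var * res (\<theta> U)) = 0" using \<theta>(2) by (simp add: \<Phi>_def \<nu>_def)
  then have eq: "s_var * res (\<theta> V) = t_var * res (\<theta> U)" unfolding to_fract_eq_0_iff by simp
  have "s_var dvd t_var * res (\<theta> U)" unfolding eq[symmetric] by simp
  then have "s_var dvd res (\<theta> U)" by (rule s_dvd_cancel_t)
  then obtain r where r: "res (\<theta> U) = s_var * r" by (rule dvdE)
  have "s_var * res (\<theta> V) = s_var * (t_var * r)" unfolding eq r by (rule mult.left_commute)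
  then have r': "res (\<theta> V) = t_var * r" using nz by simp
  have "B dvd r" by (rule B_dvd_kernel[OF D0c_D(1,2)[OF \<theta>(1)]]) (simp_all only: r r' mult.commute)
  then obtain g where g: "r = B * g" by (rule dvdE)
  have U: "homog n (\<theta> U)" unfolding U_def by (rule homog_Der_lin_form[OF D0c_D(1)[OF \<theta>(1)] D0c_D(3)[OF \<theta>(1)]])
  have "homog (n - 1 + 1) (s_var * r)" using homog_res[OF U] unfolding r by simp
  then have "homog (n - 1) r" by (rule homog_mult_cancel[OF homog_Var nz(2)])
  then have "homog (n + (h - d) + (d - 1 - h)) (B * g)" unfolding g by (simp add: algebra_simps)
  then have "homog (n + (h - d)) g" by (rule homog_mult_cancel[OF homog_B B_nonzero])
  moreover have "fst (\<nu> \<theta>) / to_fract s_var = to_fract (B * g)" using nz by (simp add: \<nu>_def r g)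
  ultimately show ?thesis by blast
qed

sublocale KK: line_bundle RK \<kappa> B "h - d"
proof (intro line_bundle.intro line_bundle_axioms.intro)
  have nz: "to_fract s_var \<noteq> (0 :: (2, 'k) mpol fract)" using NN.s_t_nonzero by simp
  have inj: "inj_on \<kappa> (carrier RK)"
  proof (rule inj_onI)
    fix X Y assume X: "X \<in> carrier RK" and Y: "Y \<in> carrier RK" and eq: "\<kappa> X = \<kappa> Y"
    have fst: "fst (MQ.\<iota> X) = fst (MQ.\<iota> Y)" using eq nz by (simp add: \<kappa>_def)
    have "\<Phi> (MQ.\<iota> X) = 0" "\<Phi> (MQ.\<iota> Y) = 0" using X Y by (simp_all add: res_kernel_def E.K_simps)
    then have "to_fract s_var * snd (MQ.\<iota> X) = to_fract s_var * snd (MQ.\<iota> Y)" by (simp add: \<Phi>_def fst)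
    then have "MQ.\<iota> X = MQ.\<iota> Y" using nz fst unfolding mult_left_cancel[OF nz] by (simp only: prod_eq_iff)
    then show "X = Y" using X Y E.K.\<iota>_inj by (simp add: res_kernel_def inj_on_eq_iff)
  qed
  interpret vector_space "(*) :: (2, 'k) mpol fract \<Rightarrow> _" by (rule vector_space_mult)
  show "emb_module (*) RK \<kappa>"
    using inj by (unfold_locales; unfold res_kernel_def)
      (simp_all add: \<kappa>_def E.K.comp_sub E.K.comp_add E.K.comp_zero E.K.comp_smult E.K.carrier_add E.K.carrier_smult
        E.K.\<iota>_add E.K.\<iota>_smult E.K.\<iota>_zero pair_scale_def plus_prod_def zero_prod_def add_divide_distrib)
  show "B \<noteq> 0" by (rule B_nonzero)
  show "\<exists>g. homog (n + (h - d)) g \<and> \<kappa> m = to_fract (B * g)" if m: "m \<in> component RK n" for m n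
  proof -
    obtain \<theta> where \<theta>: "\<theta> \<in> D0c n" "\<Phi> (\<nu> \<theta>) = 0" "m = cM \<theta>" using m unfolding RK_simps by blast
    show ?thesis unfolding \<theta>(3) \<kappa>_def \<iota>_cM[OF D0c_log[OF \<theta>(1)]] by (rule kernel_form[OF \<theta>(1,2)])
  qed
  show "\<exists>N. \<exists>m\<in>component RK (n + int N). \<kappa> m = to_fract (B * (f ^ N * g))"
    if g: "homog (n + (h - d)) g" and f: "f = s_var \<or> f = t_var" for n g f
  proof -
    obtain i where i: "f = Var i" using f by blast
    obtain N \<theta> where \<theta>: "\<theta> \<in> D0c (int N + (d - h))"
      "res (\<theta> U) = (B * Var i ^ N) * s_var" "res (\<theta> V) = (B * Var i ^ N) * t_var"
      using D0_kernel_locally[of i] by blast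
    have "(\<lambda>f. \<tau> g * \<theta> f) \<in> D0c (n + (h - d) + (int N + (d - h)))" by (rule D0c_mult[OF \<theta>(1) homog_\<tau>[OF g]])
    then have 1: "(\<lambda>f. \<tau> g * \<theta> f) \<in> D0c (n + int N)" by (simp add: algebra_simps)
    have uv: "\<nu> (\<lambda>f. \<tau> g * \<theta> f) = (to_fract (B * (f ^ N * g)) * to_fract s_var, to_fract (B * (f ^ N * g)) * to_fract t_var)"
    proof -
      have *: "g * ((B * Var i ^ N) * x) = B * (Var i ^ N * g) * x" for x by (simp only: mult_ac)
      show ?thesis unfolding \<nu>_def res_simps res_\<tau> \<theta>(2,3) i * by (simp only: to_fract_mult)
    qed
    then have "\<Phi> (\<nu> (\<lambda>f. \<tau> g * \<theta> f)) = 0" by (simp only: \<Phi>_def fst_conv snd_conv mult.left_commute mult.commute diff_self)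
    with 1 have "cM (\<lambda>f. \<tau> g * \<theta> f) \<in> component RK (n + int N)" unfolding RK_simps by blast
    moreover have "\<kappa> (cM (\<lambda>f. \<tau> g * \<theta> f)) = to_fract (B * (f ^ N * g))"
      unfolding \<kappa>_def \<iota>_cM[OF D0c_log[OF 1]] uv fst_conv using nz by (rule nonzero_mult_div_cancel_right)
    ultimately show ?thesis by blast
  qed
qed

lemmas sequence_H0 = E.H0_nonzero_iff[folded res_kernel_def, unfolded KK.H0_nonzero_iff_degree]

lemmas connecting_linear = E.connecting_linear[folded res_kernel_def]

lemma jump_line_iff:
  "L \<in> jump_lines A \<longleftrightarrow> 0 \<le> twist_D A - 1 + (h - d) \<or>
     (\<exists>c\<in>carrier (alpha_source A L). c \<noteq> \<zero>\<^bsub>alpha_source A L\<^esub> \<and> alpha_map A L c = \<zero>\<^bsub>alpha_target A L\<^esub>)"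
proof -
  have "L \<in> jump_lines A \<longleftrightarrow> carrier (H0 RM (twist_D A - 1)) \<noteq> {\<zero>\<^bsub>H0 RM (twist_D A - 1)\<^esub>}"
    unfolding jump_lines_def Let_def mem_Collect_eq by (simp only: line simp_thms)
  then show ?thesis unfolding alpha_source_def alpha_map_def alpha_target_def by (rule trans[OF _ sequence_H0])
qed

lemma alpha_source_basis: "\<exists>v. ordered_basis (alpha_source A L) (nat (twist_D A - h + 1)) v"
  using NN.H0_basis[of "twist_D A - 1"] by (simp add: alpha_source_def algebra_simps)

lemma alpha_target_basis: "\<exists>v. ordered_basis (alpha_target A L) (nat (d - h - twist_D A)) v"
  using KK.H1_basis[of "twist_D A - 1"] by (simp add: alpha_target_def algebra_simps)

text \<open>The assumption equates the dimensions before truncation. If the common number is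
  negative, both spaces are zero, the determinant is 1, and both sides are false.\<close>

lemma alpha_det_vanishes_iff:
  assumes "twist_D A - h + 1 = d - h - twist_D A"
  shows "det_vanishes (alpha_source A L) (alpha_target A L) (alpha_map A L) \<longleftrightarrow>
    (\<exists>c\<in>carrier (alpha_source A L). c \<noteq> \<zero>\<^bsub>alpha_source A L\<^esub> \<and> alpha_map A L c = \<zero>\<^bsub>alpha_target A L\<^esub>)"
proof -
  obtain v where v: "ordered_basis (alpha_source A L) (nat (twist_D A - h + 1)) v" using alpha_source_basis by (rule exE)
  obtain w where w: "ordered_basis (alpha_target A L) (nat (twist_D A - h + 1)) w"
    using alpha_target_basis unfolding assms[symmetric] by (rule exE)
  show ?thesis unfolding alpha_source_def alpha_map_def alpha_target_def
    by (rule kmod_image_map.det_vanishes_iff[OF connecting_linear v[unfolded alpha_source_def] w[unfolded alpha_target_def]])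
qed

lemma alpha_rank_less_iff:
  "lin_rank (alpha_target A L) (alpha_map A L) (alpha_source A L) < nat (twist_D A - h + 1) \<longleftrightarrow>
    (\<exists>c\<in>carrier (alpha_source A L). c \<noteq> \<zero>\<^bsub>alpha_source A L\<^esub> \<and> alpha_map A L c = \<zero>\<^bsub>alpha_target A L\<^esub>)"
proof -
  obtain v where v: "ordered_basis (alpha_source A L) (nat (twist_D A - h + 1)) v" using alpha_source_basis by (rule exE)
  show ?thesis unfolding alpha_source_def alpha_map_def alpha_target_def
    by (rule kmod_image_map.lin_rank_less_iff[OF connecting_linear v[unfolded alpha_source_def]])
qed

end

lemma essential_card_ge_2:
  fixes A :: "(3 \<Rightarrow> 'k::field) set set"
  assumes "line_arrangement A" "essential A" "L \<in> A"
  shows "2 \<le> card A"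
proof (rule ccontr)
  assume "\<not> 2 \<le> card A"
  then have "A = {L}"
    using assms(1,3) card_le_Suc0_iff_eq[of A] by (auto simp: line_arrangement_def)
  interpret plane_line L by standard (use assms in \<open>simp add: line_arrangement_def\<close>)
  have "p \<noteq> (\<lambda>i. 0)" using u(1) by (auto simp: dot_def)
  then show False using assms(2) p_in unfolding essential_def \<open>A = {L}\<close> by blast
qed

theorem theorem4p7:
  fixes A :: "(3 \<Rightarrow> 'k::field_char_0) set set" and L :: "(3 \<Rightarrow> 'k) set" and d :: nat
  assumes "line_arrangement A" and "card A = d" and "essential A" and "L \<in> A"
  shows "(odd d \<longrightarrow>
           (L \<in> jump_lines A \<longleftrightarrow>
              real (card (restricted_arr A L)) \<ge> (real d + 3) / 2 \<or>
              det_vanishes (alpha_source A L) (alpha_target A L) (alpha_map A L)))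
       \<and> (even d \<longrightarrow>
           (L \<in> jump_lines A \<longleftrightarrow>
              real (card (restricted_arr A L)) \<ge> (real d + 4) / 2 \<or>
              real (lin_rank (alpha_target A L) (alpha_map A L) (alpha_source A L))
                < real d / 2 - real (card (restricted_arr A L))))"
proof (intro conjI impI)
  interpret X: arrangement_line A L
    by standard (use assms essential_card_ge_2[of A L] in simp_all)
  have d: "X.d = int d" by (simp add: X.d_def assms(2))
  show "L \<in> jump_lines A \<longleftrightarrow> real (card (restricted_arr A L)) \<ge> (real d + 3) / 2 \<or>
      det_vanishes (alpha_source A L) (alpha_target A L) (alpha_map A L)" if odd: "odd d"
  proof -
    obtain m where m: "d = 2 * m + 1" using odd by (rule oddE)
    have t: "twist_D A = int m" by (simp add: twist_D_def norm_twist_def assms(2) m)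
    have "twist_D A - X.h + 1 = X.d - X.h - twist_D A" by (simp add: t d m)
    \<comment> \<open>Both sides say h \<ge> m + 2; in the even case below the same bound is (d + 4)
      / 2.\<close>
    moreover have "0 \<le> twist_D A - 1 + (X.h - X.d) \<longleftrightarrow> real (card (restricted_arr A L)) \<ge> (real d + 3) / 2"
      by (simp add: t d m X.h_def) linarith
    ultimately show ?thesis using X.jump_line_iff X.alpha_det_vanishes_iff by simp
  qed
  show "L \<in> jump_lines A \<longleftrightarrow> real (card (restricted_arr A L)) \<ge> (real d + 4) / 2 \<or>
      real (lin_rank (alpha_target A L) (alpha_map A L) (alpha_source A L))
        < real d / 2 - real (card (restricted_arr A L))" if even: "even d"
  proof -
    obtain m where m: "d = 2 * m" using even by (rule evenE)
    have t: "twist_D A = int m - 1" by (simp add: twist_D_def norm_twist_def assms(2) m)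
    \<comment> \<open>The untruncated dimension is m - h. Truncating it is harmless because the rank
      r is never negative.\<close>
    have "r < nat (twist_D A - X.h + 1) \<longleftrightarrow> real r < real d / 2 - real (card (restricted_arr A L))" for r
      by (simp add: t m X.h_def) linarith
    moreover have "0 \<le> twist_D A - 1 + (X.h - X.d) \<longleftrightarrow> real (card (restricted_arr A L)) \<ge> (real d + 4) / 2"
      by (simp add: t d m X.h_def) linarith
    ultimately show ?thesis using X.jump_line_iff X.alpha_rank_less_iff by simp
  qed
qed

end
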